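(* Let $\mathcal D=\{a_1,a_2,a_3\}\subset\mathbb{CP}^1$ be any three distinct points. Every irreducible representation $\chi:\pi_1(\mathbb{CP}^1\setminus\mathcal D)\to GL(2,\mathbb C)$ is realized as the monodromy representation of a Riemann equation with singular points $a_1,a_2,a_3$.
   Context: A Riemann equation with singular points $\mathcal D=\{a_1,a_2,a_3\}$ is a second order linear differential equation $y''+b_1(z)y'+b_2(z)y=0$ on the Riemann sphere whose coefficients are holomorphic outside $\mathcal D$ (with every point of $\mathbb{CP}^1\setminus\mathcal D$, including $\infty$ in the local coordinate $1/z$ if $\infty\notin\mathcal D$, being an ordinary point) and which is Fuchsian at each $a_i$: in a local coordinate $t$ centred at $a_i$, the coefficient of the $(2-j)$-th derivative has a pole of order at most $j$, $j=1,2$. Monodromy: continuing a basis (row) $Y$ of the two-dimensional solution space near a base point along a loop $\gamma$ in $\mathbb{CP}^1\setminus\mathcal D$ gives another basis $Y^*$ with $Y=Y^*G_\gamma$, $G_\gamma\in GL(2,\mathbb C)$. The matrix depends only on the homotopy class of $\gamma$, and $[\gamma]\mapsto G_\gamma$ is the monodromy representation $\pi_1(\mathbb{CP}^1\setminus\mathcal D)\to GL(2,\mathbb C)$, defined up to simultaneous conjugation (choice of basis). An equation realizes $\chi$ if $\chi$ is its monodromy representation in some basis of solutions. The group $\pi_1(\mathbb{CP}^1\setminus\mathcal D)$ is generated by loops around $a_1,a_2,a_3$ whose product is trivial (so it is free on two generators). *)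

theory Defs
  imports "HOL-Complex_Analysis.Complex_Analysis" "HOL-Algebra.Group"
begin

datatype riemann_sphere = Fin complex | Inf

text \<open>The parametrization of the sphere minus the origin by the local coordinate \<open>w = 1/z\<close>.\<close>

definition recip :: "complex \<Rightarrow> riemann_sphere" where
  "recip w = (if w = 0 then Inf else Fin (1 / w))"

text \<open>The topology glued from the two charts \<open>Fin\<close> and \<open>recip\<close>.\<close>

instantiation riemann_sphere :: topological_space
begin

definition open_riemann_sphere :: "riemann_sphere set \<Rightarrow> bool" where
  "open_riemann_sphere U \<longleftrightarrow> open (Fin -` U) \<and> open (recip -` U)"

instance
  by standard (auto simp: open_riemann_sphere_def vimage_Union)

end

definition holomorphic_on_sphere :: "(riemann_sphere \<Rightarrow> complex) \<Rightarrow> riemann_sphere set \<Rightarrow> bool" where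
  "holomorphic_on_sphere f U \<longleftrightarrow>
     (\<lambda>z. f (Fin z)) holomorphic_on (Fin -` U) \<and> (\<lambda>w. f (recip w)) holomorphic_on (recip -` U)"


definition pole_order_le :: "(complex \<Rightarrow> complex) \<Rightarrow> complex \<Rightarrow> nat \<Rightarrow> bool" where
  "pole_order_le f a n \<longleftrightarrow>
     (\<exists>g. g analytic_on {a} \<and> (\<forall>\<^sub>F z in at a. f z = g z / (z - a) ^ n))"

text \<open>
  An equation \<open>y'' + b1(z) y' + b2(z) y = 0\<close> is given by its coefficients \<open>b1\<close>, \<open>b2\<close> in the affine
  coordinate \<open>z\<close>. Substituting \<open>y(z) = u(1/z)\<close>, so that \<open>y' = - w^2 u'\<close> and
  \<open>y'' = w^4 u'' + 2 w^3 u'\<close>, turns it into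
  \<open>u'' + (2/w - b1(1/w)/w^2) u' + (b2(1/w)/w^4) u = 0\<close>.
\<close>

definition coeff1_inf :: "(complex \<Rightarrow> complex) \<Rightarrow> complex \<Rightarrow> complex" where
  "coeff1_inf b1 w = 2 / w - b1 (1 / w) / w ^ 2"

definition coeff2_inf :: "(complex \<Rightarrow> complex) \<Rightarrow> complex \<Rightarrow> complex" where
  "coeff2_inf b2 w = b2 (1 / w) / w ^ 4"

text \<open>At \<open>Inf\<close>, being ordinary means that the singularity of the transformed coefficients at
  \<open>w = 0\<close> is removable; the value of these coefficients at \<open>0\<close> itself is an artefact of
  division by zero.\<close>

fun ordinary_at :: "(complex \<Rightarrow> complex) \<Rightarrow> (complex \<Rightarrow> complex) \<Rightarrow> riemann_sphere \<Rightarrow> bool" where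
  "ordinary_at b1 b2 (Fin a) \<longleftrightarrow> b1 analytic_on {a} \<and> b2 analytic_on {a}"
| "ordinary_at b1 b2 Inf \<longleftrightarrow> pole_order_le (coeff1_inf b1) 0 0 \<and> pole_order_le (coeff2_inf b2) 0 0"

fun fuchsian_at :: "(complex \<Rightarrow> complex) \<Rightarrow> (complex \<Rightarrow> complex) \<Rightarrow> riemann_sphere \<Rightarrow> bool" where
  "fuchsian_at b1 b2 (Fin a) \<longleftrightarrow> pole_order_le b1 a 1 \<and> pole_order_le b2 a 2"
| "fuchsian_at b1 b2 Inf \<longleftrightarrow> pole_order_le (coeff1_inf b1) 0 1 \<and> pole_order_le (coeff2_inf b2) 0 2"

definition riemann_equation ::
    "riemann_sphere set \<Rightarrow> (complex \<Rightarrow> complex) \<Rightarrow> (complex \<Rightarrow> complex) \<Rightarrow> bool" where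
  "riemann_equation D b1 b2 \<longleftrightarrow>
     card D = 3 \<and> (\<forall>p. p \<notin> D \<longrightarrow> ordinary_at b1 b2 p) \<and> (\<forall>p\<in>D. fuchsian_at b1 b2 p)"

text \<open>A solution near \<open>Inf\<close> is holomorphic in \<open>w\<close> at \<open>w = 0\<close>; the transformed equation at that
  single point then follows from the one at the finite points by continuity.\<close>

definition solution_near ::
    "(complex \<Rightarrow> complex) \<Rightarrow> (complex \<Rightarrow> complex) \<Rightarrow> riemann_sphere \<Rightarrow> (riemann_sphere \<Rightarrow> complex) \<Rightarrow> bool" where
  "solution_near b1 b2 p f \<longleftrightarrow>
     (\<exists>U. open U \<and> p \<in> U \<and> holomorphic_on_sphere f U \<and>
          (\<forall>z. Fin z \<in> U \<longrightarrow>
             deriv (deriv (\<lambda>z. f (Fin z))) z + b1 z * deriv (\<lambda>z. f (Fin z)) z + b2 z * f (Fin z) = 0))"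

text \<open>A basis of the space of germs at \<open>p\<close> of solutions, arranged as a row.\<close>

definition solution_basis ::
    "(complex \<Rightarrow> complex) \<Rightarrow> (complex \<Rightarrow> complex) \<Rightarrow> riemann_sphere \<Rightarrow> (riemann_sphere \<Rightarrow> complex ^ 2) \<Rightarrow> bool" where
  "solution_basis b1 b2 p Y \<longleftrightarrow>
     (\<forall>i. solution_near b1 b2 p (\<lambda>x. Y x $ i)) \<and>
     (\<forall>f. solution_near b1 b2 p f \<longrightarrow>
        (\<exists>!c :: complex ^ 2. \<forall>\<^sub>F x in nhds p. f x = (\<Sum>i\<in>UNIV. c $ i * Y x $ i)))"


text \<open>\<open>F t\<close> represents the germ at \<open>\<gamma> t\<close> obtained by continuation along \<open>\<gamma>\<close> up to time \<open>t\<close>.\<close>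

definition analytic_continuation ::
    "(real \<Rightarrow> riemann_sphere) \<Rightarrow> (real \<Rightarrow> riemann_sphere \<Rightarrow> complex) \<Rightarrow> bool" where
  "analytic_continuation \<gamma> F \<longleftrightarrow>
     (\<forall>t\<in>{0..1}. \<exists>U. open U \<and> \<gamma> t \<in> U \<and> holomorphic_on_sphere (F t) U \<and>
        (\<forall>\<^sub>F s in at t within {0..1}. \<gamma> s \<in> U \<and> (\<forall>\<^sub>F x in nhds (\<gamma> s). F s x = F t x)))"

definition continues_along ::
    "(real \<Rightarrow> riemann_sphere) \<Rightarrow> (riemann_sphere \<Rightarrow> complex) \<Rightarrow> (riemann_sphere \<Rightarrow> complex) \<Rightarrow> bool" where
  "continues_along \<gamma> f g \<longleftrightarrow>
     (\<exists>F. analytic_continuation \<gamma> F \<and>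
          (\<forall>\<^sub>F x in nhds (pathstart \<gamma>). F 0 x = f x) \<and>
          (\<forall>\<^sub>F x in nhds (pathfinish \<gamma>). F 1 x = g x))"


definition loops_at :: "'a::topological_space set \<Rightarrow> 'a \<Rightarrow> (real \<Rightarrow> 'a) set" where
  "loops_at S p = {\<gamma>. path \<gamma> \<and> path_image \<gamma> \<subseteq> S \<and> pathstart \<gamma> = p \<and> pathfinish \<gamma> = p}"

definition homotopy_class :: "'a::topological_space set \<Rightarrow> (real \<Rightarrow> 'a) \<Rightarrow> (real \<Rightarrow> 'a) set" where
  "homotopy_class S \<gamma> = {\<delta>. homotopic_paths S \<gamma> \<delta>}"

definition fundamental_group :: "'a::topological_space set \<Rightarrow> 'a \<Rightarrow> (real \<Rightarrow> 'a) set monoid" where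
  "fundamental_group S p =
     \<lparr>carrier = homotopy_class S ` loops_at S p,
      mult = (\<lambda>A B. \<Union>\<gamma>\<in>A. \<Union>\<delta>\<in>B. homotopy_class S (\<gamma> +++ \<delta>)),
      one = homotopy_class S (\<lambda>_. p)\<rparr>"

definition GL2 :: "(complex ^ 2 ^ 2) monoid" where
  "GL2 = \<lparr>carrier = {A. invertible A}, mult = (**), one = mat 1\<rparr>"

definition irreducible_rep :: "('g, 'm) monoid_scheme \<Rightarrow> ('g \<Rightarrow> complex ^ 2 ^ 2) \<Rightarrow> bool" where
  "irreducible_rep G \<rho> \<longleftrightarrow>
     (\<forall>V. vec.subspace V \<and> (\<forall>g\<in>carrier G. \<forall>v\<in>V. \<rho> g *v v \<in> V) \<longrightarrow> V = {0} \<or> V = UNIV)"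

text \<open>The relation \<open>Y = Y\<^sup>* G\<close> between a row of germs and its continuation along the loop. It makes
  the monodromy multiplicative for \<open>\<gamma> +++ \<delta>\<close>, where \<open>\<gamma>\<close> is traversed first.\<close>

definition realizes_monodromy ::
    "riemann_sphere set \<Rightarrow> riemann_sphere \<Rightarrow> (complex \<Rightarrow> complex) \<Rightarrow> (complex \<Rightarrow> complex) \<Rightarrow>
     ((real \<Rightarrow> riemann_sphere) set \<Rightarrow> complex ^ 2 ^ 2) \<Rightarrow> bool" where
  "realizes_monodromy D p b1 b2 \<rho> \<longleftrightarrow>
     (\<exists>Y. solution_basis b1 b2 p Y \<and>
        (\<forall>\<gamma>\<in>loops_at (- D) p. \<exists>Y'.
           (\<forall>i. continues_along \<gamma> (\<lambda>x. Y x $ i) (\<lambda>x. Y' x $ i)) \<and>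
           (\<forall>\<^sub>F x in nhds p. Y x = Y' x v* \<rho> (homotopy_class (- D) \<gamma>))))"

end

theory Submission
  imports Defs
begin

text \<open>
  A Moebius transformation moves the singular points to \<open>0\<close>, \<open>1\<close>, \<open>\<infinity>\<close>. Removing the real axis except
  for one of the intervals \<open>(-\<infinity>, 0)\<close>, \<open>(0, 1)\<close>, \<open>(1, \<infinity>)\<close> from the plane gives three starlike sheets
  which cover \<open>\<complex> \<setminus> {0, 1}\<close> and pairwise meet in the two half planes. On each sheet Riemann's equation has
  a global basis of solutions; normalize these bases to agree on the upper half plane, and let \<open>K i j\<close> be
  the change of basis on the lower one. For adjacent sheets it is the monodromy around one singular
  point: its determinant is read off from the Wronskian, and one eigenvalue from a hypergeometric
  solution at that point, so its characteristic polynomial is given by the local exponents.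

  The given representation yields matrices \<open>switch i j\<close> in the same way, from loops that cross the real
  axis through two of the intervals. A flatness argument along loops shows that these matrices inherit
  irreducibility. The exponents are chosen to match the characteristic polynomials; Fuchs' relation can
  be met because the determinants multiply to one. An irreducible pair \<open>(A, B)\<close> of 2 by 2 matrices is
  determined up to conjugation by the traces and determinants of \<open>A\<close>, \<open>B\<close> and \<open>A B\<close>, so both families
  of matrices are conjugate. The conjugation then identifies the local system of solutions with that of
  the representation, and the analytic continuation of the basis along a loop is written down directly
  on the sheets.
\<close>

section \<open>Rigidity of pairs of 2 by 2 matrices\<close>

text \<open>Three singular points leave no accessory parameter: the six exponents fix the equation,
  and an irreducible pair of 2 by 2 matrices is fixed by five invariants. Exponents are logarithms
  of eigenvalues and so carry free integers; this freedom is what Fuchs' relation consumes. The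
  obstacle is the resonant case, where exponents differ by an integer and logarithms may occur. It
  never has to be singled out: only characteristic polynomials are compared, the exponent of larger
  real part always admits a power series solution, and its eigenvalue together with the determinant
  already gives the trace. Irreducibility has to be known on one side only, since equal invariants
  carry it over to the other pair. No generators of the fundamental group are chosen. A loop enters
  only through its holonomy against frames on the sheets, which is locally constant in time, so
  connectedness of the unit interval takes the place of a presentation of the group.\<close>

lemmas mat2_simps = vec_eq_iff forall_2 sum_2 matrix_vector_mult_def matrix_matrix_mult_def
  vector_matrix_mult_def trace_def det_2

lemma Cayley_Hamilton_2:
  fixes B :: "complex ^ 2 ^ 2"
  shows "B *v (B *v v) = trace B *s (B *v v) - det B *s v"
  by (auto simp: mat2_simps algebra_simps)

text \<open>This is Cayley-Hamilton for \<open>A + B\<close> minus the same identity for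
  \<open>A\<close> and for \<open>B\<close>; the mixed term of the determinant is
  \<open>trace A * trace B - trace (A ** B)\<close>.\<close>

lemma Cayley_Hamilton_2_polarized:
  fixes A B :: "complex ^ 2 ^ 2"
  shows "A *v (B *v v) = trace A *s (B *v v) + trace B *s (A *v v) - B *v (A *v v)
           + (trace (A ** B) - trace A * trace B) *s v"
  by (auto simp: mat2_simps algebra_simps)

lemma singular_2_kernel:
  fixes a b c d :: complex
  assumes "a * d = b * c"
  obtains x y where "x \<noteq> 0 \<or> y \<noteq> 0" "a * x + b * y = 0" "c * x + d * y = 0"
proof (cases "a = 0 \<and> b = 0")
  case True
  show ?thesis
  proof (cases "c = 0 \<and> d = 0")
    case True with \<open>a = 0 \<and> b = 0\<close> show ?thesis by (intro that[of 1 0]) auto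
  next
    case False with True show ?thesis by (intro that[of d "- c"]) (auto simp: algebra_simps)
  qed
next
  case False
  with assms show ?thesis by (intro that[of b "- a"]) (auto simp: algebra_simps)
qed

lemma eigenvector_2:
  fixes A :: "complex ^ 2 ^ 2"
  assumes "l ^ 2 - trace A * l + det A = 0"
  obtains v where "v \<noteq> 0" "A *v v = l *s v"
proof -
  have "(A$1$1 - l) * (A$2$2 - l) = A$1$2 * A$2$1"
    using assms by (simp add: mat2_simps algebra_simps power2_eq_square)
  then obtain x y where "x \<noteq> 0 \<or> y \<noteq> 0" "(A$1$1 - l) * x + A$1$2 * y = 0" "A$2$1 * x + (A$2$2 - l) * y = 0"
    using singular_2_kernel by blast
  then show ?thesis
    by (intro that[of "vector [x, y]"]) (auto simp: mat2_simps algebra_simps)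
qed

lemma quadratic_roots:
  fixes b c :: complex
  obtains x y where "x + y = b" "x * y = c"
proof
  let ?s = "csqrt (b ^ 2 - 4 * c)"
  show "(b + ?s) / 2 + (b - ?s) / 2 = b" by (simp add: field_simps)
  have "(b + ?s) * (b - ?s) = b ^ 2 - ?s ^ 2" by (simp add: algebra_simps power2_eq_square)
  then show "(b + ?s) / 2 * ((b - ?s) / 2) = c" by simp
qed

lemma dependent_2:
  fixes v w :: "complex ^ 2"
  assumes "v \<noteq> 0" "v$1 * w$2 = v$2 * w$1"
  obtains k where "w = k *s v"
proof (cases "v$1 = 0")
  case True
  then show ?thesis using assms
    by (intro that[of "w$2 / v$2"]) (auto simp: mat2_simps)
next
  case False
  then show ?thesis using assms
    by (intro that[of "w$1 / v$1"]) (auto simp: mat2_simps field_simps)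
qed

definition common_eigenvector :: "complex ^ 2 ^ 2 \<Rightarrow> complex ^ 2 ^ 2 \<Rightarrow> complex ^ 2 \<Rightarrow> bool" where
  "common_eigenvector A B v \<longleftrightarrow> v \<noteq> 0 \<and> (\<exists>k. A *v v = k *s v) \<and> (\<exists>k. B *v v = k *s v)"

text \<open>In the basis \<open>v\<close>, \<open>B v\<close>, where \<open>v\<close> is an eigenvector of \<open>A\<close>, both matrices are
  determined by the five invariants and the chosen eigenvalue.\<close>

lemma cyclic_normal_form:
  fixes A B :: "complex ^ 2 ^ 2"
  assumes v: "v \<noteq> 0" "A *v v = l *s v" and nc: "\<not> common_eigenvector A B v"
  defines "M \<equiv> vector [vector [v$1, (B *v v)$1], vector [v$2, (B *v v)$2]] :: complex ^ 2 ^ 2"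
  shows "invertible M"
    "A ** M = M ** vector [vector [l, trace (A ** B) - (trace A - l) * trace B], vector [0, trace A - l]]"
    "B ** M = M ** vector [vector [0, - det B], vector [1, trace B]]"
proof -
  have "det M \<noteq> 0"
  proof
    assume "det M = 0"
    then have "v$1 * (B *v v)$2 = v$2 * (B *v v)$1" by (simp add: M_def det_2)
    then obtain k where "B *v v = k *s v" using dependent_2 v by blast
    then show False using nc v by (auto simp: common_eigenvector_def)
  qed
  then show "invertible M" by (simp add: invertible_det_nz)
  have "A *v (B *v v) = (trace A - l) *s (B *v v) + (trace (A ** B) - (trace A - l) * trace B) *s v"
    unfolding Cayley_Hamilton_2_polarized[of A B v] v(2)
    by (simp add: mat2_simps algebra_simps)
  with v(2) show "A ** M = M ** vector [vector [l, trace (A ** B) - (trace A - l) * trace B], vector [0, trace A - l]]"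
    unfolding M_def by (simp add: vec_eq_iff forall_2 matrix_matrix_mult_def sum_2 matrix_vector_mult_def[of A] algebra_simps)
  show "B ** M = M ** vector [vector [0, - det B], vector [1, trace B]]"
    using Cayley_Hamilton_2[of B v] unfolding M_def
    by (simp add: vec_eq_iff forall_2 matrix_matrix_mult_def sum_2 matrix_vector_mult_def mult.commute)
qed

text \<open>Both pairs are brought to the same normal form, and \<open>T\<close> is the quotient of
  the two changes of basis. The normal form of the primed pair needs that it has no common
  eigenvector either: such a vector would impose relations on the five invariants under which
  \<open>A\<close>, \<open>B\<close> have a common eigenvector as well.\<close>

lemma simultaneously_conjugate_2:
  fixes A B A' B' :: "complex ^ 2 ^ 2"
  assumes tr: "trace A' = trace A" "trace B' = trace B" "trace (A' ** B') = trace (A ** B)"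
    and dt: "det A' = det A" "det B' = det B"
    and irr: "\<And>v. \<not> common_eigenvector A B v"
  obtains T where "invertible T" "A' ** T = T ** A" "B' ** T = T ** B"
proof -
  obtain l m where lm: "l + m = trace A" "l * m = det A" using quadratic_roots by blast
  then have root: "l ^ 2 - trace A * l + det A = 0"
    by (metis (no_types, lifting) add_diff_cancel_left' diff_add_cancel distrib_right minus_diff_eq mult.commute power2_eq_square right_minus_eq uminus_add_conv_diff)
  obtain v where v: "v \<noteq> 0" "A *v v = l *s v" using eigenvector_2[OF root] .
  obtain v' where v': "v' \<noteq> 0" "A' *v v' = l *s v'" using eigenvector_2[of l A'] root tr dt by metis
  have mu: "m = trace A - l" using lm by (simp add: algebra_simps)
  note nf = cyclic_normal_form[OF v irr]
  have "\<not> common_eigenvector A' B' v'"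
  proof
    assume "common_eigenvector A' B' v'"
    then obtain k where k: "B' *v v' = k *s v'" by (auto simp: common_eigenvector_def)
    define k' where "k' = trace B - k"
    have "k *s (k *s v') = trace B *s (k *s v') - det B *s v'"
      using Cayley_Hamilton_2[of B' v'] k tr dt by (simp add: vector_scalar_commute)
    then have "(k * k' - det B) *s v' = 0"
      by (simp add: k'_def mat2_simps algebra_simps)
    then have detB: "det B = k * k'" by (metis right_minus_eq vector_mul_eq_0 v'(1))
    have "A' *v (k *s v') = trace A *s (k *s v') + trace B *s (l *s v') - B' *v (l *s v')
           + (trace (A ** B) - trace A * trace B) *s v'"
      using Cayley_Hamilton_2_polarized[of A' B' v'] k v' tr by simp
    then have "(l * k + m * k' - trace (A ** B)) *s v' = 0"
      unfolding vector_scalar_commute v'(2) k lm(1)[symmetric] k'_def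
      by (simp add: mat2_simps algebra_simps)
    then have trAB: "trace (A ** B) = l * k + m * k'" by (metis right_minus_eq vector_mul_eq_0 v'(1))
    have trB: "trace B = k + k'" by (simp add: k'_def)
    \<comment> \<open>By Cayley-Hamilton \<open>(B - k') (B - k) = 0\<close>, so \<open>w\<close> is
      an eigenvector of \<open>B\<close> for \<open>k'\<close>. The relation for
      \<open>trace (A ** B)\<close> makes it an eigenvector of \<open>A\<close> for the other
      eigenvalue \<open>m\<close>.\<close>
    define w where "w = k *s v - B *v v"
    have "w \<noteq> 0"
      using irr[of v] v by (metis common_eigenvector_def right_minus_eq w_def)
    moreover have "B *v w = k' *s w"
      unfolding w_def matrix_vector_mult_diff_distrib vector_scalar_commute Cayley_Hamilton_2[of B v] detB trB
      by (simp add: mat2_simps algebra_simps)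
    moreover have "A *v w = m *s w"
      unfolding w_def matrix_vector_mult_diff_distrib vector_scalar_commute
        Cayley_Hamilton_2_polarized[of A B v] trAB trB v(2) lm(1)[symmetric]
      by (simp add: mat2_simps algebra_simps)
    ultimately show False using irr[of w] unfolding common_eigenvector_def by blast
  qed
  note nf' = cyclic_normal_form[OF v' this, unfolded tr dt]
  obtain M NA NB M' :: "complex ^ 2 ^ 2" where *: "invertible M" "A ** M = M ** NA" "B ** M = M ** NB"
     "invertible M'" "A' ** M' = M' ** NA" "B' ** M' = M' ** NB"
    using nf nf' by blast
  obtain Q where Q: "M ** Q = mat 1" "Q ** M = mat 1" using *(1) by (auto simp: invertible_def)
  have conj: "X' ** (M' ** Q) = (M' ** Q) ** X" if "X ** M = M ** N" "X' ** M' = M' ** N" for X X' N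
  proof -
    have "X' ** (M' ** Q) = M' ** N ** Q" using that by (simp add: matrix_mul_assoc)
    also have "\<dots> = M' ** (Q ** M) ** N ** Q" by (simp add: Q)
    also have "\<dots> = M' ** Q ** (M ** N) ** Q" by (simp add: matrix_mul_assoc)
    also have "\<dots> = M' ** Q ** X ** (M ** Q)" by (simp add: that(1)[symmetric] matrix_mul_assoc)
    finally show ?thesis by (simp add: Q)
  qed
  have "invertible Q" using Q unfolding invertible_def by blast
  then have "invertible (M' ** Q)" using *(4) invertible_mult by blast
  then show ?thesis using that[of "M' ** Q"] conj *(2,3,5,6) by blast
qed

section \<open>Second order linear equations\<close>

text \<open>The equation as a first order system. Keeping \<open>y'\<close> as a separate function
  lets constant matrices act on values and derivatives alike, and these two determine a solution at
  a single point.\<close>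

definition ode2 :: "(complex \<Rightarrow> complex) \<Rightarrow> (complex \<Rightarrow> complex) \<Rightarrow> complex set \<Rightarrow>
    (complex \<Rightarrow> complex) \<Rightarrow> (complex \<Rightarrow> complex) \<Rightarrow> bool" where
  "ode2 p q S y y' \<longleftrightarrow>
     (\<forall>z\<in>S. (y has_field_derivative y' z) (at z) \<and>
            (y' has_field_derivative - (p z * y' z + q z * y z)) (at z))"

lemma ode2_subset: "ode2 p q S y y' \<Longrightarrow> T \<subseteq> S \<Longrightarrow> ode2 p q T y y'"
  by (auto simp: ode2_def)

lemma ode2_add_scaled:
  assumes "ode2 p q S y1 y1'" "ode2 p q S y2 y2'"
  shows "ode2 p q S (\<lambda>z. c1 * y1 z + c2 * y2 z) (\<lambda>z. c1 * y1' z + c2 * y2' z)"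
  using assms unfolding ode2_def
  by (auto intro!: derivative_eq_intros simp: algebra_simps)

lemma ode2_holomorphic: "ode2 p q S y y' \<Longrightarrow> y holomorphic_on S" "ode2 p q S y y' \<Longrightarrow> y' holomorphic_on S"
  unfolding ode2_def holomorphic_on_def field_differentiable_def
  by (meson DERIV_subset has_field_derivative_at_within)+

lemma wronskian_has_field_derivative:
  assumes "ode2 p q S y1 y1'" "ode2 p q S y2 y2'" "z \<in> S"
  shows "((\<lambda>z. y1 z * y2' z - y1' z * y2 z) has_field_derivative
          - p z * (y1 z * y2' z - y1' z * y2 z)) (at z)"
  using assms unfolding ode2_def
  by (auto intro!: derivative_eq_intros simp: algebra_simps)

lemma proportional_if_same_log_derivative:
  assumes "open S" "connected S"
    and "\<And>z. z \<in> S \<Longrightarrow> (f has_field_derivative p z * f z) (at z)"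
    and "\<And>z. z \<in> S \<Longrightarrow> (g has_field_derivative p z * g z) (at z)"
    and "\<And>z. z \<in> S \<Longrightarrow> g z \<noteq> (0::complex)"
  obtains c where "\<And>z. z \<in> S \<Longrightarrow> f z = c * g z"
proof -
  have "((\<lambda>z. f z / g z) has_field_derivative 0) (at z)" if "z \<in> S" for z
    using assms(3-5)[OF that] by (auto intro!: derivative_eq_intros)
  then have "(\<lambda>z. f z / g z) constant_on S"
    by (intro has_field_derivative_0_imp_constant_on) (use assms in auto)
  then obtain c where "\<And>z. z \<in> S \<Longrightarrow> f z / g z = c"
    by (auto simp: constant_on_def)
  then have "f z = c * g z" if "z \<in> S" for z
    using assms(5) that by (auto simp: field_simps)
  then show ?thesis using that by blast
qed

text \<open>By Cramer's rule the coefficients of \<open>y\<close> are quotients of Wronskians, and these are constant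
  because all Wronskians solve the same first order equation.\<close>

lemma ode2_span:
  assumes S: "open S" "connected S"
    and y: "ode2 p q S y y'" "ode2 p q S y1 y1'" "ode2 p q S y2 y2'"
    and W: "\<And>z. z \<in> S \<Longrightarrow> y1 z * y2' z - y1' z * y2 z \<noteq> 0"
  obtains c1 c2 where "\<And>z. z \<in> S \<Longrightarrow> y z = c1 * y1 z + c2 * y2 z"
    "\<And>z. z \<in> S \<Longrightarrow> y' z = c1 * y1' z + c2 * y2' z"
proof -
  let ?W = "\<lambda>z. y1 z * y2' z - y1' z * y2 z"
  obtain c1 where c1: "\<And>z. z \<in> S \<Longrightarrow> y z * y2' z - y' z * y2 z = c1 * ?W z"
    using proportional_if_same_log_derivative[OF S wronskian_has_field_derivative[OF y(1,3)]
        wronskian_has_field_derivative[OF y(2,3)] W] by blast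
  obtain c2 where c2: "\<And>z. z \<in> S \<Longrightarrow> y1 z * y' z - y1' z * y z = c2 * ?W z"
    using proportional_if_same_log_derivative[OF S wronskian_has_field_derivative[OF y(2,1)]
        wronskian_has_field_derivative[OF y(2,3)] W] by blast
  have "?W z * y z = ?W z * (c1 * y1 z + c2 * y2 z)"
       "?W z * y' z = ?W z * (c1 * y1' z + c2 * y2' z)" if "z \<in> S" for z
    using c1[OF that] c2[OF that] by algebra+
  then show ?thesis using W that by (metis mult_left_cancel)
qed

section \<open>Existence of solutions on starlike domains\<close>

lemma primitive_bound_on_segment:
  fixes a z :: complex
  assumes der: "\<And>x. x \<in> closed_segment a z \<Longrightarrow> (F has_field_derivative f x) (at x)"
    and bd: "\<And>x. x \<in> closed_segment a z \<Longrightarrow> norm (f x) \<le> C * norm (x - a) ^ n / fact n"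
    and "F a = 0"
  shows "norm (F z) \<le> C * norm (z - a) ^ Suc n / fact (Suc n)"
proof -
  define h where "h t = a + of_real t * (z - a)" for t :: real
  let ?\<phi> = "\<lambda>t::real. C * norm (z - a) ^ Suc n * t ^ Suc n / fact (Suc n)"
  have h: "h t \<in> closed_segment a z" if "t \<in> {0..1}" for t
    using that unfolding h_def closed_segment_def
    by (intro CollectI exI[of _ t]) (auto simp: algebra_simps scaleR_conv_of_real)
  have d1: "((\<lambda>t. F (h t)) has_vector_derivative (z - a) * f (h t)) (at t)" if "t \<in> {0..1}" for t
  proof -
    have "(h has_vector_derivative (z - a)) (at t)"
      unfolding h_def by (auto intro!: derivative_eq_intros)
    from field_vector_diff_chain_at[OF this der[OF h[OF that]]]
    show ?thesis by (simp add: o_def)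
  qed
  have d2: "(?\<phi> has_vector_derivative C * norm (z - a) ^ Suc n * t ^ n / fact n) (at t)" for t
    unfolding has_real_derivative_iff_has_vector_derivative [symmetric]
    by (auto intro!: derivative_eq_intros simp: divide_simps simp del: power_Suc of_nat_Suc)
  have "norm (F (h 1) - F (h 0)) \<le> ?\<phi> 1 - ?\<phi> 0"
  proof (rule differentiable_bound_general)
    show "continuous_on {0..1} (\<lambda>t. F (h t))"
      by (intro continuous_at_imp_continuous_on ballI) (use d1 has_vector_derivative_continuous in blast)
    show "continuous_on {0..1} ?\<phi>"
      by (intro continuous_intros) auto
    fix t :: real assume t: "0 < t" "t < 1"
    show "((\<lambda>t. F (h t)) has_vector_derivative (z - a) * f (h t)) (at t)"
      using d1 t by simp
    show "(?\<phi> has_vector_derivative C * norm (z - a) ^ Suc n * t ^ n / fact n) (at t)"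
      by (rule d2)
    have "norm (h t - a) = t * norm (z - a)"
      using t by (simp add: h_def norm_mult)
    then have "norm (f (h t)) \<le> C * (t * norm (z - a)) ^ n / fact n"
      using bd[OF h, of t] t by simp
    then have "norm (z - a) * norm (f (h t)) \<le> norm (z - a) * (C * (t * norm (z - a)) ^ n / fact n)"
      by (intro mult_left_mono) auto
    then show "norm ((z - a) * f (h t)) \<le> C * norm (z - a) ^ Suc n * t ^ n / fact n"
      by (simp add: norm_mult power_mult_distrib mult_ac)
  qed simp
  then show ?thesis using \<open>F a = 0\<close> by (simp add: h_def)
qed

text \<open>\<open>K\<close> is the cone with apex \<open>a\<close> over a small closed ball. The
  coefficients are bounded on it, and it contains every segment along which the Picard estimates
  integrate.\<close>

lemma starlike_compact_neighbourhood:
  fixes a z :: complex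
  assumes "open S" "\<And>x. x \<in> S \<Longrightarrow> closed_segment a x \<subseteq> S" "z \<in> S"
  obtains d K where "d > 0" "compact K" "K \<subseteq> S" "cball z d \<subseteq> K"
    "\<And>x. x \<in> K \<Longrightarrow> closed_segment a x \<subseteq> K"
proof -
  let ?g = "\<lambda>(t::real, w). (1 - t) *\<^sub>R a + t *\<^sub>R w"
  have seg: "?g ` ({0..1} \<times> W) = (\<Union>w\<in>W. closed_segment a w)" for W
    unfolding closed_segment_def by (auto, blast)
  obtain d where d: "d > 0" "cball z d \<subseteq> S"
    using assms open_contains_cball by blast
  let ?K = "\<Union>w\<in>cball z d. closed_segment a w"
  have "compact ?K"
    unfolding seg[symmetric]
    by (intro compact_continuous_image compact_Times continuous_intros)
       (auto intro!: continuous_intros simp: case_prod_unfold)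
  moreover have "?K \<subseteq> S" using assms d by blast
  moreover have "cball z d \<subseteq> ?K" by auto
  moreover have "closed_segment a x \<subseteq> ?K" if "x \<in> ?K" for x
    using that by (meson UN_iff UN_upper ends_in_segment(1) subset_closed_segment subset_trans)
  ultimately show ?thesis using d that by blast
qed

text \<open>Picard iteration, carried out on the whole domain at once: starlikeness provides global
  primitives, and n-fold integration from \<open>a\<close> produces the factor
  \<open>1 / fact n\<close> that beats any local bound of the coefficients.\<close>

lemma ode2_initial_value_problem:
  assumes S: "open S" "a \<in> S" "\<And>x. x \<in> S \<Longrightarrow> closed_segment a x \<subseteq> S"
    and p: "p holomorphic_on S" and q: "q holomorphic_on S"
  obtains y y' where "ode2 p q S y y'" "y a = c" "y' a = c'"
proof -
  have star: "starlike S" using S by (auto simp: starlike_def)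
  define P where "P f = (SOME F. (\<forall>x\<in>S. (F has_field_derivative f x) (at x)) \<and> F a = 0)" for f :: "complex \<Rightarrow> complex"
  have P: "(P f has_field_derivative f x) (at x)" "P f a = 0" if f: "f holomorphic_on S" "x \<in> S" for f x
  proof -
    obtain G where G: "\<forall>x\<in>S. (G has_field_derivative f x) (at x)"
      using holomorphic_starlike_primitive[of S f "{}"] f star S
      by (metis Diff_empty finite.emptyI holomorphic_on_imp_continuous_on holomorphic_on_imp_differentiable_at)
    have "\<exists>F. (\<forall>x\<in>S. (F has_field_derivative f x) (at x)) \<and> F a = 0"
      by (rule exI[of _ "\<lambda>z. G z - G a"]) (use G in \<open>auto intro!: derivative_eq_intros\<close>)
    from someI_ex[OF this] show "(P f has_field_derivative f x) (at x)" "P f a = 0"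
      unfolding P_def using that by auto
  qed
  \<comment> \<open>The entries are successive corrections, not approximations: each pair is the
    primitive, vanishing at \<open>a\<close>, of what the preceding pair contributes to the
    right-hand side. The solution and its derivative are the sums over all n.\<close>
  define N :: "nat \<Rightarrow> (complex \<Rightarrow> complex) \<times> (complex \<Rightarrow> complex)" where
    "N = rec_nat (\<lambda>_. c, \<lambda>_. c') (\<lambda>_ (f, g). (P g, P (\<lambda>z. - (p z * g z + q z * f z))))"
  define f where "f n = fst (N n)" for n
  define g where "g n = snd (N n)" for n
  have f0: "f 0 = (\<lambda>_. c)" and g0: "g 0 = (\<lambda>_. c')"
    and fS: "f (Suc n) = P (g n)" and gS: "g (Suc n) = P (\<lambda>z. - (p z * g n z + q z * f n z))" for n
    by (auto simp: f_def g_def N_def split: prod.splits)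
  have hol: "f n holomorphic_on S \<and> g n holomorphic_on S" for n
  proof (induction n)
    case 0 then show ?case by (simp add: f0 g0)
  next
    case (Suc n)
    then have "(\<lambda>z. - (p z * g n z + q z * f n z)) holomorphic_on S"
      using p q by (intro holomorphic_intros) auto
    from P(1)[OF this] P(1)[of "g n"] Suc show ?case
      unfolding fS gS by (meson S(1) holomorphic_on_open)
  qed
  have holr: "(\<lambda>z. - (p z * g n z + q z * f n z)) holomorphic_on S" for n
    using hol[of n] p q by (intro holomorphic_intros) auto
  \<comment> \<open>The zeroth terms are constants and have derivative 0; after that,
    differentiation lowers the index by one. This shift turns the differentiated series back into
    the series of the right-hand side.\<close>
  define f' where "f' n = (case n of 0 \<Rightarrow> \<lambda>_. 0 | Suc m \<Rightarrow> g m)" for n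
  define g' where "g' n = (case n of 0 \<Rightarrow> \<lambda>_. 0 | Suc m \<Rightarrow> \<lambda>z. - (p z * g m z + q z * f m z))" for n
  have df: "(f n has_field_derivative f' n z) (at z)" if "z \<in> S" for n z
    using P(1)[of "g (n-1)" z] hol[of "n-1"] that by (cases n) (auto simp: f0 fS f'_def)
  have dg: "(g n has_field_derivative g' n z) (at z)" if "z \<in> S" for n z
    using P(1)[of _ z, OF holr[of "n-1"]] that by (cases n) (auto simp: g0 gS g'_def)
  have bound: "\<exists>d h. 0 < d \<and> summable h \<and> (\<forall>n. \<forall>y\<in>ball z d \<inter> S. norm (f n y) \<le> h n \<and> norm (g n y) \<le> h n)"
    if z: "z \<in> S" for z
  proof -
    obtain d K where K: "d > 0" "compact K" "K \<subseteq> S" "cball z d \<subseteq> K"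
      "\<And>x. x \<in> K \<Longrightarrow> closed_segment a x \<subseteq> K"
      using starlike_compact_neighbourhood[OF S(1,3) z] by metis
    have "bounded (p ` K)" "bounded (q ` K)" "bounded ((\<lambda>x. x - a) ` K)"
      using holomorphic_on_subset[OF p K(3)] holomorphic_on_subset[OF q K(3)] K(2)
      by (auto intro!: compact_imp_bounded compact_continuous_image holomorphic_on_imp_continuous_on
          holomorphic_on_diff holomorphic_on_ident holomorphic_on_const)
    then obtain B1 B2 R where B: "\<And>x. x \<in> K \<Longrightarrow> norm (p x) \<le> B1" "\<And>x. x \<in> K \<Longrightarrow> norm (q x) \<le> B2"
       "\<And>x. x \<in> K \<Longrightarrow> norm (x - a) \<le> R"
      unfolding bounded_iff by fast
    \<comment> \<open>The summand 1 accounts for the integrand \<open>g n\<close>, the other two for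
      \<open>p * g n + q * f n\<close>, so one constant serves both components of the
      induction.\<close>
    define M where "M = 1 + \<bar>B1\<bar> + \<bar>B2\<bar>"
    define C where "C = norm c + norm c'"
    have M: "M \<ge> 1" "C \<ge> 0" by (auto simp: M_def C_def)
    have main: "\<forall>x\<in>K. norm (f n x) \<le> C * M ^ n * norm (x - a) ^ n / fact n \<and>
                  norm (g n x) \<le> C * M ^ n * norm (x - a) ^ n / fact n" for n
    proof (induction n)
      case 0 then show ?case by (auto simp: f0 g0 C_def)
    next
      case (Suc n)
      show ?case
      proof (intro ballI conjI)
        fix x assume x: "x \<in> K"
        have "norm (g n w) \<le> C * M ^ Suc n * norm (w - a) ^ n / fact n" if "w \<in> closed_segment a x" for w
        proof -
          have "norm (g n w) \<le> C * M ^ n * norm (w - a) ^ n / fact n"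
            using Suc K(5)[OF x] that by blast
          also have "\<dots> \<le> C * M ^ Suc n * norm (w - a) ^ n / fact n"
            using M by (intro divide_right_mono mult_right_mono mult_left_mono) auto
          finally show ?thesis .
        qed
        then show "norm (f (Suc n) x) \<le> C * M ^ Suc n * norm (x - a) ^ Suc n / fact (Suc n)"
          unfolding fS using hol[of n] P[of "g n"] K(3) K(5)[OF x] S
          by (intro primitive_bound_on_segment[where f="g n"]) auto
        have "norm (- (p w * g n w + q w * f n w)) \<le> C * M ^ Suc n * norm (w - a) ^ n / fact n"
          if "w \<in> closed_segment a x" for w
        proof -
          let ?E = "C * M ^ n * norm (w - a) ^ n / fact n"
          have w: "w \<in> K" using K(5)[OF x] that by blast
          have "norm (- (p w * g n w + q w * f n w)) \<le> norm (p w) * norm (g n w) + norm (q w) * norm (f n w)"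
            by (metis norm_minus_cancel norm_mult norm_triangle_ineq)
          also have "\<dots> \<le> \<bar>B1\<bar> * ?E + \<bar>B2\<bar> * ?E"
            using Suc w B(1)[OF w] B(2)[OF w] by (intro add_mono mult_mono) auto
          also have "\<dots> = (\<bar>B1\<bar> + \<bar>B2\<bar>) * ?E" by (simp only: distrib_right)
          also have "\<dots> \<le> M * ?E"
            using M by (intro mult_right_mono) (auto simp: M_def)
          finally show ?thesis by (simp add: mult_ac)
        qed
        then show "norm (g (Suc n) x) \<le> C * M ^ Suc n * norm (x - a) ^ Suc n / fact (Suc n)"
          unfolding gS using P[OF holr[of n]] K(3) K(5)[OF x] S
          by (intro primitive_bound_on_segment[where f="\<lambda>z. - (p z * g n z + q z * f n z)"]) auto
      qed
    qed
    have "summable (\<lambda>n. C * (M * R) ^ n / fact n)"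
      using summable_mult[OF summable_exp[of "M * R"], of C] by (simp add: divide_inverse mult_ac)
    moreover have "norm (f n y) \<le> C * (M * R) ^ n / fact n \<and> norm (g n y) \<le> C * (M * R) ^ n / fact n"
      if "y \<in> ball z d \<inter> S" for n y
    proof -
      have y: "y \<in> K" using that K(4) by auto
      have "C * M ^ n * norm (y - a) ^ n / fact n \<le> C * M ^ n * R ^ n / fact n"
        using B(3)[OF y] M by (intro divide_right_mono mult_left_mono power_mono) auto
      then show ?thesis using main[of n] y by (fastforce simp: power_mult_distrib mult.assoc)
    qed
    ultimately show ?thesis using K(1) by blast
  qed
  have boundf: "\<exists>d h. 0 < d \<and> summable h \<and> (\<forall>\<^sub>F n in sequentially. \<forall>y\<in>ball z d \<inter> S. norm (f n y) \<le> h n)"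
    and boundg: "\<exists>d h. 0 < d \<and> summable h \<and> (\<forall>\<^sub>F n in sequentially. \<forall>y\<in>ball z d \<inter> S. norm (g n y) \<le> h n)"
    if z: "z \<in> S" for z
  proof -
    obtain d h where "0 < d" "summable h"
      "\<And>n y. y\<in>ball z d \<inter> S \<Longrightarrow> norm (f n y) \<le> h n" "\<And>n y. y\<in>ball z d \<inter> S \<Longrightarrow> norm (g n y) \<le> h n"
      using bound[OF z] by metis
    then show "\<exists>d h. 0 < d \<and> summable h \<and> (\<forall>\<^sub>F n in sequentially. \<forall>y\<in>ball z d \<inter> S. norm (f n y) \<le> h n)"
      "\<exists>d h. 0 < d \<and> summable h \<and> (\<forall>\<^sub>F n in sequentially. \<forall>y\<in>ball z d \<inter> S. norm (g n y) \<le> h n)"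
      by (intro exI[of _ d] exI[of _ h] conjI always_eventually allI ballI; assumption?; blast)+
  qed
  have "\<exists>y y'. \<forall>x \<in> S. ((\<lambda>n. f n x) sums y x) \<and> ((\<lambda>n. f' n x) sums y' x) \<and> (y has_field_derivative y' x) (at x)"
    by (rule series_and_derivative_comparison_local[OF S(1) df boundf])
  then obtain y y' where y: "\<And>x. x \<in> S \<Longrightarrow> (\<lambda>n. f n x) sums y x" "\<And>x. x \<in> S \<Longrightarrow> (\<lambda>n. f' n x) sums y' x"
    "\<And>x. x \<in> S \<Longrightarrow> (y has_field_derivative y' x) (at x)" by blast
  have "\<exists>w w'. \<forall>x \<in> S. ((\<lambda>n. g n x) sums w x) \<and> ((\<lambda>n. g' n x) sums w' x) \<and> (w has_field_derivative w' x) (at x)"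
    by (rule series_and_derivative_comparison_local[OF S(1) dg boundg])
  then obtain w w' where w: "\<And>x. x \<in> S \<Longrightarrow> (\<lambda>n. g n x) sums w x" "\<And>x. x \<in> S \<Longrightarrow> (\<lambda>n. g' n x) sums w' x"
    "\<And>x. x \<in> S \<Longrightarrow> (w has_field_derivative w' x) (at x)" by blast
  have "y' x = w x" if x: "x \<in> S" for x
  proof -
    have "(\<lambda>n. f' (Suc n) x) sums w x" using w(1)[OF x] by (simp add: f'_def)
    then have "(\<lambda>n. f' n x) sums w x" using sums_Suc[of "\<lambda>n. f' n x"] by (simp add: f'_def)
    then show ?thesis using y(2)[OF x] sums_unique2 by blast
  qed
  moreover have "w' x = - (p x * w x + q x * y x)" if x: "x \<in> S" for x
  proof -
    have "(\<lambda>n. g' (Suc n) x) sums (- (p x * w x + q x * y x))"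
      using sums_minus[OF sums_add[OF sums_mult[OF w(1)[OF x], of "p x"] sums_mult[OF y(1)[OF x], of "q x"]]]
      by (simp add: g'_def)
    then have "(\<lambda>n. g' n x) sums (- (p x * w x + q x * y x))" using sums_Suc[of "\<lambda>n. g' n x"] by (simp add: g'_def)
    then show ?thesis using w(2)[OF x] sums_unique2 by blast
  qed
  ultimately have "ode2 p q S y w"
    unfolding ode2_def using y(3) w(3) by auto
  moreover have "y a = c"
  proof -
    have "f (Suc n) a = 0" for n using P(2)[of "g n" a] hol S by (auto simp: fS)
    then have "(\<lambda>n. f n a) sums c" using sums_Suc[of "\<lambda>n. f n a" 0] by (simp add: f0)
    then show ?thesis using y(1)[OF S(2)] sums_unique2 by blast
  qed
  moreover have "w a = c'"
  proof -
    have "g (Suc n) a = 0" for n using P(2)[OF holr S(2)] by (auto simp: gS)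
    then have "(\<lambda>n. g n a) sums c'" using sums_Suc[of "\<lambda>n. g n a" 0] by (simp add: g0)
    then show ?thesis using w(1)[OF S(2)] sums_unique2 by blast
  qed
  ultimately show ?thesis using that by blast
qed

section \<open>Riemann's equation with singular points 0, 1 and infinity\<close>

lemma powser_shift_sums:
  fixes z :: complex
  assumes "(\<lambda>n. f n * z ^ n) sums s"
  shows "(\<lambda>n. (case n of 0 \<Rightarrow> 0 | Suc m \<Rightarrow> f m) * z ^ n) sums (z * s)"
proof -
  have "(\<lambda>n. z * (f n * z ^ n)) sums (z * s)" using assms by (rule sums_mult)
  then have "(\<lambda>n. (case Suc n of 0 \<Rightarrow> 0 | Suc m \<Rightarrow> f m) * z ^ Suc n) sums (z * s)"
    by (simp add: mult_ac)
  from sums_Suc[OF this] show ?thesis by simp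
qed

text \<open>Comparing coefficients gives a recursion that is solvable because
  \<open>c + of_nat n\<close> never vanishes; the ratio of consecutive coefficients tends to 1, so
  the series converges on the whole unit disc. The value \<open>u 0 = 1\<close> later certifies that
  the solution is not identically zero.\<close>

lemma hypergeometric_solution:
  fixes a b c :: complex
  assumes c: "\<And>n::nat. c + of_nat n \<noteq> 0"
  obtains u u1 u2 where
    "\<And>z. norm z < 1 \<Longrightarrow> (u has_field_derivative u1 z) (at z)"
    "\<And>z. norm z < 1 \<Longrightarrow> (u1 has_field_derivative u2 z) (at z)"
    "\<And>z. norm z < 1 \<Longrightarrow> z * (1 - z) * u2 z + (c - (a + b + 1) * z) * u1 z - a * b * u z = 0"
    "u 0 = 1"
proof -
  define k where "k n = (a + of_nat n) * (b + of_nat n) / ((c + of_nat n) * (1 + of_nat n))" for n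
  define d where "d = rec_nat 1 (\<lambda>n x. k n * x)"
  have d0: "d 0 = 1" and dS: "d (Suc n) = k n * d n" for n by (auto simp: d_def)
  have rec: "(of_nat n + 1) * (c + of_nat n) * d (Suc n) = (a + of_nat n) * (b + of_nat n) * d n" for n
  proof -
    have "1 + of_nat n \<noteq> (0::complex)" by (metis of_nat_Suc of_nat_neq_0)
    then have "(c + of_nat n) * (1 + of_nat n) * k n = (a + of_nat n) * (b + of_nat n)"
      using c[of n] by (simp add: k_def)
    then show ?thesis unfolding dS by algebra
  qed
  have "k \<longlonglongrightarrow> 1"
  proof -
    have inv: "(\<lambda>n. x / of_nat n) \<longlonglongrightarrow> 0" for x :: complex
      by (rule lim_const_over_n)
    have "(\<lambda>n. (a / of_nat n + 1) * (b / of_nat n + 1) / ((c / of_nat n + 1) * (1 / of_nat n + 1))) \<longlonglongrightarrow> (0 + 1) * (0 + 1) / ((0 + 1) * (0 + 1))"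
      by (intro tendsto_intros inv) auto
    moreover have "\<forall>\<^sub>F n in sequentially. (a / of_nat n + 1) * (b / of_nat n + 1) / ((c / of_nat n + 1) * (1 / of_nat n + 1)) = k n"
      using eventually_gt_at_top[of 0]
    proof eventually_elim
      case (elim n)
      have e: "x / of_nat n + 1 = (x + of_nat n) / of_nat n" for x :: complex
        using elim by (simp add: field_simps)
      show ?case unfolding e k_def using elim by simp
    qed
    ultimately show ?thesis by (simp add: filterlim_cong)
  qed
  then have k: "(\<lambda>n. norm (k n)) \<longlonglongrightarrow> 1" using tendsto_norm by fastforce
  have sm: "summable (\<lambda>n. d n * z ^ n)" if z: "norm z < 1" for z
  proof -
    define q where "q = (1 + norm z) / 2"
    have q: "norm z < q" "q < 1" using z by (auto simp: q_def)
    have "(\<lambda>n. norm (k n) * norm z) \<longlonglongrightarrow> 1 * norm z" by (intro tendsto_intros k)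
    then have "\<forall>\<^sub>F n in sequentially. norm (k n) * norm z < q"
      using q by (intro order_tendstoD) auto
    then obtain N where N: "\<And>n. n \<ge> N \<Longrightarrow> norm (k n) * norm z < q" by (auto simp: eventually_sequentially)
    show ?thesis
    proof (rule summable_ratio_test[OF q(2)])
      fix n assume "n \<ge> N"
      from N[OF this] have "norm (k n) * norm z * norm (d n * z ^ n) \<le> q * norm (d n * z ^ n)"
        by (intro mult_right_mono) auto
      then show "norm (d (Suc n) * z ^ Suc n) \<le> q * norm (d n * z ^ n)"
        by (simp add: dS norm_mult mult_ac)
    qed
  qed
  have sm1: "summable (\<lambda>n. diffs d n * z ^ n)" if "norm z < 1" for z
    using termdiff_converges[OF that, of d] sm by blast
  have sm2: "summable (\<lambda>n. diffs (diffs d) n * z ^ n)" if "norm z < 1" for z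
    using termdiff_converges[OF that, of "diffs d"] sm1 by blast
  define u where "u z = (\<Sum>n. d n * z ^ n)" for z
  define u1 where "u1 z = (\<Sum>n. diffs d n * z ^ n)" for z
  define u2 where "u2 z = (\<Sum>n. diffs (diffs d) n * z ^ n)" for z
  have between: "\<exists>K::complex. norm K < 1 \<and> norm z < norm K" if "norm z < 1" for z :: complex
    by (rule exI[of _ "of_real ((1 + norm z) / 2)"]) (use that in \<open>simp add: norm_divide del: of_real_add of_real_divide\<close>)
  show ?thesis
  proof (rule that[of u u1 u2])
    show "(u has_field_derivative u1 z) (at z)" if "norm z < 1" for z
      using between[OF that] sm termdiffs_strong unfolding u_def u1_def by blast
    show "(u1 has_field_derivative u2 z) (at z)" if "norm z < 1" for z
      using between[OF that] sm1 termdiffs_strong unfolding u1_def u2_def by blast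
    show "u 0 = 1" by (simp add: u_def d0)
    show "z * (1 - z) * u2 z + (c - (a + b + 1) * z) * u1 z - a * b * u z = 0" if z: "norm z < 1" for z
    proof -
      let ?sh = "\<lambda>(f :: nat \<Rightarrow> complex) n. case n of 0 \<Rightarrow> 0 | Suc m \<Rightarrow> f m"
      have s0: "(\<lambda>n. d n * z ^ n) sums u z" using summable_sums[OF sm[OF z]] by (simp add: u_def)
      have s1: "(\<lambda>n. diffs d n * z ^ n) sums u1 z" using summable_sums[OF sm1[OF z]] by (simp add: u1_def)
      have s2: "(\<lambda>n. diffs (diffs d) n * z ^ n) sums u2 z" using summable_sums[OF sm2[OF z]] by (simp add: u2_def)
      note t1 = powser_shift_sums[OF s1] and t2 = powser_shift_sums[OF s2]
      note t3 = powser_shift_sums[OF t2]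
      have "(\<lambda>n. ?sh (diffs (diffs d)) n * z ^ n - ?sh (?sh (diffs (diffs d))) n * z ^ n
           + c * (diffs d n * z ^ n) - (a + b + 1) * (?sh (diffs d) n * z ^ n) - a * b * (d n * z ^ n)) sums
           (z * u2 z - z * (z * u2 z) + c * u1 z - (a + b + 1) * (z * u1 z) - a * b * u z)"
        by (intro sums_diff sums_add sums_mult s0 s1 t1 t2 t3)
      moreover have "?sh (diffs (diffs d)) n * z ^ n - ?sh (?sh (diffs (diffs d))) n * z ^ n
           + c * (diffs d n * z ^ n) - (a + b + 1) * (?sh (diffs d) n * z ^ n) - a * b * (d n * z ^ n) = 0" for n
      proof -
        have e1: "?sh (diffs d) n = of_nat n * d n" by (cases n) (auto simp: diffs_def)
        have e2: "?sh (diffs (diffs d)) n = of_nat n * (of_nat n + 1) * d (Suc n)"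
          by (cases n) (auto simp: diffs_def algebra_simps)
        have e3: "?sh (?sh (diffs (diffs d))) n = of_nat n * (of_nat n - 1) * d n"
          by (auto simp: diffs_def algebra_simps split: nat.split)
        have e4: "diffs d n = (of_nat n + 1) * d (Suc n)" by (simp add: diffs_def add.commute)
        have "of_nat n * (of_nat n + 1) * d (Suc n) - of_nat n * (of_nat n - 1) * d n
           + c * ((of_nat n + 1) * d (Suc n)) - (a + b + 1) * (of_nat n * d n) - a * b * d n = 0"
          using rec[of n] by algebra
        then have "(of_nat n * (of_nat n + 1) * d (Suc n) - of_nat n * (of_nat n - 1) * d n
           + c * ((of_nat n + 1) * d (Suc n)) - (a + b + 1) * (of_nat n * d n) - a * b * d n) * z ^ n = 0"
          by simp
        then show ?thesis unfolding e1 e2 e3 e4 by (simp add: algebra_simps)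
      qed
      ultimately have "(\<lambda>n. 0::complex) sums
           (z * u2 z - z * (z * u2 z) + c * u1 z - (a + b + 1) * (z * u1 z) - a * b * u z)" by simp
      then have "z * u2 z - z * (z * u2 z) + c * u1 z - (a + b + 1) * (z * u1 z) - a * b * u z = 0"
        using sums_unique2 sums_zero by blast
      then show ?thesis by (simp add: algebra_simps)
    qed
  qed
qed

text \<open>Together with \<open>riemann_q\<close> these are the coefficients of the
  Riemann-Papperitz equation with exponents \<open>r\<close>, \<open>r'\<close> at 0,
  \<open>s\<close>, \<open>s'\<close> at 1 and \<open>t\<close>, \<open>t'\<close> at infinity,
  subject to Fuchs' relation that the six sum to 1.\<close>

definition riemann_p :: "complex \<Rightarrow> complex \<Rightarrow> complex \<Rightarrow> complex \<Rightarrow> complex \<Rightarrow> complex" where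
  "riemann_p r r' s s' z = (1 - r - r') / z + (1 - s - s') / (z - 1)"

definition riemann_q :: "complex \<Rightarrow> complex \<Rightarrow> complex \<Rightarrow> complex \<Rightarrow> complex \<Rightarrow> complex \<Rightarrow> complex \<Rightarrow> complex" where
  "riemann_q r r' s s' t t' z = (s * s' / (z - 1) - r * r' / z + t * t') / (z * (z - 1))"

text \<open>Substitution \<open>y = g * u\<close>. The factor \<open>g\<close> enters only through
  its logarithmic derivative \<open>l\<close>, so any branch of a multivalued power may be used on
  any set where it exists.\<close>

lemma ode2_gauge:
  assumes "\<And>z. z \<in> S \<Longrightarrow> (g has_field_derivative l z * g z) (at z)"
    "\<And>z. z \<in> S \<Longrightarrow> (l has_field_derivative l1 z) (at z)"
    "\<And>z. z \<in> S \<Longrightarrow> (u has_field_derivative u1 z) (at z)"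
    "\<And>z. z \<in> S \<Longrightarrow> (u1 has_field_derivative u2 z) (at z)"
    "\<And>z. z \<in> S \<Longrightarrow> u2 z + (2 * l z + p z) * u1 z + (l z ^ 2 + l1 z + p z * l z + q z) * u z = 0"
  shows "ode2 p q S (\<lambda>z. g z * u z) (\<lambda>z. g z * (u1 z + l z * u z))"
  unfolding ode2_def
proof (intro ballI conjI)
  fix z assume z: "z \<in> S"
  show "((\<lambda>z. g z * u z) has_field_derivative g z * (u1 z + l z * u z)) (at z)"
    using assms(1-4)[OF z] by (auto intro!: derivative_eq_intros simp: algebra_simps)
  have *: "((\<lambda>z. g z * (u1 z + l z * u z)) has_field_derivative
     l z * g z * (u1 z + l z * u z) + g z * (u2 z + l1 z * u z + l z * u1 z)) (at z)"
    using assms(1-4)[OF z] by (auto intro!: derivative_eq_intros simp: algebra_simps)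
  have **: "l z * g z * (u1 z + l z * u z) + g z * (u2 z + l1 z * u z + l z * u1 z) =
     - (p z * (g z * (u1 z + l z * u z)) + q z * (g z * u z))"
    using assms(5)[OF z] by algebra
  show "((\<lambda>z. g z * (u1 z + l z * u z)) has_field_derivative - (p z * (g z * (u1 z + l z * u z)) + q z * (g z * u z))) (at z)"
    using * unfolding ** .
qed

lemma exponent_derivative:
  assumes "z \<noteq> 0" "z \<noteq> (1::complex)"
  shows "((\<lambda>z. A / z + B / (z - 1)) has_field_derivative - (A / z\<^sup>2) - B / (z - 1)\<^sup>2) (at z)"
  using assms by (auto intro!: derivative_eq_intros simp: field_simps power2_eq_square)

text \<open>With the reciprocals as new variables subject to polynomial relations, the rational
  identities below become ideal membership problems that \<open>algebra\<close> can decide.\<close>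

lemma reciprocals_cases:
  fixes z :: complex
  assumes "z \<noteq> 0" "z \<noteq> 1"
  obtains x y where "inverse z = x" "inverse (z - 1) = y" "z * x = 1" "(z - 1) * y = 1"
  using assms by simp

text \<open>Splitting off \<open>z^r (z - 1)^s\<close> moves one exponent at 0 and one at 1 to 0.
  What remains is hypergeometric with parameters \<open>r + s + t\<close>, \<open>r + s + t'\<close>
  and third parameter \<open>1 + r - r'\<close>; Fuchs' relation makes the coefficient of
  \<open>u\<close> a constant.\<close>

lemma riemann_exponents_identity_finite:
  fixes z :: complex
  assumes z: "z \<noteq> 0" "z \<noteq> 1" and sum: "r + r' + s + s' + t + t' = 1"
  defines "l \<equiv> r / z + s / (z - 1)"
  shows "z * (1 - z) * (2 * l + riemann_p r r' s s' z) = (1 + r - r') - (2 + r - r' + s - s') * z"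
    "z * (1 - z) * (l ^ 2 + (- (r / z\<^sup>2) - s / (z - 1)\<^sup>2) + riemann_p r r' s s' z * l + riemann_q r r' s s' t t' z)
      = - (r + s + t) * (r + s + t')"
proof -
  obtain x y where xy: "inverse z = x" "inverse (z - 1) = y" "z * x = 1" "(z - 1) * y = 1"
    using reciprocals_cases[OF z] .
  show "z * (1 - z) * (2 * l + riemann_p r r' s s' z) = (1 + r - r') - (2 + r - r' + s - s') * z"
    unfolding l_def riemann_p_def divide_inverse xy(1,2) using xy(3,4) by algebra
  show "z * (1 - z) * (l ^ 2 + (- (r / z\<^sup>2) - s / (z - 1)\<^sup>2) + riemann_p r r' s s' z * l + riemann_q r r' s s' t t' z)
      = - (r + s + t) * (r + s + t')"
    unfolding l_def riemann_p_def riemann_q_def divide_inverse inverse_mult_distrib power_inverse[symmetric] xy(1,2)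
    using xy(3,4) sum by algebra
qed

text \<open>The factor \<open>z^(- t - s) (z - 1)^s\<close> behaves like \<open>z^(- t)\<close> at
  infinity. The left-hand sides are the coefficients after the substitution of \<open>1 / z\<close>,
  whose second derivative contributes the term \<open>2 / z ^ 3\<close>.\<close>

lemma riemann_exponents_identity_infinity:
  fixes z :: complex
  assumes z: "z \<noteq> 0" "z \<noteq> 1" and sum: "r + r' + s + s' + t + t' = 1"
  defines "l \<equiv> - (t + s) / z + s / (z - 1)"
  shows "z\<^sup>2 * (z - 1) * (2 / z ^ 3 - (2 * l + riemann_p r r' s s' z) / z\<^sup>2) = (1 + t - t') - (2 + t - t' + s - s') / z"
    "z\<^sup>2 * (z - 1) * (l ^ 2 + (- (- (t + s) / z\<^sup>2) - s / (z - 1)\<^sup>2) + riemann_p r r' s s' z * l + riemann_q r r' s s' t t' z)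
      = - (t + s + r) * (t + s + r')"
proof -
  obtain x y where xy: "inverse z = x" "inverse (z - 1) = y" "z * x = 1" "(z - 1) * y = 1"
    using reciprocals_cases[OF z] .
  show "z\<^sup>2 * (z - 1) * (2 / z ^ 3 - (2 * l + riemann_p r r' s s' z) / z\<^sup>2) = (1 + t - t') - (2 + t - t' + s - s') / z"
    unfolding l_def riemann_p_def divide_inverse power_inverse[symmetric] xy(1,2)
    using xy(3,4) sum by algebra
  show "z\<^sup>2 * (z - 1) * (l ^ 2 + (- (- (t + s) / z\<^sup>2) - s / (z - 1)\<^sup>2) + riemann_p r r' s s' z * l + riemann_q r r' s s' t t' z)
      = - (t + s + r) * (t + s + r')"
    unfolding l_def riemann_p_def riemann_q_def divide_inverse inverse_mult_distrib power_inverse[symmetric] xy(1,2)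
    using xy(3,4) sum by algebra
qed

text \<open>Local solutions \<open>z\<^sup>r (1 - z)\<^sup>s F\<close> at \<open>0\<close> and \<open>1\<close>, and \<open>z\<^sup>-\<^sup>t (1 - 1/z)\<^sup>s F\<close> at infinity, with \<open>F\<close>
  hypergeometric in the respective local coordinate; \<open>g\<close> is any branch of the power factor.\<close>

lemma riemann_local_solution_0:
  assumes sum: "r + r' + s + s' + t + t' = 1" and re: "Re r \<ge> Re r'"
  obtains u v where "continuous (at 0) u" "u 0 = 1"
    "\<And>S g. S \<subseteq> ball 0 1 - {0} \<Longrightarrow> (\<And>z. z \<in> S \<Longrightarrow> (g has_field_derivative (r / z + s / (z - 1)) * g z) (at z)) \<Longrightarrow>
       ode2 (riemann_p r r' s s') (riemann_q r r' s s' t t') S (\<lambda>z. g z * u z) (\<lambda>z. g z * v z)"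
proof -
  let ?p = "riemann_p r r' s s'" and ?q = "riemann_q r r' s s' t t'"
  let ?l = "\<lambda>z. r / z + s / (z - 1)"
  \<comment> \<open>Choosing the exponent of larger real part gives the third hypergeometric
    parameter real part at least 1, so it avoids 0, -1, -2 and so on even when the exponents differ
    by an integer.\<close>
  have "1 + r - r' + of_nat n \<noteq> 0" for n :: nat
    using re by (auto simp: complex_eq_iff)
  from hypergeometric_solution[of "1 + r - r'" "r + s + t" "r + s + t'", OF this]
  obtain u u1 u2 where u: "\<And>z. norm z < 1 \<Longrightarrow> (u has_field_derivative u1 z) (at z)"
    "\<And>z. norm z < 1 \<Longrightarrow> (u1 has_field_derivative u2 z) (at z)"
    "\<And>z. norm z < 1 \<Longrightarrow> z * (1 - z) * u2 z + (1 + r - r' - (r + s + t + (r + s + t') + 1) * z) * u1 z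
       - (r + s + t) * (r + s + t') * u z = 0" "u 0 = 1" by metis
  show ?thesis
  proof (rule that[of u "\<lambda>z. u1 z + ?l z * u z"])
    show "continuous (at 0) u" using u(1)[of 0] DERIV_isCont by simp
    fix S g assume S: "S \<subseteq> ball (0::complex) 1 - {0}" and g: "\<And>z. z \<in> S \<Longrightarrow> (g has_field_derivative ?l z * g z) (at z)"
    show "ode2 ?p ?q S (\<lambda>z. g z * u z) (\<lambda>z. g z * (u1 z + ?l z * u z))"
    proof (rule ode2_gauge[OF g])
      fix z assume "z \<in> S"
      then have z: "norm z < 1" "z \<noteq> 0" "z \<noteq> 1" using S by auto
      show "(?l has_field_derivative - (r / z\<^sup>2) - s / (z - 1)\<^sup>2) (at z)"
        using exponent_derivative z by blast
      show "(u has_field_derivative u1 z) (at z)" "(u1 has_field_derivative u2 z) (at z)" using u z by auto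
      note id = riemann_exponents_identity_finite[OF z(2,3) sum]
      have e: "r + s + t + (r + s + t') + 1 = 2 + r - r' + s - s'" using sum by algebra
      show "u2 z + (2 * ?l z + ?p z) * u1 z + ((?l z)\<^sup>2 + (- (r / z\<^sup>2) - s / (z - 1)\<^sup>2) + ?p z * ?l z + ?q z) * u z = 0" (is "?E = 0")
      proof -
        have "z * (1 - z) * ?E = 0" using id u(3)[OF z(1), unfolded e] by algebra
        then show ?thesis using z by simp
      qed
    qed
  qed (use u in auto)
qed

lemma riemann_local_solution_1:
  assumes sum: "r + r' + s + s' + t + t' = 1" and re: "Re s \<ge> Re s'"
  obtains u v where "continuous (at 1) u" "u 1 = 1"
    "\<And>S g. S \<subseteq> ball 1 1 - {1} \<Longrightarrow> (\<And>z. z \<in> S \<Longrightarrow> (g has_field_derivative (r / z + s / (z - 1)) * g z) (at z)) \<Longrightarrow>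
       ode2 (riemann_p r r' s s') (riemann_q r r' s s' t t') S (\<lambda>z. g z * u z) (\<lambda>z. g z * v z)"
proof -
  let ?p = "riemann_p r r' s s'" and ?q = "riemann_q r r' s s' t t'"
  let ?l = "\<lambda>z. r / z + s / (z - 1)"
  have "1 + s - s' + of_nat n \<noteq> 0" for n :: nat
    using re by (auto simp: complex_eq_iff)
  from hypergeometric_solution[of "1 + s - s'" "r + s + t" "r + s + t'", OF this]
  obtain u u1 u2 where u: "\<And>z. norm z < 1 \<Longrightarrow> (u has_field_derivative u1 z) (at z)"
    "\<And>z. norm z < 1 \<Longrightarrow> (u1 has_field_derivative u2 z) (at z)"
    "\<And>z. norm z < 1 \<Longrightarrow> z * (1 - z) * u2 z + (1 + s - s' - (r + s + t + (r + s + t') + 1) * z) * u1 z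
       - (r + s + t) * (r + s + t') * u z = 0" "u 0 = 1" by metis
  \<comment> \<open>Reflection in 1/2 exchanges 0 with 1 and hence \<open>r\<close>,
    \<open>r'\<close> with \<open>s\<close>, \<open>s'\<close>. The first two hypergeometric
    parameters are symmetric under this exchange, only the third one changes.\<close>
  have d: "((\<lambda>z. u (1 - z)) has_field_derivative - u1 (1 - z)) (at z)"
    "((\<lambda>z. - u1 (1 - z)) has_field_derivative u2 (1 - z)) (at z)" if "norm (1 - z) < 1" for z
  proof -
    have dz: "((\<lambda>z. 1 - z) has_field_derivative - 1) (at z)" by (auto intro!: derivative_eq_intros)
    show "((\<lambda>z. u (1 - z)) has_field_derivative - u1 (1 - z)) (at z)"
      using DERIV_chain[OF u(1)[OF that] dz] by (simp add: o_def)
    show "((\<lambda>z. - u1 (1 - z)) has_field_derivative u2 (1 - z)) (at z)"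
      using DERIV_minus[OF DERIV_chain[OF u(2)[OF that] dz]] by (simp add: o_def)
  qed
  show ?thesis
  proof (rule that[of "\<lambda>z. u (1 - z)" "\<lambda>z. - u1 (1 - z) + ?l z * u (1 - z)"])
    show "continuous (at 1) (\<lambda>z. u (1 - z))" using d(1)[of 1] DERIV_isCont by force
    fix S g assume S: "S \<subseteq> ball (1::complex) 1 - {1}" and g: "\<And>z. z \<in> S \<Longrightarrow> (g has_field_derivative ?l z * g z) (at z)"
    show "ode2 ?p ?q S (\<lambda>z. g z * u (1 - z)) (\<lambda>z. g z * (- u1 (1 - z) + ?l z * u (1 - z)))"
    proof (rule ode2_gauge[OF g])
      fix z assume "z \<in> S"
      then have z: "norm (1 - z) < 1" "z \<noteq> 0" "z \<noteq> 1" using S by (auto simp: dist_norm)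
      show "(?l has_field_derivative - (r / z\<^sup>2) - s / (z - 1)\<^sup>2) (at z)"
        using exponent_derivative z by blast
      show "((\<lambda>z. u (1 - z)) has_field_derivative - u1 (1 - z)) (at z)"
        "((\<lambda>z. - u1 (1 - z)) has_field_derivative u2 (1 - z)) (at z)" using d z by auto
      note id = riemann_exponents_identity_finite[OF z(2,3) sum]
      have e: "r + s + t + (r + s + t') + 1 = 2 + r - r' + s - s'" using sum by algebra
      show "u2 (1 - z) + (2 * ?l z + ?p z) * - u1 (1 - z) + ((?l z)\<^sup>2 + (- (r / z\<^sup>2) - s / (z - 1)\<^sup>2) + ?p z * ?l z + ?q z) * u (1 - z) = 0" (is "?E = 0")
      proof -
        have "z * (1 - z) * ?E = 0" using id u(3)[OF z(1), unfolded e] by algebra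
        then show ?thesis using z by simp
      qed
    qed
  qed (use u in auto)
qed

lemma riemann_local_solution_infinity:
  assumes sum: "r + r' + s + s' + t + t' = 1" and re: "Re t \<ge> Re t'"
  obtains u v where "continuous (at 0) u" "u 0 = 1"
    "\<And>S g. S \<subseteq> - cball 0 1 \<Longrightarrow> (\<And>z. z \<in> S \<Longrightarrow> (g has_field_derivative (- (t + s) / z + s / (z - 1)) * g z) (at z)) \<Longrightarrow>
       ode2 (riemann_p r r' s s') (riemann_q r r' s s' t t') S (\<lambda>z. g z * u (1 / z)) (\<lambda>z. g z * v z)"
proof -
  let ?p = "riemann_p r r' s s'" and ?q = "riemann_q r r' s s' t t'"
  let ?l = "\<lambda>z. - (t + s) / z + s / (z - 1)"
  have "1 + t - t' + of_nat n \<noteq> 0" for n :: nat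
    using re by (auto simp: complex_eq_iff)
  from hypergeometric_solution[of "1 + t - t'" "t + s + r" "t + s + r'", OF this]
  obtain u u1 u2 where u: "\<And>z. norm z < 1 \<Longrightarrow> (u has_field_derivative u1 z) (at z)"
    "\<And>z. norm z < 1 \<Longrightarrow> (u1 has_field_derivative u2 z) (at z)"
    "\<And>z. norm z < 1 \<Longrightarrow> z * (1 - z) * u2 z + (1 + t - t' - (t + s + r + (t + s + r') + 1) * z) * u1 z
       - (t + s + r) * (t + s + r') * u z = 0" "u 0 = 1" by metis
  have d: "((\<lambda>z. u (1 / z)) has_field_derivative - u1 (1 / z) / z\<^sup>2) (at z)"
    "((\<lambda>z. - u1 (1 / z) / z\<^sup>2) has_field_derivative u2 (1 / z) / z ^ 4 + 2 * u1 (1 / z) / z ^ 3) (at z)"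
    if "norm z > 1" for z
  proof -
    have z: "z \<noteq> 0" "norm (1 / z) < 1" using that by (auto simp: norm_divide divide_less_eq)
    have dz: "((\<lambda>z. 1 / z) has_field_derivative - (1 / z\<^sup>2)) (at z)"
      using z by (auto intro!: derivative_eq_intros simp: power2_eq_square field_simps)
    show "((\<lambda>z. u (1 / z)) has_field_derivative - u1 (1 / z) / z\<^sup>2) (at z)"
      using DERIV_chain2[OF u(1)[OF z(2)] dz] by simp
    have "((\<lambda>z. u1 (1 / z)) has_field_derivative - u2 (1 / z) / z\<^sup>2) (at z)"
      using DERIV_chain2[OF u(2)[OF z(2)] dz] by simp
    then show "((\<lambda>z. - u1 (1 / z) / z\<^sup>2) has_field_derivative u2 (1 / z) / z ^ 4 + 2 * u1 (1 / z) / z ^ 3) (at z)"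
      using z by (auto intro!: derivative_eq_intros simp: field_simps eval_nat_numeral)
  qed
  show ?thesis
  proof (rule that[of u "\<lambda>z. - u1 (1 / z) / z\<^sup>2 + ?l z * u (1 / z)"])
    show "continuous (at 0) u" using u(1)[of 0] DERIV_isCont by force
    fix S g assume S: "S \<subseteq> - cball (0::complex) 1" and g: "\<And>z. z \<in> S \<Longrightarrow> (g has_field_derivative ?l z * g z) (at z)"
    show "ode2 ?p ?q S (\<lambda>z. g z * u (1 / z)) (\<lambda>z. g z * (- u1 (1 / z) / z\<^sup>2 + ?l z * u (1 / z)))"
    proof (rule ode2_gauge[OF g])
      fix z assume "z \<in> S"
      then have z: "norm z > 1" "z \<noteq> 0" "z \<noteq> 1" using S by auto
      show "(?l has_field_derivative - (- (t + s) / z\<^sup>2) - s / (z - 1)\<^sup>2) (at z)"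
        using exponent_derivative z by blast
      show "((\<lambda>z. u (1 / z)) has_field_derivative - u1 (1 / z) / z\<^sup>2) (at z)"
        "((\<lambda>z. - u1 (1 / z) / z\<^sup>2) has_field_derivative u2 (1 / z) / z ^ 4 + 2 * u1 (1 / z) / z ^ 3) (at z)" using d z by auto
      note id = riemann_exponents_identity_infinity[OF z(2,3) sum]
      have e: "t + s + r + (t + s + r') + 1 = 2 + t - t' + s - s'" using sum by algebra
      have z1: "norm (1 / z) < 1" using z by (simp add: norm_divide divide_less_eq)
      \<comment> \<open>The leading coefficient of the hypergeometric equation at
        \<open>1 / z\<close>, rewritten so that it shows the factor
        \<open>z\<^sup>2 * (z - 1)\<close> of the exponent identities.\<close>
      have X: "1 / z * (1 - 1 / z) = z\<^sup>2 * (z - 1) / z ^ 4"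
        using z by (simp add: field_simps eval_nat_numeral)
      define Q where "Q = (?l z)\<^sup>2 + (- (- (t + s) / z\<^sup>2) - s / (z - 1)\<^sup>2) + ?p z * ?l z + ?q z"
      have "z\<^sup>2 * (z - 1) * (u2 (1 / z) / z ^ 4 + (2 / z ^ 3 - (2 * ?l z + ?p z) / z\<^sup>2) * u1 (1 / z) + Q * u (1 / z))
        = z\<^sup>2 * (z - 1) / z ^ 4 * u2 (1 / z) + z\<^sup>2 * (z - 1) * (2 / z ^ 3 - (2 * ?l z + ?p z) / z\<^sup>2) * u1 (1 / z) + z\<^sup>2 * (z - 1) * Q * u (1 / z)"
        by (simp only: distrib_left times_divide_eq_right times_divide_eq_left mult.assoc)
      also have "\<dots> = 0"
        using u(3)[OF z1, unfolded e X] unfolding Q_def unfolding id unfolding divide_inverse by (simp add: algebra_simps)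
      finally have "u2 (1 / z) / z ^ 4 + (2 / z ^ 3 - (2 * ?l z + ?p z) / z\<^sup>2) * u1 (1 / z) + Q * u (1 / z) = 0"
        using z by (simp only: mult_eq_0_iff) simp
      then show "u2 (1 / z) / z ^ 4 + 2 * u1 (1 / z) / z ^ 3 + (2 * ?l z + ?p z) * (- u1 (1 / z) / z\<^sup>2) + ((?l z)\<^sup>2 + (- (- (t + s) / z\<^sup>2) - s / (z - 1)\<^sup>2) + ?p z * ?l z + ?q z) * u (1 / z) = 0"
        unfolding Q_def[symmetric] by (simp only: left_diff_distrib right_diff_distrib diff_divide_distrib times_divide_eq_left mult_minus_right minus_divide_left[symmetric] times_divide_eq_right) (simp add: add_diff_eq)
    qed
  qed (use u in auto)
qed

section \<open>Transition matrices between the three sheets\<close>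

datatype gap = Below | Between | Beyond

fun gap_interval :: "gap \<Rightarrow> real set" where
  "gap_interval Below = {..<0}"
| "gap_interval Between = {0<..<1}"
| "gap_interval Beyond = {1<..}"

definition slit :: "real set \<Rightarrow> complex set" where
  "slit I = {z. Im z \<noteq> 0 \<or> Re z \<in> I}"

text \<open>The plane slit along the real axis, with one of the three intervals of \<open>\<real> \<setminus> {0, 1}\<close> left open.\<close>

definition sheet :: "gap \<Rightarrow> complex set" where
  "sheet j = slit (gap_interval j)"

lemma open_slit: "open I \<Longrightarrow> open (slit I)"
proof -
  assume "open I"
  have "slit I = Im -` (- {0}) \<union> Re -` I" by (auto simp: slit_def)
  moreover have "open (Im -` (- {0}))" by (intro open_vimage continuous_intros)
  moreover have "open (Re -` I)" by (intro open_vimage continuous_intros \<open>open I\<close>)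
  ultimately show ?thesis by auto
qed

lemma closed_segment_subset_slit:
  assumes "convex I" "c \<in> I" "z \<in> slit I"
  shows "closed_segment (of_real c) z \<subseteq> slit I"
proof
  fix x assume "x \<in> closed_segment (of_real c) z"
  then obtain u where u: "0 \<le> u" "u \<le> 1" "x = (1 - u) *\<^sub>R of_real c + u *\<^sub>R z" by (auto simp: closed_segment_def)
  have re: "Re x = (1 - u) *\<^sub>R c + u *\<^sub>R Re z" and im: "Im x = u * Im z" using u by auto
  show "x \<in> slit I"
  proof (cases "u = 0 \<or> Im z \<noteq> 0")
    case True then show ?thesis using re im assms by (auto simp: slit_def)
  next
    case False
    then have "Re x \<in> I" unfolding re using assms u by (intro convexD_alt) (auto simp: slit_def)
    then show ?thesis by (simp add: slit_def)
  qed
qed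

lemma convex_gap_interval: "convex (gap_interval j)" and open_gap_interval: "open (gap_interval j)"
  by (cases j; simp add: convex_real_interval)+

lemma open_sheet: "open (sheet j)"
  by (simp add: sheet_def open_slit open_gap_interval)

fun gap_centre :: "gap \<Rightarrow> real" where
  "gap_centre Below = -1" | "gap_centre Between = 1/2" | "gap_centre Beyond = 2"

lemma gap_centre: "gap_centre j \<in> gap_interval j"
  by (cases j) auto

lemma of_real_mem_slit: "c \<in> I \<Longrightarrow> of_real c \<in> slit I" by (simp add: slit_def)

lemma sheet_centre: "of_real (gap_centre j) \<in> sheet j"
  by (simp add: sheet_def of_real_mem_slit gap_centre)

lemma closed_segment_subset_sheet: "z \<in> sheet j \<Longrightarrow> closed_segment (of_real (gap_centre j)) z \<subseteq> sheet j"
  unfolding sheet_def by (intro closed_segment_subset_slit convex_gap_interval gap_centre)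

lemma starlike_sheet: "starlike (sheet j)"
  unfolding starlike_def using sheet_centre closed_segment_subset_sheet by blast

lemma connected_sheet: "connected (sheet j)"
  by (simp add: starlike_sheet starlike_imp_connected)

lemma connected_ball_slit:
  assumes "convex I" "c \<in> I" "of_real c \<in> ball x e"
  shows "connected (ball x e \<inter> slit I)"
proof (rule starlike_imp_connected)
  show "starlike (ball x e \<inter> slit I)"
    unfolding starlike_def
  proof (intro bexI[of _ "of_real c"] ballI)
    fix z assume "z \<in> ball x e \<inter> slit I"
    then show "closed_segment (of_real c) z \<subseteq> ball x e \<inter> slit I"
      using closed_segment_subset_slit[OF assms(1,2)] assms(3) closed_segment_subset[of "of_real c" "ball x e" z] by auto
  qed (use assms in \<open>auto simp: of_real_mem_slit\<close>)
qed

lemma sheet_nonreal: "Im z \<noteq> 0 \<Longrightarrow> z \<in> sheet j"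
  by (simp add: sheet_def slit_def)

lemma sheet_subset: "sheet j \<subseteq> - {0, 1}"
  by (cases j) (auto simp: sheet_def slit_def)

lemma sheet_cover: "z \<noteq> 0 \<Longrightarrow> z \<noteq> 1 \<Longrightarrow> \<exists>j. z \<in> sheet j"
proof -
  assume "z \<noteq> 0" "z \<noteq> 1"
  then have "Im z \<noteq> 0 \<or> Re z < 0 \<or> (0 < Re z \<and> Re z < 1) \<or> Re z > 1"
    by (auto simp: complex_eq_iff)
  then show ?thesis
    unfolding sheet_def slit_def
    by (metis (mono_tags, lifting) gap_interval.simps greaterThanLessThan_iff greaterThan_iff lessThan_iff mem_Collect_eq)
qed

lemma sheet_inter: "z \<in> sheet i \<Longrightarrow> z \<in> sheet j \<Longrightarrow> i \<noteq> j \<Longrightarrow> Im z \<noteq> 0"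
  by (cases i; cases j) (auto simp: sheet_def slit_def)

text \<open>The constants make the branches on the three sheets agree on the upper half plane.\<close>

fun log_0 :: "gap \<Rightarrow> complex \<Rightarrow> complex" where
  "log_0 Below z = Ln (- z) + \<i> * pi"
| "log_0 Between z = Ln z"
| "log_0 Beyond z = Ln z"

fun log_1 :: "gap \<Rightarrow> complex \<Rightarrow> complex" where
  "log_1 Below z = Ln (1 - z) + \<i> * pi"
| "log_1 Between z = Ln (1 - z) + \<i> * pi"
| "log_1 Beyond z = Ln (z - 1)"

abbreviation e2pi :: "complex \<Rightarrow> complex" where
  "e2pi x \<equiv> exp (2 * pi * \<i> * x)"

text \<open>A branch of \<open>z^A (z - 1)^B\<close>. It has no zeros, so it can serve both as a
  gauge factor and as the comparison function for Wronskians.\<close>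

definition power_branch :: "gap \<Rightarrow> complex \<Rightarrow> complex \<Rightarrow> complex \<Rightarrow> complex" where
  "power_branch j A B z = exp (A * log_0 j z + B * log_1 j z)"

lemma power_branch_nonzero [simp]: "power_branch j A B z \<noteq> 0"
  by (simp add: power_branch_def)

lemma log_branch_derivative:
  assumes z: "z \<in> sheet j"
  shows "(log_0 j has_field_derivative 1 / z) (at z)" "(log_1 j has_field_derivative 1 / (z - 1)) (at z)"
proof -
  have nz: "z \<noteq> 0" "z \<noteq> 1" using z sheet_subset by auto
  have fu: "log_0 Below = (\<lambda>z. Ln (- z) + \<i> * pi)" "log_0 Between = Ln" "log_0 Beyond = Ln"
    "log_1 Below = (\<lambda>z. Ln (1 - z) + \<i> * pi)" "log_1 Between = (\<lambda>z. Ln (1 - z) + \<i> * pi)" "log_1 Beyond = (\<lambda>z. Ln (z - 1))"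
    by auto
  have s: "Im z \<noteq> 0 \<or> Re z \<in> gap_interval j" using z by (simp add: sheet_def slit_def)
  have nr: "w \<notin> \<real>\<^sub>\<le>\<^sub>0" if "Im w \<noteq> 0 \<or> Re w > 0" for w
    using that by (auto simp: complex_nonpos_Reals_iff)
  show "(log_0 j has_field_derivative 1 / z) (at z)"
  proof (cases j)
    case Below
    have "((\<lambda>z. Ln (- z) + \<i> * pi) has_field_derivative 1 / z) (at z)"
      using s Below nr[of "- z"] nz by (auto intro!: derivative_eq_intros simp: field_simps)
    then show ?thesis using Below fu by simp
  next
    case Between
    then show ?thesis using s nr[of z] fu by (auto intro!: derivative_eq_intros simp: divide_inverse)
  next
    case Beyond
    then show ?thesis using s nr[of z] fu by (auto intro!: derivative_eq_intros simp: divide_inverse)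
  qed
  have l1: "((\<lambda>z. Ln (1 - z) + \<i> * pi) has_field_derivative 1 / (z - 1)) (at z)" if "Im z \<noteq> 0 \<or> Re z < 1"
  proof -
    have "1 - z \<noteq> 0" using nz by auto
    then have "- inverse (1 - z) = 1 / (z - 1)" by (metis inverse_eq_divide inverse_minus_eq minus_diff_eq)
    moreover have "((\<lambda>z. Ln (1 - z) + \<i> * pi) has_field_derivative - inverse (1 - z)) (at z)"
      using that nr[of "1 - z"] by (auto intro!: derivative_eq_intros simp: divide_inverse)
    ultimately show ?thesis by simp
  qed
  show "(log_1 j has_field_derivative 1 / (z - 1)) (at z)"
  proof (cases j)
    case Beyond
    have "((\<lambda>z. Ln (z - 1)) has_field_derivative 1 / (z - 1)) (at z)"
      using s Beyond nr[of "z - 1"] nz by (auto intro!: derivative_eq_intros simp: divide_inverse)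
    then show ?thesis using Beyond fu by simp
  qed (use s l1 fu in auto)
qed

lemma power_branch_derivative:
  assumes "z \<in> sheet j"
  shows "(power_branch j A B has_field_derivative (A / z + B / (z - 1)) * power_branch j A B z) (at z)"
  unfolding power_branch_def[abs_def]
  using log_branch_derivative[OF assms] by (auto intro!: derivative_eq_intros simp: algebra_simps)

lemma log_branch_upper:
  assumes "Im z > 0" shows "log_0 i z = log_0 j z" "log_1 i z = log_1 j z"
proof -
  have "z \<noteq> 0" "z - 1 \<noteq> 0" using assms by auto
  then have "Ln (- z) = Ln z - \<i> * pi" "Ln (1 - z) = Ln (z - 1) - \<i> * pi"
    using assms Ln_minus[of z] Ln_minus[of "z - 1"] by auto
  then show "log_0 i z = log_0 j z" "log_1 i z = log_1 j z"
    by (cases i; cases j; simp)+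
qed

lemma power_branch_upper: "Im z > 0 \<Longrightarrow> power_branch i A B z = power_branch j A B z"
  unfolding power_branch_def using log_branch_upper[of z i j] by simp

text \<open>Two neighbouring branches agree above the axis and are continued downwards through
  neighbouring gaps. They differ by one turn around the singular point that separates these gaps,
  and only the logarithm at that point notices.\<close>

lemma power_branch_lower:
  assumes "Im z < 0"
  shows "power_branch Below A B z = e2pi A * power_branch Between A B z"
    "power_branch Between A B z = e2pi B * power_branch Beyond A B z"
proof -
  have "z \<noteq> 0" "z - 1 \<noteq> 0" using assms by auto
  then have "Ln (- z) = Ln z + \<i> * pi" "Ln (1 - z) = Ln (z - 1) + \<i> * pi"
    using assms Ln_minus[of z] Ln_minus[of "z - 1"] by auto
  then show "power_branch Below A B z = e2pi A * power_branch Between A B z"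
    "power_branch Between A B z = e2pi B * power_branch Beyond A B z"
    by (auto simp: power_branch_def exp_add[symmetric] algebra_simps)
qed

section \<open>Fundamental systems and constant changes of basis\<close>

definition wronskian :: "(complex \<Rightarrow> complex ^ 2) \<Rightarrow> (complex \<Rightarrow> complex ^ 2) \<Rightarrow> complex \<Rightarrow> complex" where
  "wronskian Y Y' z = Y z $ 1 * Y' z $ 2 - Y' z $ 1 * Y z $ 2"

definition fundamental_system :: "(complex \<Rightarrow> complex) \<Rightarrow> (complex \<Rightarrow> complex) \<Rightarrow> complex set \<Rightarrow>
    (complex \<Rightarrow> complex ^ 2) \<Rightarrow> (complex \<Rightarrow> complex ^ 2) \<Rightarrow> bool" where
  "fundamental_system p q S Y Y' \<longleftrightarrow>
     (\<forall>k. ode2 p q S (\<lambda>z. Y z $ k) (\<lambda>z. Y' z $ k)) \<and> (\<forall>z\<in>S. wronskian Y Y' z \<noteq> 0)"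

lemma fundamental_system_subset:
  "fundamental_system p q S Y Y' \<Longrightarrow> T \<subseteq> S \<Longrightarrow> fundamental_system p q T Y Y'"
  unfolding fundamental_system_def using ode2_subset by blast

lemma fundamental_system_span:
  assumes "open S" "connected S" "fundamental_system p q S Y Y'" "ode2 p q S y y'"
  obtains c :: "complex ^ 2" where "\<And>z. z \<in> S \<Longrightarrow> y z = (\<Sum>k\<in>UNIV. c $ k * Y z $ k)"
    "\<And>z. z \<in> S \<Longrightarrow> y' z = (\<Sum>k\<in>UNIV. c $ k * Y' z $ k)"
proof -
  obtain c1 c2 where c: "\<And>z. z \<in> S \<Longrightarrow> y z = c1 * Y z $ 1 + c2 * Y z $ 2"
    "\<And>z. z \<in> S \<Longrightarrow> y' z = c1 * Y' z $ 1 + c2 * Y' z $ 2"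
    using ode2_span[OF assms(1,2,4), of "\<lambda>z. Y z $ 1" "\<lambda>z. Y' z $ 1" "\<lambda>z. Y z $ 2" "\<lambda>z. Y' z $ 2"] assms(3)
    unfolding fundamental_system_def wronskian_def by blast
  show ?thesis by (rule that[of "vector [c1, c2]"]) (use c in \<open>auto simp: sum_2\<close>)
qed

lemma fundamental_system_independent:
  fixes c d :: "complex ^ 2"
  assumes "wronskian Y Y' z \<noteq> 0" "(\<Sum>k\<in>UNIV. c $ k * Y z $ k) = (\<Sum>k\<in>UNIV. d $ k * Y z $ k)"
    "(\<Sum>k\<in>UNIV. c $ k * Y' z $ k) = (\<Sum>k\<in>UNIV. d $ k * Y' z $ k)"
  shows "c = d"
proof -
  have "wronskian Y Y' z * (c $ 1 - d $ 1) = 0" "wronskian Y Y' z * (c $ 2 - d $ 2) = 0"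
    using assms(2,3) unfolding wronskian_def sum_2 by algebra+
  then show ?thesis using assms(1) by (auto simp: vec_eq_iff forall_2)
qed

lemma row_mult_column:
  fixes y c :: "complex ^ 2"
  shows "(\<Sum>k\<in>UNIV. c $ k * (y v* K) $ k) = (\<Sum>k\<in>UNIV. (K *v c) $ k * y $ k)"
  by (simp add: mat2_simps algebra_simps)

lemma fundamental_system_transition:
  fixes X X' :: "complex \<Rightarrow> complex ^ 2"
  assumes "open S" "connected S" "fundamental_system p q S Y Y'" "\<And>k. ode2 p q S (\<lambda>z. X z $ k) (\<lambda>z. X' z $ k)"
  obtains K :: "complex ^ 2 ^ 2" where "\<And>z. z \<in> S \<Longrightarrow> X z = Y z v* K" "\<And>z. z \<in> S \<Longrightarrow> X' z = Y' z v* K"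
proof -
  obtain c :: "complex ^ 2" where c: "\<And>z. z \<in> S \<Longrightarrow> X z $ 1 = (\<Sum>k\<in>UNIV. c $ k * Y z $ k)"
    "\<And>z. z \<in> S \<Longrightarrow> X' z $ 1 = (\<Sum>k\<in>UNIV. c $ k * Y' z $ k)"
    using fundamental_system_span[OF assms(1-3) assms(4)[of 1]] by blast
  obtain d :: "complex ^ 2" where d: "\<And>z. z \<in> S \<Longrightarrow> X z $ 2 = (\<Sum>k\<in>UNIV. d $ k * Y z $ k)"
    "\<And>z. z \<in> S \<Longrightarrow> X' z $ 2 = (\<Sum>k\<in>UNIV. d $ k * Y' z $ k)"
    using fundamental_system_span[OF assms(1-3) assms(4)[of 2]] by blast
  show ?thesis
    by (rule that[of "vector [vector [c $ 1, d $ 1], vector [c $ 2, d $ 2]]"])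
       (use c d in \<open>auto simp: vec_eq_iff forall_2 vector_matrix_mult_def sum_2\<close>)
qed

lemma wronskian_mult: "wronskian (\<lambda>z. Y z v* K) (\<lambda>z. Y' z v* K) z = wronskian Y Y' z * det K"
  unfolding wronskian_def det_2 vector_matrix_mult_def by (simp add: sum_2 algebra_simps)

lemma fundamental_system_mult:
  assumes "fundamental_system p q S Y Y'" "invertible K"
  shows "fundamental_system p q S (\<lambda>z. Y z v* K) (\<lambda>z. Y' z v* K)"
proof -
  have "(\<lambda>z. (Y z v* K) $ k) = (\<lambda>z. K $ 1 $ k * Y z $ 1 + K $ 2 $ k * Y z $ 2)" for Y :: "complex \<Rightarrow> complex ^ 2" and k
    by (simp add: fun_eq_iff vector_matrix_mult_def sum_2 mult.commute)
  moreover have "det K \<noteq> 0" using assms(2) by (simp add: invertible_det_nz)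
  ultimately show ?thesis
    using assms(1) unfolding fundamental_system_def wronskian_mult by (simp add: ode2_add_scaled)
qed

text \<open>The determinant supplies the second eigenvalue. Diagonalizability is not assumed, so
  coinciding eigenvalues and logarithmic solutions are covered as well.\<close>

lemma trace_from_eigenvalue:
  fixes K :: "complex ^ 2 ^ 2"
  assumes "v \<noteq> 0" "K *v v = k *s v" "det K = k * k'" "k \<noteq> 0"
  shows "trace K = k + k'"
proof -
  have "k *s (k *s v) = trace K *s (k *s v) - (k * k') *s v"
    using Cayley_Hamilton_2[of K v] assms by (simp add: vector_scalar_commute)
  then have "(k * (trace K - (k + k'))) *s v = 0"
    by (simp add: mat2_simps algebra_simps)
  then have "k * (trace K - (k + k')) = 0" using assms(1) vector_mul_eq_0 by blast
  then show ?thesis using assms(4) by (metis mult_eq_0_iff right_minus_eq)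
qed

locale sheet_bases =
  fixes r r' s s' t t' :: complex and Y Y' :: "gap \<Rightarrow> complex \<Rightarrow> complex ^ 2"
    and K :: "gap \<Rightarrow> gap \<Rightarrow> complex ^ 2 ^ 2"
  assumes sum: "r + r' + s + s' + t + t' = 1"
    and fund: "fundamental_system (riemann_p r r' s s') (riemann_q r r' s s' t t') (sheet j) (Y j) (Y' j)"
    and upper: "Im z > 0 \<Longrightarrow> Y i z = Y j z" "Im z > 0 \<Longrightarrow> Y' i z = Y' j z"
    and lower: "Im z < 0 \<Longrightarrow> Y i z = Y j z v* K i j" "Im z < 0 \<Longrightarrow> Y' i z = Y' j z v* K i j"
begin

lemma wronskian_nonzero: "z \<in> sheet j \<Longrightarrow> wronskian (Y j) (Y' j) z \<noteq> 0"
  using fund unfolding fundamental_system_def by blast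

text \<open>Values and derivatives at one point suffice, because the Wronskian does not vanish
  there; this is why transition matrices can always be evaluated at a single point of the lower half
  plane.\<close>

lemma transition_unique:
  assumes "Im z < 0" "Y i z = Y j z v* M" "Y' i z = Y' j z v* M"
  shows "K i j = M"
proof -
  have "K i j *v c = M *v c" for c
  proof (rule fundamental_system_independent[OF wronskian_nonzero[of z j]])
    show "z \<in> sheet j" using assms sheet_nonreal by force
    show "(\<Sum>k\<in>UNIV. (K i j *v c) $ k * Y j z $ k) = (\<Sum>k\<in>UNIV. (M *v c) $ k * Y j z $ k)"
      unfolding row_mult_column[symmetric] using lower(1)[of z i j] assms by simp
    show "(\<Sum>k\<in>UNIV. (K i j *v c) $ k * Y' j z $ k) = (\<Sum>k\<in>UNIV. (M *v c) $ k * Y' j z $ k)"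
      unfolding row_mult_column[symmetric] using lower(2)[of z i j] assms by simp
  qed
  then show ?thesis by (simp add: matrix_eq)
qed

text \<open>The factors appear in reverse order because the matrices act on rows from the
  right.\<close>

lemma transition_cocycle: "K i k = K j k ** K i j"
proof (rule transition_unique[of "- \<i>"])
  show "Y i (- \<i>) = Y k (- \<i>) v* (K j k ** K i j)"
    using lower(1)[of "- \<i>" i j] lower(1)[of "- \<i>" j k] by (simp add: vector_matrix_mul_assoc)
  show "Y' i (- \<i>) = Y' k (- \<i>) v* (K j k ** K i j)"
    using lower(2)[of "- \<i>" i j] lower(2)[of "- \<i>" j k] by (simp add: vector_matrix_mul_assoc)
qed simp

text \<open>Abel's formula: the logarithmic derivative of the Wronskian is
  \<open>- riemann_p r r' s s'\<close>, which belongs to the exponents \<open>r + r' - 1\<close> and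
  \<open>s + s' - 1\<close>. The constant is the same on all sheets since bases and branches agree
  on the upper half plane.\<close>

lemma wronskian_power_branch:
  obtains c where "c \<noteq> 0" "\<And>j z. z \<in> sheet j \<Longrightarrow> wronskian (Y j) (Y' j) z = c * power_branch j (r + r' - 1) (s + s' - 1) z"
proof -
  let ?g = "\<lambda>j. power_branch j (r + r' - 1) (s + s' - 1)"
  have "\<exists>c. \<forall>z\<in>sheet j. wronskian (Y j) (Y' j) z = c * ?g j z" for j
  proof -
    obtain c where "\<And>z. z \<in> sheet j \<Longrightarrow> wronskian (Y j) (Y' j) z = c * ?g j z"
    proof (rule proportional_if_same_log_derivative[of "sheet j" "wronskian (Y j) (Y' j)" "\<lambda>z. - riemann_p r r' s s' z" "?g j"])
      show "open (sheet j)" "connected (sheet j)" by (auto simp: open_sheet connected_sheet)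
      fix z assume z: "z \<in> sheet j"
      show "(wronskian (Y j) (Y' j) has_field_derivative - riemann_p r r' s s' z * wronskian (Y j) (Y' j) z) (at z)"
        using wronskian_has_field_derivative[of _ _ "sheet j" "\<lambda>z. Y j z $ 1" "\<lambda>z. Y' j z $ 1" "\<lambda>z. Y j z $ 2" "\<lambda>z. Y' j z $ 2"] fund[of j] z
        unfolding fundamental_system_def wronskian_def[abs_def] by blast
      have "- riemann_p r r' s s' z = (r + r' - 1) / z + (s + s' - 1) / (z - 1)"
        unfolding riemann_p_def minus_add minus_divide_left by (simp add: algebra_simps)
      then show "(?g j has_field_derivative - riemann_p r r' s s' z * ?g j z) (at z)"
        using power_branch_derivative[OF z] by simp
    qed auto
    then show ?thesis by blast
  qed
  then obtain c where c: "\<And>j z. z \<in> sheet j \<Longrightarrow> wronskian (Y j) (Y' j) z = c j * ?g j z" by metis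
  have "c i = c j" for i j
  proof -
    have "wronskian (Y i) (Y' i) \<i> = wronskian (Y j) (Y' j) \<i>"
      using upper[of \<i> i j] by (simp add: wronskian_def)
    then show ?thesis using c[of \<i> i] c[of \<i> j] sheet_nonreal[of \<i>] power_branch_upper[of \<i> i _ _ j] by simp
  qed
  then have "wronskian (Y j) (Y' j) z = c Below * ?g j z" if "z \<in> sheet j" for j z
    using c[OF that] by metis
  moreover have "c Below \<noteq> 0"
    using c[of \<i> Below] wronskian_nonzero[of \<i> Below] sheet_nonreal[of \<i>] by auto
  ultimately show ?thesis using that by blast
qed

lemma det_transition:
  assumes "\<And>z. Im z < 0 \<Longrightarrow> power_branch i (r + r' - 1) (s + s' - 1) z = k * power_branch j (r + r' - 1) (s + s' - 1) z"
  shows "det (K i j) = k"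
proof -
  let ?g = "\<lambda>j. power_branch j (r + r' - 1) (s + s' - 1) (- \<i>)"
  obtain c where c: "c \<noteq> 0" "\<And>j z. z \<in> sheet j \<Longrightarrow> wronskian (Y j) (Y' j) z = c * power_branch j (r + r' - 1) (s + s' - 1) z"
    using wronskian_power_branch by metis
  have "wronskian (Y i) (Y' i) (- \<i>) = wronskian (\<lambda>z. Y j z v* K i j) (\<lambda>z. Y' j z v* K i j) (- \<i>)"
    unfolding wronskian_def using lower[of "- \<i>" i j] by simp
  then have "c * ?g i = c * ?g j * det (K i j)"
    using c(2)[of "- \<i>"] sheet_nonreal[of "- \<i>"] by (simp add: wronskian_mult)
  then show ?thesis using c(1) assms[of "- \<i>"] by simp
qed

lemma exp_2pi_sub_1: "e2pi (x - 1) = e2pi x"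
proof -
  have "2 * pi * \<i> * (x - 1) = 2 * pi * \<i> * x - 2 * pi * \<i>" by (simp add: algebra_simps)
  then show ?thesis by (simp add: exp_diff)
qed

lemma det_K:
  "det (K Below Between) = e2pi r * e2pi r'"
  "det (K Between Beyond) = e2pi s * e2pi s'"
  "det (K Below Beyond) = exp (- 2 * pi * \<i> * t) * exp (- 2 * pi * \<i> * t')"
proof -
  have "det (K Below Between) = e2pi (r + r' - 1)"
    by (intro det_transition power_branch_lower(1))
  then show 1: "det (K Below Between) = e2pi r * e2pi r'"
    unfolding exp_2pi_sub_1 by (simp add: exp_add[symmetric] algebra_simps)
  have "det (K Between Beyond) = e2pi (s + s' - 1)"
    by (intro det_transition power_branch_lower(2))
  then show 2: "det (K Between Beyond) = e2pi s * e2pi s'"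
    unfolding exp_2pi_sub_1 by (simp add: exp_add[symmetric] algebra_simps)
  \<comment> \<open>Fuchs' relation expresses the third determinant through the exponents at
    infinity; the integer 1 disappears under the exponential.\<close>
  have rs: "r + r' + s + s' = 1 - t - t'" using sum by (simp add: algebra_simps)
  have "det (K Below Beyond) = det (K Between Beyond) * det (K Below Between)"
    by (metis det_mul transition_cocycle)
  also have "\<dots> = e2pi (r + r' + s + s')"
    unfolding 1 2 by (simp add: exp_add[symmetric] algebra_simps)
  also have "2 * pi * \<i> * (r + r' + s + s') = - 2 * pi * \<i> * t + - 2 * pi * \<i> * t' + 2 * pi * \<i>"
    unfolding rs by (simp add: algebra_simps)
  also have "exp \<dots> = exp (- 2 * pi * \<i> * t) * exp (- 2 * pi * \<i> * t')"
    unfolding exp_add by simp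
  finally show "det (K Below Beyond) = exp (- 2 * pi * \<i> * t) * exp (- 2 * pi * \<i> * t')" .
qed

text \<open>The local solution \<open>g * u\<close> has the same coefficient column \<open>c\<close>
  on both sheets, because everything agrees above the axis. Below it the two branches differ by the
  scalar \<open>k\<close> and the two bases by \<open>K i j\<close>, so \<open>c\<close> is an
  eigenvector. The point \<open>z0\<close> guarantees that it is not zero.\<close>

lemma transition_eigenvector:
  fixes g :: "gap \<Rightarrow> complex \<Rightarrow> complex"
  assumes W: "open W" "connected (W \<inter> sheet i)" "connected (W \<inter> sheet j)"
    and ode: "\<And>l. l = i \<or> l = j \<Longrightarrow> ode2 (riemann_p r r' s s') (riemann_q r r' s s' t t') (W \<inter> sheet l) (\<lambda>z. g l z * u z) (\<lambda>z. g l z * v z)"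
    and up: "\<And>z. Im z > 0 \<Longrightarrow> g i z = g j z" and low: "\<And>z. Im z < 0 \<Longrightarrow> g i z = k * g j z"
    and z0: "z0 \<in> W" "Im z0 > 0" "g i z0 * u z0 \<noteq> 0" and z1: "z1 \<in> W" "Im z1 < 0"
  obtains c where "c \<noteq> 0" "K i j *v c = k *s c"
proof -
  have op: "open (W \<inter> sheet l)" for l using W(1) open_sheet by blast
  have fs: "fundamental_system (riemann_p r r' s s') (riemann_q r r' s s' t t') (W \<inter> sheet l) (Y l) (Y' l)" for l
    using fundamental_system_subset[OF fund[of l]] by simp
  obtain c where c: "\<And>z. z \<in> W \<inter> sheet i \<Longrightarrow> g i z * u z = (\<Sum>k\<in>UNIV. c $ k * Y i z $ k)"
    "\<And>z. z \<in> W \<inter> sheet i \<Longrightarrow> g i z * v z = (\<Sum>k\<in>UNIV. c $ k * Y' i z $ k)"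
    using fundamental_system_span[OF op W(2) fs ode[OF disjI1[OF refl]]] by metis
  obtain d where d: "\<And>z. z \<in> W \<inter> sheet j \<Longrightarrow> g j z * u z = (\<Sum>k\<in>UNIV. d $ k * Y j z $ k)"
    "\<And>z. z \<in> W \<inter> sheet j \<Longrightarrow> g j z * v z = (\<Sum>k\<in>UNIV. d $ k * Y' j z $ k)"
    using fundamental_system_span[OF op W(3) fs ode[OF disjI2[OF refl]]] by metis
  have z0s: "z0 \<in> W \<inter> sheet l" and z1s: "z1 \<in> W \<inter> sheet l" for l using z0 z1 sheet_nonreal by auto
  have cd: "c = d"
  proof (rule fundamental_system_independent[OF wronskian_nonzero[of z0 i]])
    show "z0 \<in> sheet i" using z0s by auto
    show "(\<Sum>k\<in>UNIV. c $ k * Y i z0 $ k) = (\<Sum>k\<in>UNIV. d $ k * Y i z0 $ k)"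
      using c(1)[OF z0s] d(1)[OF z0s] up[OF z0(2)] upper(1)[OF z0(2), of i j] by simp
    show "(\<Sum>k\<in>UNIV. c $ k * Y' i z0 $ k) = (\<Sum>k\<in>UNIV. d $ k * Y' i z0 $ k)"
      using c(2)[OF z0s] d(2)[OF z0s] up[OF z0(2)] upper(2)[OF z0(2), of i j] by simp
  qed
  have "K i j *v c = k *s c"
  proof (rule fundamental_system_independent[OF wronskian_nonzero[of z1 j]])
    show "z1 \<in> sheet j" using z1s by auto
    show "(\<Sum>l\<in>UNIV. (K i j *v c) $ l * Y j z1 $ l) = (\<Sum>l\<in>UNIV. (k *s c) $ l * Y j z1 $ l)"
      unfolding row_mult_column[symmetric] lower(1)[OF z1(2), of i j, symmetric] c(1)[OF z1s, symmetric]
      using d(1)[OF z1s] low[OF z1(2)] cd by (simp add: sum_2 algebra_simps)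
    show "(\<Sum>l\<in>UNIV. (K i j *v c) $ l * Y' j z1 $ l) = (\<Sum>l\<in>UNIV. (k *s c) $ l * Y' j z1 $ l)"
      unfolding row_mult_column[symmetric] lower(2)[OF z1(2), of i j, symmetric] c(2)[OF z1s, symmetric]
      using d(2)[OF z1s] low[OF z1(2)] cd by (simp add: sum_2 algebra_simps)
  qed
  moreover have "c \<noteq> 0" using c(1)[OF z0s] z0(3) by auto
  ultimately show ?thesis using that by blast
qed

lemma trace_K_0_aux:
  assumes "Re r \<ge> Re r'"
  shows "trace (K Below Between) = e2pi r + e2pi r'"
proof (rule riemann_local_solution_0[OF sum assms])
  fix u v assume u: "continuous (at 0) u" "u 0 = 1"
    "\<And>S g. S \<subseteq> ball 0 1 - {0} \<Longrightarrow> (\<And>z. z \<in> S \<Longrightarrow> (g has_field_derivative (r / z + s / (z - 1)) * g z) (at z)) \<Longrightarrow>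
       ode2 (riemann_p r r' s s') (riemann_q r r' s s' t t') S (\<lambda>z. g z * u z) (\<lambda>z. g z * v z)"
  obtain e where e: "e > 0" "\<And>z. dist 0 z < e \<Longrightarrow> u z \<noteq> 0"
    using continuous_at_avoid[OF u(1), of 0] u(2) by auto
  \<comment> \<open>The test point \<open>\<i> * d\<close> lies in the unit disc above the axis, and
    close enough to 0 for \<open>u\<close> not to vanish there.\<close>
  define d where "d = min (e / 2) (1 / 2)"
  have d: "d > 0" "d < e" "d < 1" using e by (auto simp: d_def)
  obtain c where "c \<noteq> 0" "K Below Between *v c = e2pi r *s c"
  proof (rule transition_eigenvector[of "ball 0 1" Below Between "\<lambda>l. power_branch l r s" u v])
    show "connected (ball 0 1 \<inter> sheet Below)"
      unfolding sheet_def by (rule connected_ball_slit[of _ "- 1/2"]) (auto simp: convex_gap_interval norm_divide)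
    show "connected (ball 0 1 \<inter> sheet Between)"
      unfolding sheet_def by (rule connected_ball_slit[of _ "1/2"]) (auto simp: convex_gap_interval norm_divide)
    show "ode2 (riemann_p r r' s s') (riemann_q r r' s s' t t') (ball 0 1 \<inter> sheet l) (\<lambda>z. power_branch l r s z * u z) (\<lambda>z. power_branch l r s z * v z)" for l
      by (rule u(3)) (use sheet_subset power_branch_derivative in auto)
    show "\<i> * d \<in> ball 0 1" using d by (simp add: norm_mult)
    show "Im (\<i> * d) > 0" using d by simp
    show "power_branch Below r s (\<i> * d) * u (\<i> * d) \<noteq> 0" using d e(2)[of "\<i> * d"] by (simp add: norm_mult)
    show "- \<i> / 2 \<in> ball 0 1" "Im (- \<i> / 2) < 0" by (auto simp: norm_divide)
  qed (auto simp: power_branch_lower power_branch_upper)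
  from trace_from_eigenvalue[OF this det_K(1)] show ?thesis by simp
qed

lemma trace_K_1_aux:
  assumes "Re s \<ge> Re s'"
  shows "trace (K Between Beyond) = e2pi s + e2pi s'"
proof (rule riemann_local_solution_1[OF sum assms])
  fix u v assume u: "continuous (at 1) u" "u 1 = 1"
    "\<And>S g. S \<subseteq> ball 1 1 - {1} \<Longrightarrow> (\<And>z. z \<in> S \<Longrightarrow> (g has_field_derivative (r / z + s / (z - 1)) * g z) (at z)) \<Longrightarrow>
       ode2 (riemann_p r r' s s') (riemann_q r r' s s' t t') S (\<lambda>z. g z * u z) (\<lambda>z. g z * v z)"
  obtain e where e: "e > 0" "\<And>z. dist 1 z < e \<Longrightarrow> u z \<noteq> 0"
    using continuous_at_avoid[OF u(1), of 0] u(2) by auto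
  define d where "d = min (e / 2) (1 / 2)"
  have d: "d > 0" "d < e" "d < 1" using e by (auto simp: d_def)
  obtain c where "c \<noteq> 0" "K Between Beyond *v c = e2pi s *s c"
  proof (rule transition_eigenvector[of "ball 1 1" Between Beyond "\<lambda>l. power_branch l r s" u v])
    show "connected (ball 1 1 \<inter> sheet Between)"
      unfolding sheet_def by (rule connected_ball_slit[of _ "1/2"]) (auto simp: convex_gap_interval dist_norm norm_divide)
    show "connected (ball 1 1 \<inter> sheet Beyond)"
      unfolding sheet_def by (rule connected_ball_slit[of _ "3/2"]) (auto simp: convex_gap_interval dist_norm norm_divide)
    show "ode2 (riemann_p r r' s s') (riemann_q r r' s s' t t') (ball 1 1 \<inter> sheet l) (\<lambda>z. power_branch l r s z * u z) (\<lambda>z. power_branch l r s z * v z)" for l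
      by (rule u(3)) (use sheet_subset power_branch_derivative in auto)
    show "1 + \<i> * d \<in> ball 1 1" using d by (simp add: norm_mult dist_norm)
    show "Im (1 + \<i> * d) > 0" using d by simp
    show "power_branch Between r s (1 + \<i> * d) * u (1 + \<i> * d) \<noteq> 0" using d e(2)[of "1 + \<i> * d"] by (simp add: norm_mult dist_norm)
    show "1 - \<i> / 2 \<in> ball 1 1" "Im (1 - \<i> / 2) < 0" by (auto simp: norm_divide dist_norm)
  qed (auto simp: power_branch_lower power_branch_upper)
  from trace_from_eigenvalue[OF this det_K(2)] show ?thesis by simp
qed

text \<open>Inversion maps the outside of the unit disc to the punctured disc and the real axis to
  itself, so the claim is the one for a slit disc with the inverted interval;
  \<open>0 \<notin> I\<close> means that the centre lies on the cut. In this way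
  \<open>Beyond\<close> corresponds to the interval from 0 to 1.\<close>

lemma connected_outside_ball_slit:
  assumes "convex I" "c \<in> I" "\<bar>c\<bar> < 1" and J: "\<And>x. \<bar>x\<bar> > 1 \<Longrightarrow> x \<in> J \<longleftrightarrow> 1 / x \<in> I" and "0 \<notin> I"
  shows "connected (- cball 0 1 \<inter> slit J)"
proof -
  have nz: "0 \<notin> slit I" using assms by (simp add: slit_def)
  have iff: "z \<in> slit J \<longleftrightarrow> 1 / z \<in> slit I" if "norm z > 1" for z
  proof (cases "Im z = 0")
    case True
    then have "z = of_real (Re z)" by (simp add: complex_eq_iff)
    then obtain x where x: "z = of_real x" by blast
    then have "\<bar>x\<bar> > 1" using that by simp
    have "1 / z = of_real (1 / x)" using x by simp
    then have "1 / z \<in> slit I \<longleftrightarrow> 1 / x \<in> I" by (simp only: slit_def) simp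
    then show ?thesis using J[OF \<open>\<bar>x\<bar> > 1\<close>] x by (simp add: slit_def)
  next
    case False
    then have "Im (1 / z) \<noteq> 0" by (simp add: Im_divide)
    then show ?thesis using False by (simp add: slit_def)
  qed
  have "- cball 0 1 \<inter> slit J = (\<lambda>z. 1 / z) ` (ball 0 1 \<inter> slit I)"
  proof (intro equalityI subsetI)
    fix z assume z: "z \<in> - cball 0 1 \<inter> slit J"
    then have "1 / z \<in> ball 0 1 \<inter> slit I" using iff[of z] by (auto simp: norm_divide divide_less_eq)
    then show "z \<in> (\<lambda>z. 1 / z) ` (ball 0 1 \<inter> slit I)" by (intro image_eqI[of _ _ "1 / z"]) auto
  next
    fix z assume "z \<in> (\<lambda>z. 1 / z) ` (ball 0 1 \<inter> slit I)"
    then obtain w where w: "z = 1 / w" "norm w < 1" "w \<in> slit I" by auto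
    then have "w \<noteq> 0" using nz by auto
    then have "norm z > 1" using w by (auto simp: norm_divide less_divide_eq)
    then show "z \<in> - cball 0 1 \<inter> slit J" using iff[of z] w by auto
  qed
  moreover have "connected ((\<lambda>z. 1 / z) ` (ball 0 1 \<inter> slit I))"
    using assms nz by (intro connected_continuous_image connected_ball_slit[of _ c] continuous_intros) auto
  ultimately show ?thesis by simp
qed

lemma trace_K_infinity_aux:
  assumes "Re t \<ge> Re t'"
  shows "trace (K Below Beyond) = exp (- 2 * pi * \<i> * t) + exp (- 2 * pi * \<i> * t')"
proof (rule riemann_local_solution_infinity[OF sum assms])
  fix u v assume u: "continuous (at 0) u" "u 0 = 1"
    "\<And>S g. S \<subseteq> - cball 0 1 \<Longrightarrow> (\<And>z. z \<in> S \<Longrightarrow> (g has_field_derivative (- (t + s) / z + s / (z - 1)) * g z) (at z)) \<Longrightarrow>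
       ode2 (riemann_p r r' s s') (riemann_q r r' s s' t t') S (\<lambda>z. g z * u (1 / z)) (\<lambda>z. g z * v z)"
  obtain e where e: "e > 0" "\<And>z. dist 0 z < e \<Longrightarrow> u z \<noteq> 0"
    using continuous_at_avoid[OF u(1), of 0] u(2) by auto
  define d where "d = min (e / 2) (1 / 2)"
  have d: "d > 0" "d < e" "d < 1" using e by (auto simp: d_def)
  obtain c where "c \<noteq> 0" "K Below Beyond *v c = exp (- 2 * pi * \<i> * t) *s c"
  proof (rule transition_eigenvector[of "- cball 0 1" Below Beyond "\<lambda>l. power_branch l (- (t + s)) s" "\<lambda>z. u (1 / z)" v])
    show "connected (- cball 0 1 \<inter> sheet Below)"
      unfolding sheet_def by (rule connected_outside_ball_slit[of "{..<0}" "- 1/2"]) (auto simp: convex_real_interval divide_less_0_iff)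
    show "connected (- cball 0 1 \<inter> sheet Beyond)"
      unfolding sheet_def by (rule connected_outside_ball_slit[of "{0<..<1}" "1/2"]) (auto simp: convex_real_interval divide_less_eq)
    show "ode2 (riemann_p r r' s s') (riemann_q r r' s s' t t') (- cball 0 1 \<inter> sheet l) (\<lambda>z. power_branch l (- (t + s)) s z * u (1 / z)) (\<lambda>z. power_branch l (- (t + s)) s z * v z)" for l
      by (rule u(3)) (use power_branch_derivative in auto)
    have dd: "1 / (\<i> / d) = - \<i> * d" "norm (\<i> / d) = 1 / d" using d by (auto simp: field_simps norm_divide)
    show "\<i> / d \<in> - cball 0 1" using d by (simp add: dd del: norm_divide)
    show "Im (\<i> / d) > 0" using d by simp
    show "power_branch Below (- (t + s)) s (\<i> / d) * u (1 / (\<i> / d)) \<noteq> 0" using d e(2)[of "- \<i> * d"] unfolding dd by (simp add: norm_mult)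
    show "- 2 * \<i> \<in> - cball 0 1" "Im (- 2 * \<i>) < 0" by (auto simp: norm_mult)
    show "power_branch Below (- (t + s)) s z = exp (- 2 * pi * \<i> * t) * power_branch Beyond (- (t + s)) s z" if "Im z < 0" for z
    proof -
      \<comment> \<open>Between the outer gaps lie both 0 and 1, so the branch picks up the factors
        of both points; the contributions of \<open>s\<close> cancel.\<close>
      have "e2pi (- (t + s)) * e2pi s = exp (- 2 * pi * \<i> * t)"
        by (simp add: exp_add[symmetric] algebra_simps)
      then show ?thesis unfolding power_branch_lower[OF that] by (metis mult.assoc)
    qed
  qed (auto simp: power_branch_upper)
  from trace_from_eigenvalue[OF this det_K(3)] show ?thesis by simp
qed

text \<open>The equation does not change when the two exponents at a point are exchanged, so the
  same bases and matrices are also instances with exchanged exponents. This removes the assumption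
  on real parts.\<close>

lemma trace_K:
  "trace (K Below Between) = e2pi r + e2pi r'"
  "trace (K Between Beyond) = e2pi s + e2pi s'"
  "trace (K Below Beyond) = exp (- 2 * pi * \<i> * t) + exp (- 2 * pi * \<i> * t')"
proof -
  have sym: "riemann_p r' r s s' = riemann_p r r' s s'" "riemann_p r r' s' s = riemann_p r r' s s'"
    "riemann_q r' r s s' t t' = riemann_q r r' s s' t t'" "riemann_q r r' s' s t t' = riemann_q r r' s s' t t'"
    "riemann_q r r' s s' t' t = riemann_q r r' s s' t t'"
    by (auto simp: riemann_p_def riemann_q_def mult.commute algebra_simps)
  interpret R: sheet_bases r' r s s' t t' Y Y' K
    by unfold_locales (use sum fund upper lower in \<open>auto simp: sym algebra_simps\<close>)
  interpret S: sheet_bases r r' s' s t t' Y Y' K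
    by unfold_locales (use sum fund upper lower in \<open>auto simp: sym algebra_simps\<close>)
  interpret T: sheet_bases r r' s s' t' t Y Y' K
    by unfold_locales (use sum fund upper lower in \<open>auto simp: sym algebra_simps\<close>)
  show "trace (K Below Between) = e2pi r + e2pi r'"
    using trace_K_0_aux R.trace_K_0_aux by (metis add.commute linear)
  show "trace (K Between Beyond) = e2pi s + e2pi s'"
    using trace_K_1_aux S.trace_K_1_aux by (metis add.commute linear)
  show "trace (K Below Beyond) = exp (- 2 * pi * \<i> * t) + exp (- 2 * pi * \<i> * t')"
    using trace_K_infinity_aux T.trace_K_infinity_aux by (metis add.commute linear)
qed

end

section \<open>Existence of compatible bases on the three sheets\<close>

lemma riemann_pq_holomorphic:
  "riemann_p r r' s s' holomorphic_on sheet j" "riemann_q r r' s s' t t' holomorphic_on sheet j"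
  unfolding riemann_p_def[abs_def] riemann_q_def[abs_def]
  using sheet_subset[of j] by (auto intro!: holomorphic_intros)

lemma fundamental_system_on_sheet:
  obtains Y Y' where "fundamental_system (riemann_p r r' s s') (riemann_q r r' s s' t t') (sheet j) Y Y'"
proof -
  let ?p = "riemann_p r r' s s'" and ?q = "riemann_q r r' s s' t t'" and ?a = "of_real (gap_centre j) :: complex"
  obtain y1 y1' where y1: "ode2 ?p ?q (sheet j) y1 y1'" "y1 ?a = 1" "y1' ?a = 0"
    using ode2_initial_value_problem[OF open_sheet sheet_centre closed_segment_subset_sheet riemann_pq_holomorphic] by metis
  obtain y2 y2' where y2: "ode2 ?p ?q (sheet j) y2 y2'" "y2 ?a = 0" "y2' ?a = 1"
    using ode2_initial_value_problem[OF open_sheet sheet_centre closed_segment_subset_sheet riemann_pq_holomorphic] by metis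
  let ?W = "\<lambda>z. y1 z * y2' z - y1' z * y2 z" and ?g = "power_branch j (r + r' - 1) (s + s' - 1)"
  have "(?g has_field_derivative - ?p z * ?g z) (at z)" if "z \<in> sheet j" for z
  proof -
    have "- ?p z = (r + r' - 1) / z + (s + s' - 1) / (z - 1)"
      unfolding riemann_p_def minus_add minus_divide_left by (simp add: algebra_simps)
    then show ?thesis using power_branch_derivative[OF that] by simp
  qed
  then obtain c where c: "\<And>z. z \<in> sheet j \<Longrightarrow> ?W z = c * ?g z"
    using proportional_if_same_log_derivative[OF open_sheet connected_sheet wronskian_has_field_derivative[OF y1(1) y2(1)], where g = ?g] power_branch_nonzero
    by blast
  have "c \<noteq> 0" using c[OF sheet_centre] y1 y2 by auto
  then have "?W z \<noteq> 0" if "z \<in> sheet j" for z using c[OF that] by simp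
  then have "fundamental_system ?p ?q (sheet j) (\<lambda>z. vector [y1 z, y2 z]) (\<lambda>z. vector [y1' z, y2' z])"
    unfolding fundamental_system_def forall_2 wronskian_def using y1(1) y2(1) by simp
  then show ?thesis using that by blast
qed

text \<open>On the connected upper half plane a constant matrix relates any basis to that of
  \<open>Between\<close>; multiplying by it makes the bases agree there. All monodromy is then
  concentrated in the constant matrices of the lower half plane.\<close>

lemma exists_sheet_bases:
  assumes "r + r' + s + s' + t + t' = 1"
  obtains Y Y' K where "sheet_bases r r' s s' t t' Y Y' K"
proof -
  let ?p = "riemann_p r r' s s'" and ?q = "riemann_q r r' s s' t t'"
  let ?U = "{z. Im z > 0}" and ?L = "{z. Im z < 0}"
  have U: "open ?U" "connected ?U" and L: "open ?L" "connected ?L"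
    by (auto simp: open_halfspace_Im_gt open_halfspace_Im_lt convex_connected convex_halfspace_Im_gt convex_halfspace_Im_lt)
  have US: "?U \<subseteq> sheet j" and LS: "?L \<subseteq> sheet j" for j using sheet_nonreal by auto
  obtain X X' where X: "\<And>j. fundamental_system ?p ?q (sheet j) (X j) (X' j)"
  proof -
    have "\<exists>X X'. fundamental_system ?p ?q (sheet j) X X'" for j
      by (rule fundamental_system_on_sheet) blast
    then show thesis using that by metis
  qed
  have "\<exists>M. \<forall>z\<in>?U. X Between z = X j z v* M \<and> X' Between z = X' j z v* M" for j
    using fundamental_system_transition[OF U fundamental_system_subset[OF X US], of "X Between" "X' Between" j]
      fundamental_system_subset[OF X US, of Between] unfolding fundamental_system_def by metis
  then obtain M where M: "\<And>j z. Im z > 0 \<Longrightarrow> X Between z = X j z v* M j" "\<And>j z. Im z > 0 \<Longrightarrow> X' Between z = X' j z v* M j"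
    by (metis mem_Collect_eq)
  have invM: "invertible (M j)" for j
  proof -
    have "wronskian (X Between) (X' Between) \<i> = wronskian (X j) (X' j) \<i> * det (M j)"
      unfolding wronskian_mult[symmetric] using M[of \<i> j] by (simp add: wronskian_def)
    moreover have "wronskian (X Between) (X' Between) \<i> \<noteq> 0"
      using X[of Between] sheet_nonreal[of \<i>] unfolding fundamental_system_def by simp
    ultimately show ?thesis by (auto simp: invertible_det_nz)
  qed
  define Y where "Y j z = X j z v* M j" for j z
  define Y' where "Y' j z = X' j z v* M j" for j z
  have Y: "fundamental_system ?p ?q (sheet j) (Y j) (Y' j)" for j
    using fundamental_system_mult[OF X invM] unfolding Y_def[abs_def] Y'_def[abs_def] .
  have "\<exists>K. \<forall>z\<in>?L. Y i z = Y j z v* K \<and> Y' i z = Y' j z v* K" for i j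
    using fundamental_system_transition[OF L fundamental_system_subset[OF Y LS], of "Y i" "Y' i" j]
      fundamental_system_subset[OF Y LS, of i] unfolding fundamental_system_def by metis
  then obtain K where K: "\<And>i j z. Im z < 0 \<Longrightarrow> Y i z = Y j z v* K i j" "\<And>i j z. Im z < 0 \<Longrightarrow> Y' i z = Y' j z v* K i j"
    by (metis mem_Collect_eq)
  have "sheet_bases r r' s s' t t' Y Y' K"
  proof
    show "Im z > 0 \<Longrightarrow> Y i z = Y j z" "Im z > 0 \<Longrightarrow> Y' i z = Y' j z" for i j z
      using M[of z i] M[of z j] by (simp_all add: Y_def Y'_def)
  qed (use Y K assms in auto)
  then show ?thesis using that by blast
qed

section \<open>Representations of the fundamental group\<close>

definition path_in :: "'a::topological_space set \<Rightarrow> (real \<Rightarrow> 'a) \<Rightarrow> bool" where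
  "path_in S g \<longleftrightarrow> path g \<and> path_image g \<subseteq> S"

lemma path_in_join: "path_in S g \<Longrightarrow> path_in S h \<Longrightarrow> pathfinish g = pathstart h \<Longrightarrow> path_in S (g +++ h)"
  by (auto simp: path_in_def path_image_join)

lemma path_in_reversepath [simp]: "path_in S (reversepath g) \<longleftrightarrow> path_in S g"
  by (auto simp: path_in_def)

lemma path_in_subset: "path_in S g \<Longrightarrow> S \<subseteq> T \<Longrightarrow> path_in T g"
  by (auto simp: path_in_def)

lemma path_in_linepath_refl: "x \<in> S \<Longrightarrow> path_in S (linepath x x)"
  by (auto simp: path_in_def)

lemma path_in_endpoints: "path_in S g \<Longrightarrow> pathstart g \<in> S \<and> pathfinish g \<in> S"
  unfolding path_in_def by (meson pathfinish_in_path_image pathstart_in_path_image subsetD)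

lemma path_in_mem: "path_in S g \<Longrightarrow> t \<in> {0..1} \<Longrightarrow> g t \<in> S"
  unfolding path_in_def path_image_def by blast

lemma loops_at_iff: "g \<in> loops_at S p \<longleftrightarrow> path_in S g \<and> pathstart g = p \<and> pathfinish g = p"
  by (auto simp: loops_at_def path_in_def)

text \<open>Only the detour along \<open>c\<close> and back is removed, everything else is
  reassociation. The bracketing is the one in which two tethered paths with a common intermediate
  point are concatenated.\<close>

lemma homotopic_paths_cancel_middle:
  fixes S :: "'a::real_normed_vector set"
  assumes "path_in S a" "path_in S b" "path_in S c" "path_in S d" "path_in S e"
    "pathfinish a = pathstart b" "pathfinish b = pathfinish c" "pathfinish c = pathstart d" "pathfinish d = pathstart e"
  shows "homotopic_paths S ((a +++ (b +++ reversepath c)) +++ (c +++ (d +++ e))) (a +++ ((b +++ d) +++ e))"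
proof -
  let ?h = "homotopic_paths S" and ?c = "reversepath c"
  note p = assms[unfolded path_in_def]
  have refl: "?h g g" if "path_in S g" for g using that by (simp add: path_in_def)
  have de: "path_in S (d +++ e)" using assms by (intro path_in_join) auto
  have "?h (?c +++ (c +++ (d +++ e))) ((?c +++ c) +++ (d +++ e))"
    using p de[unfolded path_in_def] by (intro homotopic_paths_assoc) auto
  moreover have "?h ((?c +++ c) +++ (d +++ e)) (linepath (pathstart d) (pathstart d) +++ (d +++ e))"
    using p homotopic_paths_linv[of c S] de by (intro homotopic_paths_join refl) auto
  moreover have "?h (linepath (pathstart d) (pathstart d) +++ (d +++ e)) (d +++ e)"
    using homotopic_paths_lid[of "d +++ e" S] de by (simp add: path_in_def)
  ultimately have 1: "?h (?c +++ (c +++ (d +++ e))) (d +++ e)"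
    using homotopic_paths_trans by blast
  have "?h ((b +++ ?c) +++ (c +++ (d +++ e))) (b +++ (?c +++ (c +++ (d +++ e))))"
    using p de[unfolded path_in_def]
    by (intro homotopic_paths_assoc[THEN homotopic_paths_sym]) (auto simp: path_image_join)
  moreover have "?h (b +++ (?c +++ (c +++ (d +++ e)))) (b +++ (d +++ e))"
    using assms by (intro homotopic_paths_join refl 1) auto
  moreover have "?h (b +++ (d +++ e)) ((b +++ d) +++ e)"
    using p by (intro homotopic_paths_assoc) auto
  ultimately have 2: "?h ((b +++ ?c) +++ (c +++ (d +++ e))) ((b +++ d) +++ e)"
    using homotopic_paths_trans by blast
  have "?h ((a +++ (b +++ ?c)) +++ (c +++ (d +++ e))) (a +++ ((b +++ ?c) +++ (c +++ (d +++ e))))"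
    using p de[unfolded path_in_def]
    by (intro homotopic_paths_assoc[THEN homotopic_paths_sym]) (auto simp: path_image_join)
  moreover have "?h (a +++ ((b +++ ?c) +++ (c +++ (d +++ e)))) (a +++ ((b +++ d) +++ e))"
    using assms by (intro homotopic_paths_join refl 2) auto
  ultimately show ?thesis using homotopic_paths_trans by blast
qed

lemma matrix_inv_inverse:
  fixes A :: "complex ^ 2 ^ 2"
  assumes "invertible A"
  shows matrix_inv_right: "A ** matrix_inv A = mat 1" and matrix_inv_left: "matrix_inv A ** A = mat 1"
  using someI_ex[OF assms[unfolded invertible_def]] by (auto simp: matrix_inv_def)

text \<open>A representation of the fundamental group read on loops instead of classes. In this form
  it can be pulled back along a homeomorphism by composing paths.\<close>

locale loop_representation =
  fixes S :: "complex set" and P :: complex and \<rho> :: "(real \<Rightarrow> complex) \<Rightarrow> complex ^ 2 ^ 2"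
  assumes base: "P \<in> S" and pc: "path_connected S"
    and homotopic: "g \<in> loops_at S P \<Longrightarrow> homotopic_paths S g h \<Longrightarrow> \<rho> g = \<rho> h"
    and mult: "g \<in> loops_at S P \<Longrightarrow> h \<in> loops_at S P \<Longrightarrow> \<rho> (g +++ h) = \<rho> g ** \<rho> h"
    and inv: "g \<in> loops_at S P \<Longrightarrow> invertible (\<rho> g)"
begin

text \<open>A fixed choice of path from the base point to each point. At the base point it is
  constant, so that closing up a loop does not conjugate its matrix.\<close>

definition tether :: "complex \<Rightarrow> real \<Rightarrow> complex" where
  "tether x = (if x = P then linepath P P else SOME g. path_in S g \<and> pathstart g = P \<and> pathfinish g = x)"

lemma tether:
  assumes "x \<in> S"
  shows "path_in S (tether x)" "pathstart (tether x) = P" "pathfinish (tether x) = x"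
proof -
  have "\<exists>g. path_in S g \<and> pathstart g = P \<and> pathfinish g = x"
    using pc base assms unfolding path_connected_def path_in_def by blast
  from someI_ex[OF this] show "path_in S (tether x)" "pathstart (tether x) = P" "pathfinish (tether x) = x"
    unfolding tether_def using base by (auto simp: path_in_linepath_refl)
qed

text \<open>Extends the representation to the fundamental groupoid by closing up an arbitrary path
  along the tethers of its endpoints.\<close>

definition transport :: "(real \<Rightarrow> complex) \<Rightarrow> complex ^ 2 ^ 2" where
  "transport g = \<rho> (tether (pathstart g) +++ (g +++ reversepath (tether (pathfinish g))))"

lemma tethered_loop:
  assumes "path_in S g"
  shows "tether (pathstart g) +++ (g +++ reversepath (tether (pathfinish g))) \<in> loops_at S P"
  unfolding loops_at_iff using assms path_in_endpoints[OF assms]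
  by (auto simp: tether intro!: path_in_join)

lemma transport_invertible: "path_in S g \<Longrightarrow> invertible (transport g)"
  unfolding transport_def using tethered_loop inv by blast

lemma transport_homotopic:
  assumes "homotopic_paths S g h"
  shows "transport g = transport h"
proof -
  have g: "path_in S g" and h: "path_in S h"
    using homotopic_paths_imp_path[OF assms] homotopic_paths_imp_subset[OF assms] by (auto simp: path_in_def)
  have e: "pathstart h = pathstart g" "pathfinish h = pathfinish g"
    using homotopic_paths_imp_pathstart[OF assms] homotopic_paths_imp_pathfinish[OF assms] by auto
  show ?thesis unfolding transport_def e
    using tethered_loop[OF g] assms path_in_endpoints[OF g] tether
    by (intro homotopic homotopic_paths_join) (auto simp: path_in_def)
qed

lemma transport_join:
  assumes "path_in S g" "path_in S h" "pathfinish g = pathstart h"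
  shows "transport (g +++ h) = transport g ** transport h"
proof -
  note g = path_in_endpoints[OF assms(1)] and h = path_in_endpoints[OF assms(2)]
  have "transport g ** transport h = \<rho> ((tether (pathstart g) +++ (g +++ reversepath (tether (pathfinish g)))) +++
      (tether (pathstart h) +++ (h +++ reversepath (tether (pathfinish h)))))"
    unfolding transport_def using mult tethered_loop assms by metis
  also have "\<dots> = \<rho> (tether (pathstart g) +++ ((g +++ h) +++ reversepath (tether (pathfinish h))))"
    unfolding assms(3)
    using assms g h tether tethered_loop[OF assms(1)] tethered_loop[OF assms(2)]
    by (intro homotopic homotopic_paths_cancel_middle) (auto simp: loops_at_iff intro!: path_in_join)
  finally show ?thesis by (simp add: transport_def)
qed

text \<open>The matrix is idempotent, since a constant path joined with itself is homotopic to it,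
  and it is invertible.\<close>

lemma transport_linepath_refl:
  assumes "x \<in> S" shows "transport (linepath x x) = mat 1"
proof -
  let ?c = "linepath x x"
  have c: "path_in S ?c" using assms by (rule path_in_linepath_refl)
  have "transport ?c ** transport ?c = transport (?c +++ ?c)"
    using transport_join[OF c c] by simp
  also have "\<dots> = transport ?c"
    using transport_homotopic[OF homotopic_paths_rid[of ?c S]] c by (simp add: path_in_def)
  finally have "transport ?c ** transport ?c = transport ?c" .
  moreover obtain B where "transport ?c ** B = mat 1"
    using transport_invertible[OF c] unfolding invertible_def by blast
  ultimately show ?thesis by (metis matrix_mul_assoc matrix_mul_rid)
qed

lemma transport_loop:
  assumes "g \<in> loops_at S P" shows "transport g = \<rho> g"
proof -
  have g: "path_in S g" "pathstart g = P" "pathfinish g = P" using assms by (auto simp: loops_at_iff)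
  have "homotopic_paths S (g +++ linepath P P) g"
    using homotopic_paths_rid[of g S] g by (simp add: path_in_def)
  then have "homotopic_paths S (linepath P P +++ (g +++ linepath P P)) (linepath P P +++ g)"
    using base g by (intro homotopic_paths_join) auto
  moreover have "homotopic_paths S (linepath P P +++ g) g"
    using homotopic_paths_lid[of g S] g by (simp add: path_in_def)
  ultimately have "homotopic_paths S (linepath P P +++ (g +++ linepath P P)) g"
    using homotopic_paths_trans by blast
  then have "\<rho> (linepath P P +++ (g +++ linepath P P)) = \<rho> g"
    using tethered_loop[OF g(1)] g by (intro homotopic) (auto simp: tether_def)
  then show ?thesis using g by (simp add: transport_def tether_def)
qed

end

section \<open>Flat frames of a representation over the sheets\<close>

lemma simply_connected_sheet: "simply_connected (sheet j)"
  by (simp add: starlike_imp_simply_connected starlike_sheet)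

lemma homotopic_paths_in_sheet:
  assumes "path_in (sheet j) g" "path_in (sheet j) h" "pathstart g = pathstart h" "pathfinish g = pathfinish h"
  shows "homotopic_paths (- {0, 1}) g h"
  using simply_connected_sheet[of j] assms homotopic_paths_subset[OF _ sheet_subset]
  unfolding simply_connected_eq_homotopic_paths path_in_def by metis

lemma path_in_sheet_exists:
  assumes "x \<in> sheet j" "y \<in> sheet j"
  obtains g where "path_in (sheet j) g" "pathstart g = x" "pathfinish g = y"
  using simply_connected_sheet[of j] assms
  unfolding simply_connected_eq_homotopic_paths path_connected_def path_in_def by blast

lemma ii_in_sheet: "\<i> \<in> sheet j" "- \<i> \<in> sheet j" by (auto intro: sheet_nonreal)

lemma path_connected_twice_punctured: "path_connected (- {0, 1 :: complex})"
proof -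
  have "path_component (- {0, 1}) \<i> x" if x: "x \<in> - {0, 1}" for x
  proof -
    obtain j where "x \<in> sheet j" using sheet_cover x by auto
    then obtain g where "path_in (sheet j) g" "pathstart g = \<i>" "pathfinish g = x"
      using path_in_sheet_exists ii_in_sheet by metis
    then show ?thesis unfolding path_component_def using sheet_subset[of j] by (auto simp: path_in_def)
  qed
  then show ?thesis unfolding path_connected_component by (metis path_component_sym path_component_trans)
qed

locale sheet_representation = loop_representation "- {0, 1}" P \<rho> for P \<rho>
begin

text \<open>The flat frame of the local system over sheet \<open>j\<close>, normalized at
  \<open>\<i>\<close>. Since the sheet is simply connected, the chosen path does not matter, and
  frames of different sheets agree on the upper half plane just like the normalized bases of
  solutions.\<close>

definition descent :: "gap \<Rightarrow> complex \<Rightarrow> complex ^ 2 ^ 2" where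
  "descent j x = transport (SOME g. path_in (sheet j) g \<and> pathstart g = x \<and> pathfinish g = \<i>)"

lemma descent_eq:
  assumes "path_in (sheet j) g" "pathstart g = x" "pathfinish g = \<i>"
  shows "descent j x = transport g"
proof -
  let ?Q = "\<lambda>g. path_in (sheet j) g \<and> pathstart g = x \<and> pathfinish g = \<i>"
  have "?Q (SOME g. ?Q g)" by (rule someI[of ?Q g]) (use assms in auto)
  then show ?thesis unfolding descent_def
    by (intro transport_homotopic homotopic_paths_in_sheet[of j]) (use assms in auto)
qed

lemma path_in_sheet_imp: "path_in (sheet j) g \<Longrightarrow> path_in (- {0, 1}) g"
  using path_in_subset sheet_subset by blast

lemma descent_transport:
  assumes "path_in (sheet j) g" "pathstart g = x" "pathfinish g = y"
  shows "descent j x = transport g ** descent j y"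
proof -
  have "y \<in> sheet j" using assms path_in_endpoints by blast
  then obtain h where h: "path_in (sheet j) h" "pathstart h = y" "pathfinish h = \<i>"
    using path_in_sheet_exists ii_in_sheet by metis
  have "descent j x = transport (g +++ h)"
    by (rule descent_eq) (use assms h in \<open>auto intro!: path_in_join\<close>)
  also have "\<dots> = transport g ** transport h"
    by (rule transport_join) (use assms h path_in_sheet_imp in auto)
  also have "transport h = descent j y" using descent_eq[OF h] by simp
  finally show ?thesis .
qed

lemma descent_invertible:
  assumes "x \<in> sheet j" shows "invertible (descent j x)"
proof -
  obtain h where h: "path_in (sheet j) h" "pathstart h = x" "pathfinish h = \<i>"
    using assms path_in_sheet_exists ii_in_sheet by metis
  then show ?thesis using descent_eq[OF h] transport_invertible path_in_sheet_imp by metis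
qed

lemma descent_ii: "descent j \<i> = mat 1"
  using descent_eq[of j "linepath \<i> \<i>" \<i>] path_in_linepath_refl[OF ii_in_sheet(1)[of j]]
  by (simp add: transport_linepath_refl)

lemma linepath_halfplane:
  "Im x > 0 \<Longrightarrow> Im y > 0 \<Longrightarrow> path_in (sheet j) (linepath x y)"
  "Im x < 0 \<Longrightarrow> Im y < 0 \<Longrightarrow> path_in (sheet j) (linepath x y)"
proof -
  show "path_in (sheet j) (linepath x y)" if "Im x > 0" "Im y > 0"
    using closed_segment_subset[OF _ _ convex_halfspace_Im_gt[of 0], of x y] that sheet_nonreal
    by (fastforce simp: path_in_def)
  show "path_in (sheet j) (linepath x y)" if "Im x < 0" "Im y < 0"
    using closed_segment_subset[OF _ _ convex_halfspace_Im_lt[of 0], of x y] that sheet_nonreal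
    by (fastforce simp: path_in_def)
qed

lemma descent_upper: "Im x > 0 \<Longrightarrow> descent i x = descent j x"
  using descent_transport[OF linepath_halfplane(1)[of x \<i>]] descent_ii by simp

text \<open>The transport along the loop at \<open>\<i>\<close> that goes down to
  \<open>- \<i>\<close> through gap \<open>i\<close> and comes back through gap
  \<open>j\<close>.\<close>

definition switch :: "gap \<Rightarrow> gap \<Rightarrow> complex ^ 2 ^ 2" where
  "switch i j = matrix_inv (descent i (- \<i>)) ** descent j (- \<i>)"

lemma descent_switch: "descent i (- \<i>) ** switch i j = descent j (- \<i>)"
  unfolding switch_def matrix_mul_assoc
  using matrix_inv_right[OF descent_invertible[OF ii_in_sheet(2)]] by simp

lemma descent_lower:
  assumes "Im x < 0" shows "descent j x = descent i x ** switch i j"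
  using descent_transport[OF linepath_halfplane(2)[of x "- \<i>"]] assms
  by (simp add: matrix_mul_assoc[symmetric] descent_switch)

lemma switch_trans: "switch i j ** switch j k = switch i k"
proof -
  have "switch i j ** switch j k = matrix_inv (descent i (- \<i>)) ** (descent j (- \<i>) ** switch j k)"
    by (simp add: switch_def matrix_mul_assoc)
  then show ?thesis by (simp add: descent_switch) (simp add: switch_def)
qed

lemma switch_refl: "switch i i = mat 1"
  unfolding switch_def using matrix_inv_left[OF descent_invertible[OF ii_in_sheet(2)]] by simp

lemma switch_invertible: "invertible (switch i j)"
  unfolding invertible_def using switch_trans switch_refl by metis

text \<open>The product transports along \<open>g\<close> up to time \<open>s\<close> and then to
  \<open>\<i>\<close> inside the sheet. As long as \<open>g\<close> stays in the sheet, moving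
  \<open>s\<close> only shifts a piece of path from one factor to the other.\<close>

lemma holonomy_locally_constant:
  assumes g: "path_in (- {0, 1}) g" and t: "t \<in> {0..1}" "g t \<in> sheet j"
  obtains d where "d > 0" "\<And>s. s \<in> {0..1} \<Longrightarrow> \<bar>s - t\<bar> < d \<Longrightarrow> g s \<in> sheet j \<and>
     transport (subpath 0 s g) ** descent j (g s) = transport (subpath 0 t g) ** descent j (g t)"
proof -
  have cont: "continuous_on {0..1} g" using g by (simp add: path_in_def path_def)
  obtain d where d: "d > 0" "\<And>s. s \<in> {0..1} \<Longrightarrow> dist s t < d \<Longrightarrow> g s \<in> sheet j"
  proof -
    obtain e where e: "e > 0" "ball (g t) e \<subseteq> sheet j"
      using open_sheet t open_contains_ball by blast
    obtain d where "d > 0" "\<And>s. s \<in> {0..1} \<Longrightarrow> dist s t < d \<Longrightarrow> dist (g s) (g t) < e"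
      using cont t e unfolding continuous_on_iff by blast
    then show ?thesis using that[of d] e by (metis dist_commute mem_ball subsetD)
  qed
  show ?thesis
  proof (rule that[OF d(1)], intro conjI)
    fix s assume s: "s \<in> {0..1}" "\<bar>s - t\<bar> < d"
    show "g s \<in> sheet j" using d(2)[OF s(1)] s by (simp add: dist_real_def)
    have sub: "path_in (sheet j) (subpath s t g)"
      unfolding path_in_def
    proof
      show "path (subpath s t g)" using g s t by (intro path_subpath) (auto simp: path_in_def)
      show "path_image (subpath s t g) \<subseteq> sheet j"
        using d(2) s t unfolding path_image_subpath_gen
        by (auto simp: closed_segment_eq_real_ivl dist_real_def split: if_splits)
    qed
    have "transport (subpath 0 t g) = transport (subpath 0 s g +++ subpath s t g)"
      using homotopic_join_subpaths[of g "- {0, 1}" 0 s t] g s t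
      by (intro transport_homotopic[OF homotopic_paths_sym]) (auto simp: path_in_def)
    also have "\<dots> = transport (subpath 0 s g) ** transport (subpath s t g)"
    proof (rule transport_join)
      show "path_in (- {0, 1}) (subpath 0 s g)"
        using g s path_image_subpath_subset[of 0 s g] unfolding path_in_def
        by (auto intro!: path_subpath)
    qed (use path_in_sheet_imp[OF sub] in \<open>auto simp: pathstart_subpath pathfinish_subpath\<close>)
    finally have "transport (subpath 0 t g) ** descent j (g t) = transport (subpath 0 s g) ** (transport (subpath s t g) ** descent j (g t))"
      by (simp add: matrix_mul_assoc)
    also have "transport (subpath s t g) ** descent j (g t) = descent j (g s)"
      using descent_transport[OF sub] by (simp add: pathstart_subpath pathfinish_subpath)
    finally show "transport (subpath 0 s g) ** descent j (g s) = transport (subpath 0 t g) ** descent j (g t)" by simp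
  qed
qed

text \<open>A line that is invariant under all \<open>switch\<close> matrices spans a flat line bundle along every loop,
  hence a line that is invariant under the representation.\<close>

lemma no_common_eigenvector:
  assumes irr: "\<And>V. vec.subspace V \<Longrightarrow> (\<And>g v. g \<in> loops_at (- {0, 1}) P \<Longrightarrow> v \<in> V \<Longrightarrow> \<rho> g *v v \<in> V) \<Longrightarrow> V = {0} \<or> V = UNIV"
  shows "\<not> common_eigenvector (switch Beyond Between) (switch Between Below) v"
proof
  assume "common_eigenvector (switch Beyond Between) (switch Between Below) v"
  then obtain k1 k2 where v: "v \<noteq> 0" and k: "switch Beyond Between *v v = k1 *s v" "switch Between Below *v v = k2 *s v"
    by (auto simp: common_eigenvector_def)
  have inv: "\<exists>c. switch j i *v v = c *s v" if "switch i j *v v = k *s v" for i j k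
  proof -
    have "switch j i *v (switch i j *v v) = v"
      by (simp add: matrix_vector_mul_assoc switch_trans switch_refl)
    then have *: "k *s (switch j i *v v) = v" using that by (simp add: vector_scalar_commute)
    then have "k \<noteq> 0" using v by auto
    then have "switch j i *v v = (1 / k) *s v" using arg_cong[OF *, of "\<lambda>x. (1 / k) *s x"] by (simp add: vector_smult_assoc)
    then show ?thesis by blast
  qed
  have comp: "\<exists>c. switch i l *v v = c *s v" if "switch i j *v v = a *s v" "switch j l *v v = b *s v" for i j l a b
  proof -
    have "switch i l *v v = switch i j *v (switch j l *v v)" by (simp add: matrix_vector_mul_assoc switch_trans)
    also have "\<dots> = (b * a) *s v" using that by (simp add: vector_scalar_commute)
    finally show ?thesis by blast
  qed
  \<comment> \<open>The two given matrices cross neighbouring gaps; inverses and products of them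
    reach all pairs.\<close>
  have all: "\<exists>c. switch i j *v v = c *s v" for i j
    using k inv[OF k(1)] inv[OF k(2)] comp[OF k] switch_refl[of i] comp
    by (cases i; cases j) (metis matrix_vector_mul_lid vector_smult_lid)+
  have change: "\<exists>c. descent j x *v v = c *s (descent i x *v v)" if "x \<in> sheet i" "x \<in> sheet j" for i j x
  proof (cases "i = j \<or> Im x > 0")
    case True
    then have "descent j x *v v = 1 *s (descent i x *v v)" using descent_upper[of x i j] by auto
    then show ?thesis by blast
  next
    case False
    then have "Im x < 0" using sheet_inter[OF that] by auto
    moreover obtain c where "switch i j *v v = c *s v" using all by blast
    ultimately have "descent j x *v v = c *s (descent i x *v v)"
      using descent_lower[of x j i] by (metis matrix_vector_mul_assoc vector_scalar_commute)
    then show ?thesis by blast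
  qed
  obtain j0 where j0: "P \<in> sheet j0" using base sheet_cover by auto
  define w where "w = descent j0 P *v v"
  have "w \<noteq> 0"
  proof
    assume "w = 0"
    obtain B where "B ** descent j0 P = mat 1" using descent_invertible[OF j0] unfolding invertible_def by blast
    then have "v = B *v w" unfolding w_def by (simp add: matrix_vector_mul_assoc)
    then show False using v \<open>w = 0\<close> by simp
  qed
  define V where "V = range (\<lambda>c. c *s w)"
  have "\<rho> g *v x \<in> V" if g: "g \<in> loops_at (- {0, 1}) P" and x: "x \<in> V" for g x
  proof -
    have gp: "path_in (- {0, 1}) g" "pathstart g = P" "pathfinish g = P" using g by (auto simp: loops_at_iff)
    \<comment> \<open>The frame at \<open>g t\<close>, brought back to the base point along the
      loop, still sends \<open>v\<close> into the line of \<open>w\<close>. By \<open>change\<close>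
      this does not depend on the sheet, so it is enough to test one; it then propagates from time 0
      to time 1 by connectedness.\<close>
    define Q where "Q t \<longleftrightarrow> (\<forall>j. g t \<in> sheet j \<longrightarrow> (\<exists>c. (transport (subpath 0 t g) ** descent j (g t)) *v v = c *s w))" for t
    have Qj: "Q t \<longleftrightarrow> (\<exists>c. (transport (subpath 0 t g) ** descent j (g t)) *v v = c *s w)" if tj: "g t \<in> sheet j" for t j
      unfolding Q_def
    proof (intro iffI allI impI)
      fix i assume "g t \<in> sheet i" "\<exists>c. (transport (subpath 0 t g) ** descent j (g t)) *v v = c *s w"
      then obtain a b where "descent i (g t) *v v = a *s (descent j (g t) *v v)"
        "(transport (subpath 0 t g) ** descent j (g t)) *v v = b *s w" using change[OF tj] by blast
      then have "(transport (subpath 0 t g) ** descent i (g t)) *v v = (a * b) *s w"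
        by (simp add: matrix_vector_mul_assoc[symmetric] vector_scalar_commute)
      then show "\<exists>c. (transport (subpath 0 t g) ** descent i (g t)) *v v = c *s w" by blast
    qed (use tj in blast)
    have "Q 1"
    proof (rule connected_induction_simple[of "{0..1::real}" 0 1 Q])
      have "transport (subpath 0 0 g) = mat 1"
        using transport_linepath_refl[OF base] gp by (simp add: pathstart_def subpath_refl)
      moreover have "g 0 = P" using gp by (simp add: pathstart_def)
      ultimately show "Q 0" using Qj[of 0 j0] j0 unfolding w_def
        by (metis matrix_mul_lid vector_smult_lid)
      fix t :: real assume t: "t \<in> {0..1}"
      have "g t \<in> - {0, 1}" using path_in_mem[OF gp(1) t] .
      then obtain j where j: "g t \<in> sheet j" using sheet_cover by auto
      obtain d where d: "d > 0" "\<And>s. s \<in> {0..1} \<Longrightarrow> \<bar>s - t\<bar> < d \<Longrightarrow> g s \<in> sheet j \<and>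
         transport (subpath 0 s g) ** descent j (g s) = transport (subpath 0 t g) ** descent j (g t)"
        using holonomy_locally_constant[OF gp(1) t j] by metis
      have Qs: "Q s \<longleftrightarrow> Q t" if "s \<in> {0..1} \<inter> ball t d" for s
        using d(2)[of s] that Qj[OF j] Qj[of s j] by (auto simp: dist_real_def abs_minus_commute)
      show "\<exists>T. openin (top_of_set {0..1}) T \<and> t \<in> T \<and> (\<forall>x\<in>T. \<forall>y\<in>T. Q x \<longrightarrow> Q y)"
      proof (intro exI conjI ballI impI)
        show "openin (top_of_set {0..1}) ({0..1} \<inter> ball t d)" by (simp add: openin_open_Int)
        show "t \<in> {0..1} \<inter> ball t d" using t d(1) by simp
        show "Q y" if "x \<in> {0..1} \<inter> ball t d" "y \<in> {0..1} \<inter> ball t d" "Q x" for x y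
          using that(3) Qs[OF that(1)] Qs[OF that(2)] by simp
      qed
    qed auto
    moreover have "subpath 0 1 g = g" "g 1 = P" using gp by (auto simp: pathfinish_def)
    ultimately obtain c where "(transport g ** descent j0 P) *v v = c *s w" unfolding Q_def using j0 by metis
    then have *: "\<rho> g *v w = c *s w" unfolding w_def using transport_loop[OF g] by (simp add: matrix_vector_mul_assoc)
    obtain b where "x = b *s w" using x by (auto simp: V_def)
    then have "\<rho> g *v x = (b * c) *s w" using * by (simp add: vector_scalar_commute)
    then show ?thesis by (auto simp: V_def)
  qed
  moreover have "vec.subspace V"
    unfolding V_def vec.subspace_def by (auto simp: image_iff) (metis vector_sadd_rdistrib)
  ultimately have "V = {0} \<or> V = UNIV" using irr by blast
  then show False
  proof
    assume "V = {0}" moreover have "1 *s w \<in> V" unfolding V_def by blast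
    ultimately show False using \<open>w \<noteq> 0\<close> by simp
  next
    assume "V = UNIV"
    then obtain a b where "axis 1 1 = a *s w" "axis 2 1 = b *s w" by (metis UNIV_I V_def imageE)
    then show False by (simp add: vec_eq_iff forall_2 axis_def) (metis mult_eq_0_iff zero_neq_one)
  qed
qed

end

section \<open>Matching the invariants and continuation along loops\<close>

lemma exp_2pi_surj:
  fixes w :: complex
  assumes "w \<noteq> 0" obtains x where "e2pi x = w"
  by (rule that[of "Ln w / (2 * pi * \<i>)"]) (use assms in simp)

lemma matrix_inv_eqI:
  fixes A B :: "complex ^ 2 ^ 2"
  assumes "A ** B = mat 1"
  shows "matrix_inv A = B"
proof -
  have "invertible A" using assms invertible_right_inverse by blast
  then have "matrix_inv A ** A = mat 1" by (rule matrix_inv_left)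
  then show ?thesis by (metis assms matrix_mul_assoc matrix_mul_lid matrix_mul_rid)
qed

text \<open>The planar counterpart of \<open>analytic_continuation\<close>, with one neighbourhood
  and one family of germs for the whole row, so that constant matrices can act on it.\<close>

definition continued_row :: "(real \<Rightarrow> complex) \<Rightarrow> (real \<Rightarrow> complex \<Rightarrow> complex ^ 2) \<Rightarrow> bool" where
  "continued_row g F \<longleftrightarrow>
     (\<forall>t\<in>{0..1}. \<exists>U. open U \<and> g t \<in> U \<and> (\<forall>k. (\<lambda>z. F t z $ k) holomorphic_on U) \<and>
        (\<forall>\<^sub>F s in at t within {0..1}. g s \<in> U \<and> (\<forall>\<^sub>F z in nhds (g s). F s z = F t z)))"

context sheet_bases
begin

lemma transition_refl: "K i i = mat 1"
  by (rule transition_unique[of "- \<i>"]) auto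

text \<open>Both families are cocycles but compose in opposite orders, hence \<open>K i j\<close> is
  paired with \<open>R j i\<close>. Neighbouring gaps generate: products give the third pair and
  inverses the opposite directions.\<close>

lemma intertwining_all:
  assumes T1: "K Between Beyond ** T = T ** R Beyond Between" and T2: "K Below Between ** T = T ** R Between Below"
    and R: "\<And>i j k. R i j ** R j k = R i k" "\<And>i. R i i = mat 1"
  shows "K i j ** T = T ** R j i"
proof -
  have comp: "K i k ** T = T ** R k i" if "K j k ** T = T ** R k j" "K i j ** T = T ** R j i" for i j k
  proof -
    have "K i k ** T = K j k ** (K i j ** T)" by (simp add: transition_cocycle[of i k j] matrix_mul_assoc)
    also have "\<dots> = K j k ** T ** R j i" using that(2) by (simp add: matrix_mul_assoc)
    also have "\<dots> = T ** (R k j ** R j i)" using that(1) by (simp add: matrix_mul_assoc)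
    finally show ?thesis by (simp add: R)
  qed
  have rev: "K j i ** T = T ** R i j" if "K i j ** T = T ** R j i" for i j
  proof -
    have "K j i ** T = K j i ** (T ** R j i) ** R i j"
      by (simp add: matrix_mul_assoc[symmetric] R)
    also have "\<dots> = (K j i ** K i j) ** T ** R i j" unfolding that[symmetric] by (simp add: matrix_mul_assoc)
    also have "K j i ** K i j = mat 1" by (metis transition_cocycle transition_refl)
    finally show ?thesis by simp
  qed
  have id: "K i i ** T = T ** R i i" for i by (simp add: transition_refl R)
  note T3 = comp[OF T1 T2]
  show ?thesis
    by (cases i; cases j) (simp_all only: id T1 T2 T3 rev[OF T1] rev[OF T2] rev[OF T3])
qed

end

context sheet_representation
begin

text \<open>Five exponents are arbitrary logarithms of eigenvalues and Fuchs' relation dictates the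
  sixth. That this one also has the right exponential follows from the multiplicativity of the
  determinants of the \<open>switch\<close> matrices.\<close>

lemma exists_matching_exponents:
  obtains r r' s s' t t' where "r + r' + s + s' + t + t' = 1"
    "e2pi r + e2pi r' = trace (switch Between Below)"
    "e2pi r * e2pi r' = det (switch Between Below)"
    "e2pi s + e2pi s' = trace (switch Beyond Between)"
    "e2pi s * e2pi s' = det (switch Beyond Between)"
    "exp (- 2 * pi * \<i> * t) + exp (- 2 * pi * \<i> * t') = trace (switch Beyond Below)"
proof -
  have nz: "det (switch i j) \<noteq> 0" for i j using switch_invertible invertible_det_nz by blast
  have quad: "\<exists>x x'. e2pi x + e2pi x' = trace (switch i j) \<and>
     e2pi x * e2pi x' = det (switch i j)" for i j
  proof -
    obtain l l' where l: "l + l' = trace (switch i j)" "l * l' = det (switch i j)" using quadratic_roots by blast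
    then have "l \<noteq> 0" "l' \<noteq> 0" using nz[of i j] by auto
    then show ?thesis using l exp_2pi_surj by metis
  qed
  obtain r r' where r: "e2pi r + e2pi r' = trace (switch Between Below)"
     "e2pi r * e2pi r' = det (switch Between Below)" using quad by blast
  obtain s s' where s: "e2pi s + e2pi s' = trace (switch Beyond Between)"
     "e2pi s * e2pi s' = det (switch Beyond Between)" using quad by blast
  obtain x x' where x: "e2pi x + e2pi x' = trace (switch Beyond Below)"
     "e2pi x * e2pi x' = det (switch Beyond Below)" using quad by blast
  \<comment> \<open>The sign arises because exponents at infinity refer to powers of
    \<open>1 / z\<close>, which turns in the opposite sense to \<open>z\<close>.\<close>
  define t where "t = - x"
  define t' where "t' = 1 - r - r' - s - s' - t"
  have "det (switch Beyond Below) = det (switch Beyond Between) * det (switch Between Below)"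
    by (metis det_mul switch_trans)
  also have "\<dots> = e2pi (r + r' + s + s')"
    unfolding r(2)[symmetric] s(2)[symmetric] by (simp add: exp_add[symmetric] algebra_simps)
  finally have "e2pi x' = e2pi (r + r' + s + s') / e2pi x"
    using x(2) by (simp add: field_simps)
  also have "\<dots> = e2pi (r + r' + s + s' - x)"
    unfolding exp_diff[symmetric] by (simp add: algebra_simps)
  also have "r + r' + s + s' - x = 1 + - t'" by (simp add: t'_def t_def)
  also have "e2pi (1 + - t') = exp (- 2 * pi * \<i> * t')"
    unfolding distrib_left exp_add by simp
  finally have e2: "exp (- 2 * pi * \<i> * t') = e2pi x'" ..
  have e1: "exp (- 2 * pi * \<i> * t) = e2pi x" by (simp add: t_def)
  show ?thesis
  proof (rule that[OF _ r s, of t t'])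
    show "r + r' + s + s' + t + t' = 1" by (simp add: t'_def)
    show "exp (- 2 * pi * \<i> * t) + exp (- 2 * pi * \<i> * t') = trace (switch Beyond Below)"
      unfolding e1 e2 by (rule x(1))
  qed
qed

text \<open>At time \<open>t\<close> the continued germ is a basis on a sheet containing
  \<open>g t\<close>, multiplied by the inverse holonomy accumulated so far. The matrix
  \<open>T\<close> gives bases and frames the same jumps across the lower half plane, so these
  cancel, and the germ does not depend on the sheet that \<open>J\<close> selects.\<close>

theorem loop_representation_realized:
  assumes irr: "\<And>V. vec.subspace V \<Longrightarrow> (\<And>g v. g \<in> loops_at (- {0, 1}) P \<Longrightarrow> v \<in> V \<Longrightarrow> \<rho> g *v v \<in> V) \<Longrightarrow> V = {0} \<or> V = UNIV"
  obtains r r' s s' t t' :: complex and X X' and U where "r + r' + s + s' + t + t' = 1"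
    "open U" "P \<in> U" "fundamental_system (riemann_p r r' s s') (riemann_q r r' s s' t t') U X X'"
    "\<And>g. g \<in> loops_at (- {0, 1}) P \<Longrightarrow> \<exists>F.
        continued_row g F \<and>
        (\<forall>z. F 0 z = X z) \<and> (\<forall>z. X z = F 1 z v* \<rho> g)"
proof -
  obtain r r' s s' t t' where sum: "r + r' + s + s' + t + t' = 1" and e:
    "e2pi r + e2pi r' = trace (switch Between Below)"
    "e2pi r * e2pi r' = det (switch Between Below)"
    "e2pi s + e2pi s' = trace (switch Beyond Between)"
    "e2pi s * e2pi s' = det (switch Beyond Between)"
    "exp (- 2 * pi * \<i> * t) + exp (- 2 * pi * \<i> * t') = trace (switch Beyond Below)"
    using exists_matching_exponents .
  let ?p = "riemann_p r r' s s'" and ?q = "riemann_q r r' s s' t t'"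
  obtain Y Y' K where "sheet_bases r r' s s' t t' Y Y' K" using exists_sheet_bases[OF sum] .
  then interpret B: sheet_bases r r' s s' t t' Y Y' K .
  obtain T where T: "invertible T" "K Between Beyond ** T = T ** switch Beyond Between"
    "K Below Between ** T = T ** switch Between Below"
  proof (rule simultaneously_conjugate_2[of "K Between Beyond" "switch Beyond Between" "K Below Between" "switch Between Below"])
    show "trace (K Between Beyond ** K Below Between) = trace (switch Beyond Between ** switch Between Below)"
      using B.trace_K(3) e(5) by (simp add: B.transition_cocycle[symmetric] switch_trans)
    show "\<not> common_eigenvector (switch Beyond Between) (switch Between Below) v" for v
      using no_common_eigenvector[OF irr] by blast
  qed (use B.trace_K B.det_K e in auto)
  have KT: "K i j ** T = T ** switch j i" for i j
    by (rule B.intertwining_all[OF T(2,3) switch_trans switch_refl])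
  define Z where "Z j z = Y j z v* T" for j z
  define Z' where "Z' j z = Y' j z v* T" for j z
  have fZ: "fundamental_system ?p ?q (sheet j) (Z j) (Z' j)" for j
    using fundamental_system_mult[OF B.fund T(1)] unfolding Z_def[abs_def] Z'_def[abs_def] .
  have up: "Z i z = Z j z" if "Im z > 0" for i j z
    unfolding Z_def using B.upper(1)[OF that] by metis
  have low: "Z i z = Z j z v* switch j i" if "Im z < 0" for i j z
    unfolding Z_def B.lower(1)[OF that, of i j] by (simp add: vector_matrix_mul_assoc KT)
  define J where "J x = (SOME j. x \<in> sheet j)" for x
  have J: "x \<in> sheet (J x)" if "x \<in> - {0, 1}" for x
    using someI_ex[of "\<lambda>j. x \<in> sheet j"] sheet_cover[of x] that unfolding J_def by auto
  let ?j = "J P"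
  have jP: "P \<in> sheet ?j" using J base by blast
  \<comment> \<open>The holonomy at time 0 is the frame at the base point and not the identity. The
    factor \<open>E\<close> compensates for this, so that the monodromy is \<rho> itself and not a
    conjugate.\<close>
  define E where "E = matrix_inv (descent ?j P)"
  have E: "descent ?j P ** E = mat 1" "E ** descent ?j P = mat 1"
    unfolding E_def using matrix_inv_inverse descent_invertible[OF jP] by auto
  define X where "X z = Z ?j z v* E" for z
  define X' where "X' z = Z' ?j z v* E" for z
  have "invertible E" using E unfolding invertible_def by blast
  then have fX: "fundamental_system ?p ?q (sheet ?j) X X'"
    using fundamental_system_mult[OF fZ] unfolding X_def[abs_def] X'_def[abs_def] by blast
  show ?thesis
  proof (rule that[OF sum open_sheet jP fX])
    fix g assume g: "g \<in> loops_at (- {0, 1}) P"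
    have gp: "path_in (- {0, 1}) g" "pathstart g = P" "pathfinish g = P" using g by (auto simp: loops_at_iff)
    \<comment> \<open>Changing the sheet below the axis multiplies \<open>M\<close> by a
      \<open>switch\<close> matrix from the right. The inverse in \<open>G\<close> then absorbs the
      matrix by which the basis \<open>Z\<close> changes.\<close>
    define M where "M j t = transport (subpath 0 t g) ** descent j (g t)" for j t
    define G where "G j t z = Z j z v* matrix_inv (M j t)" for j t z
    have invM: "invertible (M j t)" if "t \<in> {0..1}" "g t \<in> sheet j" for j t
    proof -
      have "path_in (- {0, 1}) (subpath 0 t g)"
        using gp that path_image_subpath_subset[of 0 t g] unfolding path_in_def
        by (auto intro!: path_subpath)
      then show ?thesis unfolding M_def
        using that by (intro invertible_mult transport_invertible descent_invertible)
    qed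
    have change: "\<forall>\<^sub>F z in nhds (g t). G i t z = G j t z" if t: "t \<in> {0..1}" "g t \<in> sheet i" "g t \<in> sheet j" for i j t
    proof -
      consider "i = j" | "Im (g t) > 0" | "Im (g t) < 0" using sheet_inter[OF t(2,3)] by force
      then show ?thesis
      proof cases
        case 1 then show ?thesis by simp
      next
        case 2
        have "\<forall>\<^sub>F z in nhds (g t). Im z > 0"
          using eventually_nhds_in_open[OF open_halfspace_Im_gt[of 0], of "g t"] 2 by simp
        then show ?thesis
          by eventually_elim (use up[of _ i j] descent_upper[OF 2, of i j] in \<open>auto simp: G_def M_def\<close>)
      next
        case 3
        have Mj: "M j t = M i t ** switch i j"
          unfolding M_def descent_lower[OF 3, of j i] by (simp add: matrix_mul_assoc)
        have "M j t ** (switch j i ** matrix_inv (M i t)) = M i t ** (switch i j ** switch j i) ** matrix_inv (M i t)"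
          unfolding Mj by (simp add: matrix_mul_assoc)
        also have "\<dots> = mat 1" using matrix_inv_right[OF invM[OF t(1,2)]] by (simp add: switch_trans switch_refl)
        finally have iM: "matrix_inv (M j t) = switch j i ** matrix_inv (M i t)" by (rule matrix_inv_eqI)
        have "\<forall>\<^sub>F z in nhds (g t). Im z < 0"
          using eventually_nhds_in_open[OF open_halfspace_Im_lt[of 0], of "g t"] 3 by simp
        then show ?thesis
          by eventually_elim (use low[of _ i j] in \<open>auto simp: G_def iM vector_matrix_mul_assoc\<close>)
      qed
    qed
    define F where "F t = G (J (g t)) t" for t
    have "continued_row g F"
      unfolding continued_row_def
    proof
      fix t :: real assume t: "t \<in> {0..1}"
      let ?i = "J (g t)"
      have i: "g t \<in> sheet ?i" using J path_in_mem[OF gp(1) t] by blast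
      have "(\<lambda>z. F t z $ k) holomorphic_on sheet ?i" for k
      proof -
        have "(\<lambda>z. Z ?i z $ k) holomorphic_on sheet ?i" for k
          using fZ[of ?i] ode2_holomorphic(1) unfolding fundamental_system_def by blast
        then show ?thesis unfolding F_def G_def vector_matrix_mult_def
          by (auto simp: sum_2 intro!: holomorphic_intros)
      qed
      moreover have "\<forall>\<^sub>F s in at t within {0..1}. g s \<in> sheet ?i \<and> (\<forall>\<^sub>F z in nhds (g s). F s z = F t z)"
      proof -
        obtain d where d: "d > 0" "\<And>s. s \<in> {0..1} \<Longrightarrow> \<bar>s - t\<bar> < d \<Longrightarrow> g s \<in> sheet ?i \<and> M ?i s = M ?i t"
          using holonomy_locally_constant[OF gp(1) t i] unfolding M_def by metis
        have "g s \<in> sheet ?i \<and> (\<forall>\<^sub>F z in nhds (g s). F s z = F t z)" if s: "s \<in> {0..1}" "\<bar>s - t\<bar> < d" for s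
        proof -
          have "g s \<in> sheet ?i" and "G ?i s = G ?i t" using d(2)[OF s] by (auto simp: G_def)
          moreover have "\<forall>\<^sub>F z in nhds (g s). F s z = G ?i s z"
            unfolding F_def using J path_in_mem[OF gp(1) s(1)] \<open>g s \<in> sheet ?i\<close> by (intro change s) auto
          ultimately show ?thesis by (simp add: F_def)
        qed
        then show ?thesis using d(1) unfolding eventually_at dist_real_def by blast
      qed
      ultimately show "\<exists>U. open U \<and> g t \<in> U \<and> (\<forall>k. (\<lambda>z. F t z $ k) holomorphic_on U) \<and>
          (\<forall>\<^sub>F s in at t within {0..1}. g s \<in> U \<and> (\<forall>\<^sub>F z in nhds (g s). F s z = F t z))"
        using open_sheet i by blast
    qed
    moreover have "F 0 z = X z" for z
    proof -
      have "transport (subpath 0 0 g) = mat 1"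
        using transport_linepath_refl[OF base] gp by (simp add: pathstart_def subpath_refl)
      moreover have "g 0 = P" using gp by (simp add: pathstart_def)
      ultimately show ?thesis by (simp add: F_def G_def M_def X_def E_def)
    qed
    moreover have "X z = F 1 z v* \<rho> g" for z
    proof -
      have g1: "subpath 0 1 g = g" "g 1 = P" using gp by (auto simp: pathfinish_def)
      have M1: "M ?j 1 = \<rho> g ** descent ?j P" unfolding M_def g1 using transport_loop[OF g] by simp
      have "(\<rho> g ** descent ?j P) ** (E ** matrix_inv (\<rho> g)) = \<rho> g ** (descent ?j P ** E) ** matrix_inv (\<rho> g)"
        by (simp add: matrix_mul_assoc)
      also have "\<dots> = mat 1" using matrix_inv_right[OF inv[OF g]] E by simp
      finally have "matrix_inv (M ?j 1) = E ** matrix_inv (\<rho> g)" unfolding M1 by (rule matrix_inv_eqI)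
      then have "F 1 z v* \<rho> g = Z ?j z v* (E ** (matrix_inv (\<rho> g) ** \<rho> g))"
        by (simp add: F_def G_def g1 vector_matrix_mul_assoc matrix_mul_assoc)
      then show ?thesis using matrix_inv_left[OF inv[OF g]] by (simp add: X_def)
    qed
    ultimately show "\<exists>F. continued_row g F \<and>
        (\<forall>z. F 0 z = X z) \<and> (\<forall>z. X z = F 1 z v* \<rho> g)"
      by blast
  qed
qed

end

section \<open>Transport to the Riemann sphere\<close>

lemma has_field_derivative_cong_nhds:
  assumes "\<forall>\<^sub>F x in nhds a. f x = g x" "(g has_field_derivative d) (at a)"
  shows "(f has_field_derivative d) (at a)"
  using assms(2) unfolding DERIV_cong_ev[OF refl assms(1) refl] .

lemma homotopy_class_eq: "homotopic_paths S g h \<Longrightarrow> homotopy_class S g = homotopy_class S h"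
  unfolding homotopy_class_def
  by (rule Collect_cong) (meson homotopic_paths_sym homotopic_paths_trans)

text \<open>The product is a union over all representatives; homotopy invariance makes all its
  members equal, and the classes are nonempty.\<close>

lemma fundamental_group_mult:
  assumes "g \<in> loops_at S p" "h \<in> loops_at S p"
  shows "mult (fundamental_group S p) (homotopy_class S g) (homotopy_class S h) = homotopy_class S (g +++ h)"
proof -
  have "homotopy_class S (g' +++ h') = homotopy_class S (g +++ h)"
    if "g' \<in> homotopy_class S g" "h' \<in> homotopy_class S h" for g' h'
  proof (rule homotopy_class_eq[OF homotopic_paths_sym[OF homotopic_paths_join]])
    show "homotopic_paths S g g'" "homotopic_paths S h h'" using that by (auto simp: homotopy_class_def)
    show "pathfinish g = pathstart h" using assms by (auto simp: loops_at_def)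
  qed
  then have "(\<Union>g'\<in>homotopy_class S g. \<Union>h'\<in>homotopy_class S h. homotopy_class S (g' +++ h')) =
      (\<Union>g'\<in>homotopy_class S g. \<Union>h'\<in>homotopy_class S h. homotopy_class S (g +++ h))"
    by (intro SUP_cong refl)
  also have "\<dots> = homotopy_class S (g +++ h)"
  proof -
    have "homotopy_class S g \<noteq> {}" "homotopy_class S h \<noteq> {}"
      using assms unfolding homotopy_class_def loops_at_def by (auto intro: homotopic_paths_refl[THEN iffD2])
    then show ?thesis by simp
  qed
  finally show ?thesis by (simp add: fundamental_group_def)
qed

lemma open_Fin_vimage: "open U \<Longrightarrow> open (Fin -` U)" and open_recip_vimage: "open U \<Longrightarrow> open (recip -` U)"
  by (auto simp: open_riemann_sphere_def)

lemma continuous_on_Fin: "continuous_on S Fin"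
  by (rule continuous_on_subset[of UNIV]) (simp_all add: continuous_on_open_vimage open_Fin_vimage)

lemma continuous_on_recip: "continuous_on S recip"
  by (rule continuous_on_subset[of UNIV]) (simp_all add: continuous_on_open_vimage open_recip_vimage)

lemma open_Compl_Fin: "open (- {Fin a})"
proof -
  have "Fin -` (- {Fin a}) = - {a}" by auto
  moreover have "recip -` (- {Fin a}) = {w. a * w \<noteq> 1}"
    by (auto simp: recip_def field_simps split: if_splits)
  moreover have "open {w. a * w \<noteq> 1}" by (intro open_Collect_neq continuous_intros)
  ultimately show ?thesis by (simp add: open_riemann_sphere_def open_Compl)
qed

lemma open_Compl_Inf: "open (- {Inf})"
proof -
  have "Fin -` (- {Inf}) = UNIV" "recip -` (- {Inf}) = - {0}"
    by (auto simp: recip_def)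
  then show ?thesis by (simp add: open_riemann_sphere_def open_Compl)
qed

lemma open_Compl_three: "open (- {a, b, c :: riemann_sphere})"
proof -
  have "open (- {x})" for x :: riemann_sphere
    by (cases x) (simp_all add: open_Compl_Fin open_Compl_Inf)
  moreover have "- {a, b, c} = - {a} \<inter> - {b} \<inter> - {c}" by auto
  ultimately show ?thesis by (simp add: open_Int)
qed

lemma holomorphic_on_sphere_open_preimage:
  assumes "holomorphic_on_sphere f U" "open U" "open V"
  shows "open {x \<in> U. f x \<in> V}"
proof -
  have "open ((\<lambda>z. f (Fin z)) -` V \<inter> Fin -` U)" "open ((\<lambda>w. f (recip w)) -` V \<inter> recip -` U)"
    using assms holomorphic_on_imp_continuous_on continuous_on_open_vimage open_Fin_vimage open_recip_vimage
    unfolding holomorphic_on_sphere_def by blast+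
  moreover have "Fin -` {x \<in> U. f x \<in> V} = (\<lambda>z. f (Fin z)) -` V \<inter> Fin -` U"
    "recip -` {x \<in> U. f x \<in> V} = (\<lambda>w. f (recip w)) -` V \<inter> recip -` U" by auto
  ultimately show ?thesis by (simp add: open_riemann_sphere_def)
qed

lemma holomorphic_on_sphere_compose:
  assumes "holomorphic_on_sphere f U" "h holomorphic_on V"
  shows "holomorphic_on_sphere (\<lambda>x. h (f x)) {x \<in> U. f x \<in> V}"
  unfolding holomorphic_on_sphere_def
proof
  have f: "(\<lambda>z. f (Fin z)) holomorphic_on Fin -` U" "(\<lambda>z. f (recip z)) holomorphic_on recip -` U"
    using assms(1) by (auto simp: holomorphic_on_sphere_def)
  show "(\<lambda>z. h (f (Fin z))) holomorphic_on Fin -` {x \<in> U. f x \<in> V}"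
    using holomorphic_on_compose_gen[OF holomorphic_on_subset[OF f(1)] assms(2), of "Fin -` {x \<in> U. f x \<in> V}"]
    by (auto simp: o_def)
  show "(\<lambda>z. h (f (recip z))) holomorphic_on recip -` {x \<in> U. f x \<in> V}"
    using holomorphic_on_compose_gen[OF holomorphic_on_subset[OF f(2)] assms(2), of "recip -` {x \<in> U. f x \<in> V}"]
    by (auto simp: o_def)
qed

text \<open>A Moebius coordinate \<mu> on the sphere without \<open>D\<close>, with inverse \<nu>
  and with its derivatives \<open>m1\<close>, \<open>m2\<close> in the affine coordinate. It treats
  the positions of \<open>Inf\<close> uniformly: either \<open>Inf\<close> is singular, or it is an
  ordinary point with a finite coordinate.\<close>

locale sphere_coordinate =
  fixes D :: "riemann_sphere set" and \<mu> :: "riemann_sphere \<Rightarrow> complex" and \<nu> :: "complex \<Rightarrow> riemann_sphere"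
    and m1 m2 :: "complex \<Rightarrow> complex"
  assumes open_D: "open (- D)"
    and mu: "x \<notin> D \<Longrightarrow> \<mu> x \<in> - {0, 1}" and nu_mu: "x \<notin> D \<Longrightarrow> \<nu> (\<mu> x) = x"
    and nu: "y \<in> - {0, 1} \<Longrightarrow> \<nu> y \<notin> D" and mu_nu: "y \<in> - {0, 1} \<Longrightarrow> \<mu> (\<nu> y) = y"
    and mu_hol: "holomorphic_on_sphere \<mu> (- D)" and nu_cont: "continuous_on (- {0, 1}) \<nu>"
    and nu_hol: "holomorphic_on_sphere f U \<Longrightarrow> open U \<Longrightarrow> (\<lambda>y. f (\<nu> y)) holomorphic_on {y \<in> - {0, 1}. \<nu> y \<in> U}"
    and m1: "Fin z \<notin> D \<Longrightarrow> ((\<lambda>z. \<mu> (Fin z)) has_field_derivative m1 z) (at z)"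
    and m2: "Fin z \<notin> D \<Longrightarrow> (m1 has_field_derivative m2 z) (at z)"
    and m1_nz: "Fin z \<notin> D \<Longrightarrow> m1 z \<noteq> 0"
begin

lemma mu_open: "open V \<Longrightarrow> open {x \<in> - D. \<mu> x \<in> V}"
  by (rule holomorphic_on_sphere_open_preimage[OF mu_hol open_D])

lemma mu_nhds:
  assumes "x \<notin> D" "\<forall>\<^sub>F y in nhds (\<mu> x). Q y"
  shows "\<forall>\<^sub>F x in nhds x. x \<notin> D \<and> Q (\<mu> x)"
proof -
  obtain V where "open V" "\<mu> x \<in> V" "\<And>y. y \<in> V \<Longrightarrow> Q y" using assms(2) by (auto simp: eventually_nhds)
  then show ?thesis unfolding eventually_nhds
    by (intro exI[of _ "{x \<in> - D. \<mu> x \<in> V}"]) (use assms(1) mu_open in auto)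
qed

lemma nu_open: "open U \<Longrightarrow> open {y \<in> - {0, 1}. \<nu> y \<in> U}"
proof -
  assume "open U"
  moreover have "open (- {0, 1 :: complex})" by (intro open_Compl finite_imp_closed) auto
  ultimately have "open (\<nu> -` U \<inter> - {0, 1})" using nu_cont continuous_on_open_vimage by blast
  moreover have "\<nu> -` U \<inter> - {0, 1} = {y \<in> - {0, 1}. \<nu> y \<in> U}" by auto
  ultimately show ?thesis by simp
qed

lemma nu_nhds:
  assumes "y \<in> - {0, 1}" "\<forall>\<^sub>F x in nhds (\<nu> y). Q x"
  shows "\<forall>\<^sub>F y in nhds y. y \<in> - {0, 1} \<and> Q (\<nu> y)"
proof -
  obtain V where "open V" "\<nu> y \<in> V" "\<And>x. x \<in> V \<Longrightarrow> Q x" using assms(2) by (auto simp: eventually_nhds)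
  then show ?thesis unfolding eventually_nhds
    by (intro exI[of _ "{y \<in> - {0, 1}. \<nu> y \<in> V}"]) (use assms(1) nu_open in auto)
qed

lemma mu_continuous: "continuous_on (- D) \<mu>"
  unfolding continuous_on_open_vimage[OF open_D]
proof (intro allI impI)
  fix B :: "complex set" assume "open B"
  moreover have "\<mu> -` B \<inter> - D = {x \<in> - D. \<mu> x \<in> B}" by auto
  ultimately show "open (\<mu> -` B \<inter> - D)" using mu_open by simp
qed

lemma mu_loop:
  assumes "g \<in> loops_at (- D) p" shows "\<mu> \<circ> g \<in> loops_at (- {0, 1}) (\<mu> p)"
proof -
  have "path (\<mu> \<circ> g)"
    using assms mu_continuous by (intro path_continuous_image continuous_on_subset[OF mu_continuous]) (auto simp: loops_at_def)
  then show ?thesis using assms mu by (fastforce simp: loops_at_def pathstart_compose pathfinish_compose path_image_compose)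
qed

lemma nu_loop:
  assumes "g \<in> loops_at (- {0, 1}) (\<mu> p)" "p \<notin> D" shows "\<nu> \<circ> g \<in> loops_at (- D) p"
proof -
  have "path (\<nu> \<circ> g)"
    using assms by (intro path_continuous_image continuous_on_subset[OF nu_cont]) (auto simp: loops_at_def)
  moreover have "path_image (\<nu> \<circ> g) \<subseteq> - D"
    using assms nu unfolding path_image_compose loops_at_def by blast
  ultimately show ?thesis using assms nu_mu by (simp add: loops_at_def pathstart_compose pathfinish_compose)
qed

text \<open>The transformation law of a second order equation under a change of variable: the chain
  rule for \<open>h (\<mu> z)\<close> reproduces the old equation times
  \<open>m1 z ^ 2\<close>.\<close>

definition pulled_back ::
    "(complex \<Rightarrow> complex) \<Rightarrow> (complex \<Rightarrow> complex) \<Rightarrow> (complex \<Rightarrow> complex) \<Rightarrow> (complex \<Rightarrow> complex) \<Rightarrow> bool" where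
  "pulled_back P Q b1 b2 \<longleftrightarrow> (\<forall>z. Fin z \<notin> D \<longrightarrow>
     b1 z = P (\<mu> (Fin z)) * m1 z - m2 z / m1 z \<and> b2 z = Q (\<mu> (Fin z)) * m1 z ^ 2)"

lemma pullback_equation:
  assumes W: "open W" "z \<in> W" "\<And>z. z \<in> W \<Longrightarrow> Fin z \<notin> D"
    and f: "\<And>z. z \<in> W \<Longrightarrow> f z = h (\<mu> (Fin z))"
    and h: "\<And>z. z \<in> W \<Longrightarrow> (h has_field_derivative h1 (\<mu> (Fin z))) (at (\<mu> (Fin z)))"
      "\<And>z. z \<in> W \<Longrightarrow> (h1 has_field_derivative h2 (\<mu> (Fin z))) (at (\<mu> (Fin z)))"
    and "pulled_back P Q b1 b2"
  shows "deriv (deriv f) z + b1 z * deriv f z + b2 z * f z =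
    m1 z ^ 2 * (h2 (\<mu> (Fin z)) + P (\<mu> (Fin z)) * h1 (\<mu> (Fin z)) + Q (\<mu> (Fin z)) * h (\<mu> (Fin z)))"
proof -
  have b: "b1 z = P (\<mu> (Fin z)) * m1 z - m2 z / m1 z" "b2 z = Q (\<mu> (Fin z)) * m1 z ^ 2"
    using assms by (auto simp: pulled_back_def)
  have ev: "\<forall>\<^sub>F x in nhds w. x \<in> W" if "w \<in> W" for w using eventually_nhds_in_open[OF W(1) that] .
  have df: "deriv f w = h1 (\<mu> (Fin w)) * m1 w" if w: "w \<in> W" for w
  proof (rule DERIV_imp_deriv)
    have "\<forall>\<^sub>F x in nhds w. f x = h (\<mu> (Fin x))" using ev[OF w] by eventually_elim (rule f)
    moreover have "((\<lambda>x. h (\<mu> (Fin x))) has_field_derivative h1 (\<mu> (Fin w)) * m1 w) (at w)"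
      by (rule DERIV_chain2[OF h(1)[OF w] m1]) (use W w in auto)
    ultimately show "(f has_field_derivative h1 (\<mu> (Fin w)) * m1 w) (at w)"
      by (rule has_field_derivative_cong_nhds)
  qed
  have "deriv (deriv f) z = h2 (\<mu> (Fin z)) * m1 z * m1 z + h1 (\<mu> (Fin z)) * m2 z"
  proof (rule DERIV_imp_deriv)
    have "\<forall>\<^sub>F x in nhds z. deriv f x = h1 (\<mu> (Fin x)) * m1 x" using ev[OF W(2)] by eventually_elim (rule df)
    moreover have "((\<lambda>x. h1 (\<mu> (Fin x)) * m1 x) has_field_derivative h2 (\<mu> (Fin z)) * m1 z * m1 z + h1 (\<mu> (Fin z)) * m2 z) (at z)"
      using DERIV_mult[OF DERIV_chain2[OF h(2)[OF W(2)] m1] m2] W by (simp add: mult_ac)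
    ultimately show "(deriv f has_field_derivative h2 (\<mu> (Fin z)) * m1 z * m1 z + h1 (\<mu> (Fin z)) * m2 z) (at z)"
      by (rule has_field_derivative_cong_nhds)
  qed
  moreover have "m2 z / m1 z * m1 z = m2 z" using m1_nz W by simp
  ultimately show ?thesis using df[OF W(2)] f[OF W(2)] unfolding b by algebra
qed

lemma pullback_solution_near:
  assumes p: "p \<notin> D" and U: "open U" "\<mu> p \<in> U" "ode2 P Q U h h'"
    and b: "pulled_back P Q b1 b2"
  shows "solution_near b1 b2 p (\<lambda>x. h (\<mu> x))"
  unfolding solution_near_def
proof (intro exI conjI allI impI)
  let ?U = "{x \<in> - D. \<mu> x \<in> U}"
  show "open ?U" "p \<in> ?U" using mu_open U p by auto
  show "holomorphic_on_sphere (\<lambda>x. h (\<mu> x)) ?U"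
    by (rule holomorphic_on_sphere_compose[OF mu_hol ode2_holomorphic(1)[OF U(3)]])
  fix z assume z: "Fin z \<in> ?U"
  define h2 where "h2 y = - (P y * h' y + Q y * h y)" for y
  have "deriv (deriv (\<lambda>z. h (\<mu> (Fin z)))) z + b1 z * deriv (\<lambda>z. h (\<mu> (Fin z))) z + b2 z * h (\<mu> (Fin z)) =
     m1 z ^ 2 * (h2 (\<mu> (Fin z)) + P (\<mu> (Fin z)) * h' (\<mu> (Fin z)) + Q (\<mu> (Fin z)) * h (\<mu> (Fin z)))"
    by (rule pullback_equation[of "Fin -` ?U"])
       (use z U(3) b open_Fin_vimage[OF mu_open[OF U(1)]] in \<open>auto simp: ode2_def h2_def\<close>)
  then show "deriv (deriv (\<lambda>z. h (\<mu> (Fin z)))) z + b1 z * deriv (\<lambda>z. h (\<mu> (Fin z))) z + b2 z * h (\<mu> (Fin z)) = 0"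
    by (simp add: h2_def)
qed

text \<open>A solution on the sphere is known to satisfy the equation at finite points only. The
  defect \<open>E\<close> therefore vanishes except possibly where \<nu> takes the value
  \<open>Inf\<close>; that is at most one point, and continuity settles it.\<close>

lemma pushforward_solution:
  assumes p: "p \<notin> D" and f: "solution_near b1 b2 p f"
    and PQ: "continuous_on (- {0, 1}) P" "continuous_on (- {0, 1}) Q"
    and b: "pulled_back P Q b1 b2"
  obtains e where "e > 0" "ball (\<mu> p) e \<subseteq> - {0, 1}" "ode2 P Q (ball (\<mu> p) e) (\<lambda>y. f (\<nu> y)) (deriv (\<lambda>y. f (\<nu> y)))"
proof -
  obtain U where U: "open U" "p \<in> U" "holomorphic_on_sphere f U"
    "\<And>z. Fin z \<in> U \<Longrightarrow> deriv (deriv (\<lambda>z. f (Fin z))) z + b1 z * deriv (\<lambda>z. f (Fin z)) z + b2 z * f (Fin z) = 0"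
    using f unfolding solution_near_def by blast
  define O' where "O' = {y \<in> - {0, 1}. \<nu> y \<in> U}"
  define h where "h y = f (\<nu> y)" for y
  have O': "open O'" "\<mu> p \<in> O'" "O' \<subseteq> - {0, 1}" unfolding O'_def using nu_open U mu[OF p] nu_mu[OF p] by auto
  have hol: "h holomorphic_on O'" unfolding O'_def h_def by (rule nu_hol[OF U(3,1)])
  have d1: "(h has_field_derivative deriv h y) (at y)" if "y \<in> O'" for y
    using holomorphic_derivI[OF hol O'(1) that] by simp
  have d2: "(deriv h has_field_derivative deriv (deriv h) y) (at y)" if "y \<in> O'" for y
    using holomorphic_derivI[OF holomorphic_deriv[OF hol O'(1)] O'(1) that] by simp
  define E where "E y = deriv (deriv h) y + P y * deriv h y + Q y * h y" for y
  have E0: "E (\<mu> (Fin z)) = 0" if z: "Fin z \<notin> D" "Fin z \<in> U" for z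
  proof -
    have "open (Fin -` (U \<inter> - D))" by (intro open_Fin_vimage open_Int U open_D)
    then have "deriv (deriv (\<lambda>z. f (Fin z))) z + b1 z * deriv (\<lambda>z. f (Fin z)) z + b2 z * f (Fin z) = m1 z ^ 2 * E (\<mu> (Fin z))"
      unfolding E_def
    proof (rule pullback_equation)
      show "f (Fin w) = h (\<mu> (Fin w))" if "w \<in> Fin -` (U \<inter> - D)" for w
        using that nu_mu by (simp add: h_def)
      have "\<mu> (Fin w) \<in> O'" if "w \<in> Fin -` (U \<inter> - D)" for w
        using that nu_mu mu by (simp add: O'_def)
      then show "(h has_field_derivative deriv h (\<mu> (Fin w))) (at (\<mu> (Fin w)))"
        "(deriv h has_field_derivative deriv (deriv h) (\<mu> (Fin w))) (at (\<mu> (Fin w)))" if "w \<in> Fin -` (U \<inter> - D)" for w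
        using that d1 d2 by blast+
    qed (use z b in auto)
    then show ?thesis using U(4)[OF z(2)] m1_nz[OF z(1)] by simp
  qed
  have "continuous_on O' E"
  proof -
    have "continuous_on O' h" "continuous_on O' (deriv h)" "continuous_on O' (deriv (deriv h))"
      by (intro holomorphic_on_imp_continuous_on holomorphic_deriv hol O'(1))+
    moreover have "continuous_on O' P" "continuous_on O' Q" using PQ O'(3) continuous_on_subset by blast+
    ultimately show ?thesis unfolding E_def by (intro continuous_on_add continuous_on_mult)
  qed
  then have cont: "isCont E y" if "y \<in> O'" for y using that O'(1) continuous_on_eq_continuous_at by blast
  have E: "E y = 0" if y: "y \<in> O'" for y
  proof -
    have "\<forall>\<^sub>F w in at y. E w = 0"
    proof -
      have "\<forall>\<^sub>F w in at y. w \<in> O'" using eventually_at_in_open'[OF O'(1) y] .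
      moreover have "\<forall>\<^sub>F w in at y. \<nu> w \<noteq> Inf"
      proof (cases "\<nu> y = Inf")
        case True
        have "\<forall>\<^sub>F w in at y. w \<in> O' \<and> w \<noteq> y" using eventually_at_in_open[OF O'(1) y] by simp
        then show ?thesis
        proof eventually_elim
          case (elim w) then show ?case using True mu_nu[of w] mu_nu[of y] y O'(3) by (metis subsetD)
        qed
      next
        case False
        have "\<forall>\<^sub>F x in nhds (\<nu> y). x \<noteq> Inf"
          using eventually_nhds_in_open[OF open_Compl_Inf, of "\<nu> y"] False by simp
        moreover have "y \<in> - {0, 1}" using y O'(3) by blast
        ultimately have "\<forall>\<^sub>F w in nhds y. w \<in> - {0, 1} \<and> \<nu> w \<noteq> Inf" by (intro nu_nhds)
        then have "\<forall>\<^sub>F w in nhds y. \<nu> w \<noteq> Inf" by (rule eventually_mono) blast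
        then show ?thesis by (simp add: eventually_nhds_conv_at)
      qed
      ultimately show ?thesis
      proof eventually_elim
        case (elim w)
        then obtain z where z: "\<nu> w = Fin z" by (cases "\<nu> w") auto
        have "w \<in> - {0, 1}" "\<nu> w \<in> U" using elim by (auto simp: O'_def)
        then show ?case using E0[of z] nu[of w] mu_nu[of w] z by auto
      qed
    qed
    then have "(E \<longlongrightarrow> 0) (at y)" using tendsto_eventually by blast
    then show ?thesis using cont[OF y] LIM_unique unfolding isCont_def by blast
  qed
  obtain e where e: "e > 0" "ball (\<mu> p) e \<subseteq> O'" using O' open_contains_ball by blast
  have "ode2 P Q (ball (\<mu> p) e) h (deriv h)"
    unfolding ode2_def
  proof (intro ballI conjI)
    fix y assume "y \<in> ball (\<mu> p) e"
    then have y: "y \<in> O'" using e by blast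
    show "(h has_field_derivative deriv h y) (at y)" by (rule d1[OF y])
    have "deriv (deriv h) y = - (P y * deriv h y + Q y * h y)" using E[OF y] unfolding E_def by algebra
    then show "(deriv h has_field_derivative - (P y * deriv h y + Q y * h y)) (at y)" using d2[OF y] by simp
  qed
  then show ?thesis using that[OF e(1)] e(2) O'(3) unfolding h_def[abs_def] by blast
qed

lemma pullback_solution_basis:
  assumes p: "p \<notin> D" and U: "open U" "\<mu> p \<in> U" and X: "fundamental_system P Q U X X'"
    and PQ: "continuous_on (- {0, 1}) P" "continuous_on (- {0, 1}) Q"
    and b: "pulled_back P Q b1 b2"
  shows "solution_basis b1 b2 p (\<lambda>x. X (\<mu> x))"
  unfolding solution_basis_def
proof (intro conjI allI impI)
  have ode: "ode2 P Q U (\<lambda>y. X y $ k) (\<lambda>y. X' y $ k)" for k using X by (simp add: fundamental_system_def)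
  show "solution_near b1 b2 p (\<lambda>x. X (\<mu> x) $ k)" for k
    by (rule pullback_solution_near[OF p U ode b])
  fix f assume "solution_near b1 b2 p f"
  then obtain e where e: "e > 0" "ball (\<mu> p) e \<subseteq> - {0, 1}" "ode2 P Q (ball (\<mu> p) e) (\<lambda>y. f (\<nu> y)) (deriv (\<lambda>y. f (\<nu> y)))"
    by (rule pushforward_solution[OF p _ PQ b])
  obtain d where d: "d > 0" "ball (\<mu> p) d \<subseteq> U" using U open_contains_ball by blast
  let ?B = "ball (\<mu> p) (min d e)"
  have B: "?B \<subseteq> U" "?B \<subseteq> ball (\<mu> p) e" "\<mu> p \<in> ?B" using d e(1) by auto
  obtain c :: "complex ^ 2" where c: "\<And>y. y \<in> ?B \<Longrightarrow> f (\<nu> y) = (\<Sum>k\<in>UNIV. c $ k * X y $ k)"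
    using fundamental_system_span[OF open_ball connected_ball fundamental_system_subset[OF X B(1)] ode2_subset[OF e(3) B(2)]] by metis
  show "\<exists>!c :: complex ^ 2. \<forall>\<^sub>F x in nhds p. f x = (\<Sum>k\<in>UNIV. c $ k * X (\<mu> x) $ k)"
  proof (rule ex1I[of _ c])
    have "\<forall>\<^sub>F y in nhds (\<mu> p). y \<in> ?B" using eventually_nhds_in_open[OF open_ball B(3)] .
    from mu_nhds[OF p this] show "\<forall>\<^sub>F x in nhds p. f x = (\<Sum>k\<in>UNIV. c $ k * X (\<mu> x) $ k)"
    proof eventually_elim
      case (elim x) then show ?case using c[of "\<mu> x"] nu_mu[of x] by simp
    qed
    fix c' :: "complex ^ 2" assume "\<forall>\<^sub>F x in nhds p. f x = (\<Sum>k\<in>UNIV. c' $ k * X (\<mu> x) $ k)"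
    then have "\<forall>\<^sub>F x in nhds (\<nu> (\<mu> p)). f x = (\<Sum>k\<in>UNIV. c' $ k * X (\<mu> x) $ k)" using nu_mu[OF p] by simp
    from nu_nhds[OF mu[OF p] this] have ev: "\<forall>\<^sub>F y in nhds (\<mu> p). (\<Sum>k\<in>UNIV. c' $ k * X y $ k) = (\<Sum>k\<in>UNIV. c $ k * X y $ k)"
      using eventually_nhds_in_open[OF open_ball B(3)]
    proof eventually_elim
      case (elim y) then show ?case using c[of y] mu_nu[of y] by simp
    qed
    have der: "((\<lambda>y. \<Sum>k\<in>UNIV. a $ k * X y $ k) has_field_derivative (\<Sum>k\<in>UNIV. a $ k * X' (\<mu> p) $ k)) (at (\<mu> p))" for a :: "complex ^ 2"
      using ode U(2) unfolding ode2_def by (intro DERIV_sum DERIV_cmult) auto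
    \<comment> \<open>The two combinations agree on a neighbourhood, so their derivatives agree as
      well; values and derivatives at one point then identify the columns.\<close>
    have d: "(\<Sum>k\<in>UNIV. c' $ k * X' (\<mu> p) $ k) = (\<Sum>k\<in>UNIV. c $ k * X' (\<mu> p) $ k)"
      by (rule DERIV_unique[OF der has_field_derivative_cong_nhds[OF ev der]])
    show "c' = c"
    proof (rule fundamental_system_independent[of X X' "\<mu> p"])
      show "wronskian X X' (\<mu> p) \<noteq> 0" using X U(2) by (simp add: fundamental_system_def)
      show "(\<Sum>k\<in>UNIV. c' $ k * X (\<mu> p) $ k) = (\<Sum>k\<in>UNIV. c $ k * X (\<mu> p) $ k)"
        using eventually_nhds_x_imp_x[OF ev] .
      show "(\<Sum>k\<in>UNIV. c' $ k * X' (\<mu> p) $ k) = (\<Sum>k\<in>UNIV. c $ k * X' (\<mu> p) $ k)" by (rule d)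
    qed
  qed
qed

lemma pullback_continues_along:
  fixes F :: "real \<Rightarrow> complex \<Rightarrow> complex ^ 2"
  assumes g: "g \<in> loops_at (- D) p"
    and F: "continued_row (\<mu> \<circ> g) F"
  shows "continues_along g (\<lambda>x. F 0 (\<mu> x) $ k) (\<lambda>x. F 1 (\<mu> x) $ k)"
  unfolding continues_along_def
proof (intro exI conjI)
  have gD: "g t \<notin> D" if "t \<in> {0..1}" for t using g that unfolding loops_at_def path_image_def by blast
  show "analytic_continuation g (\<lambda>t x. F t (\<mu> x) $ k)"
    unfolding analytic_continuation_def
  proof
    fix t :: real assume t: "t \<in> {0..1}"
    obtain U where U: "open U" "\<mu> (g t) \<in> U" "(\<lambda>z. F t z $ k) holomorphic_on U"
      "\<forall>\<^sub>F s in at t within {0..1}. \<mu> (g s) \<in> U \<and> (\<forall>\<^sub>F z in nhds (\<mu> (g s)). F s z = F t z)"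
      using F t unfolding continued_row_def o_def by blast
    let ?U = "{x \<in> - D. \<mu> x \<in> U}"
    have "\<forall>\<^sub>F s in at t within {0..1}. s \<in> {0..1}" by (simp add: eventually_at_filter)
    with U(4) have "\<forall>\<^sub>F s in at t within {0..1}. g s \<in> ?U \<and> (\<forall>\<^sub>F x in nhds (g s). F s (\<mu> x) $ k = F t (\<mu> x) $ k)"
    proof eventually_elim
      case (elim s)
      then have "\<forall>\<^sub>F x in nhds (g s). x \<notin> D \<and> F s (\<mu> x) = F t (\<mu> x)" using mu_nhds[OF gD] by blast
      then have "\<forall>\<^sub>F x in nhds (g s). F s (\<mu> x) $ k = F t (\<mu> x) $ k" by (rule eventually_mono) simp
      then show ?case using elim gD by simp
    qed
    then show "\<exists>U. open U \<and> g t \<in> U \<and> holomorphic_on_sphere (\<lambda>x. F t (\<mu> x) $ k) U \<and>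
        (\<forall>\<^sub>F s in at t within {0..1}. g s \<in> U \<and> (\<forall>\<^sub>F x in nhds (g s). F s (\<mu> x) $ k = F t (\<mu> x) $ k))"
      using mu_open[OF U(1)] U(2) gD[OF t] holomorphic_on_sphere_compose[OF mu_hol U(3)]
      by (intro exI[of _ ?U]) auto
  qed
qed auto

theorem realized_after_pullback:
  assumes p: "p \<notin> D"
    and \<rho>: "\<rho> \<in> hom (fundamental_group (- D) p) GL2" and irr: "irreducible_rep (fundamental_group (- D) p) \<rho>"
  obtains r r' s s' t t' where "r + r' + s + s' + t + t' = 1"
    "\<And>b1 b2. pulled_back (riemann_p r r' s s') (riemann_q r r' s s' t t') b1 b2 \<Longrightarrow> realizes_monodromy D p b1 b2 \<rho>"
proof -
  define \<sigma> where "\<sigma> g = \<rho> (homotopy_class (- D) (\<nu> \<circ> g))" for g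
  let ?G = "fundamental_group (- D) p"
  have carrier: "homotopy_class (- D) g \<in> carrier ?G" if "g \<in> loops_at (- D) p" for g
    using that by (simp add: fundamental_group_def)
  have \<sigma>_mu: "\<sigma> (\<mu> \<circ> g) = \<rho> (homotopy_class (- D) g)" if g: "g \<in> loops_at (- D) p" for g
  proof -
    \<comment> \<open>The two paths coincide only on the unit interval, since outside it
      \<open>g\<close> is unconstrained; hence they are compared as homotopic paths and not as
      functions.\<close>
    have "homotopic_paths (- D) g (\<nu> \<circ> (\<mu> \<circ> g))"
      using g nu_mu by (intro homotopic_paths_eq) (auto simp: loops_at_def path_image_def image_subset_iff)
    then show ?thesis unfolding \<sigma>_def using homotopy_class_eq by metis
  qed
  interpret R: sheet_representation "\<mu> p" \<sigma>
  proof
    show "\<mu> p \<in> - {0, 1}" by (rule mu[OF p])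
    show "path_connected (- {0, 1 :: complex})" by (rule path_connected_twice_punctured)
    show "\<sigma> g = \<sigma> h" if "g \<in> loops_at (- {0, 1}) (\<mu> p)" "homotopic_paths (- {0, 1}) g h" for g h
      unfolding \<sigma>_def
      using homotopy_class_eq[OF homotopic_paths_continuous_image[OF that(2) nu_cont]] nu by fastforce
    show "\<sigma> (g +++ h) = \<sigma> g ** \<sigma> h" if "g \<in> loops_at (- {0, 1}) (\<mu> p)" "h \<in> loops_at (- {0, 1}) (\<mu> p)" for g h
    proof -
      note l = nu_loop[OF that(1) p] nu_loop[OF that(2) p]
      have "\<sigma> (g +++ h) = \<rho> (homotopy_class (- D) (\<nu> \<circ> g) \<otimes>\<^bsub>?G\<^esub> homotopy_class (- D) (\<nu> \<circ> h))"
        unfolding \<sigma>_def path_compose_join fundamental_group_mult[OF l] ..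
      then show ?thesis using hom_mult[OF \<rho> carrier[OF l(1)] carrier[OF l(2)]] by (simp add: \<sigma>_def GL2_def)
    qed
    show "invertible (\<sigma> g)" if "g \<in> loops_at (- {0, 1}) (\<mu> p)" for g
      using hom_in_carrier[OF \<rho> carrier[OF nu_loop[OF that p]]] by (simp add: \<sigma>_def GL2_def)
  qed
  have irr': "V = {0} \<or> V = UNIV" if V: "vec.subspace V" "\<And>g v. g \<in> loops_at (- {0, 1}) (\<mu> p) \<Longrightarrow> v \<in> V \<Longrightarrow> \<sigma> g *v v \<in> V" for V
  proof -
    have "\<rho> x *v v \<in> V" if xv: "x \<in> carrier ?G" "v \<in> V" for x v
    proof -
      obtain g where g: "g \<in> loops_at (- D) p" "x = homotopy_class (- D) g"
        using xv(1) by (auto simp: fundamental_group_def)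
      then show ?thesis using V(2)[OF mu_loop[OF g(1)] xv(2)] \<sigma>_mu[OF g(1)] by simp
    qed
    then show ?thesis using irr V(1) unfolding irreducible_rep_def by blast
  qed
  show ?thesis
  proof (rule R.loop_representation_realized)
    fix V assume "vec.subspace V" "\<And>g v. g \<in> loops_at (- {0, 1}) (\<mu> p) \<Longrightarrow> v \<in> V \<Longrightarrow> \<sigma> g *v v \<in> V"
    then show "V = {0} \<or> V = UNIV" by (rule irr')
  next
    fix r r' s s' t t' X X' U
    assume sum: "r + r' + s + s' + t + t' = 1" and U: "open U" "\<mu> p \<in> U"
      and X: "fundamental_system (riemann_p r r' s s') (riemann_q r r' s s' t t') U X X'"
      and mono: "\<And>g. g \<in> loops_at (- {0, 1}) (\<mu> p) \<Longrightarrow> \<exists>F.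
        continued_row g F \<and>
        (\<forall>z. F 0 z = X z) \<and> (\<forall>z. X z = F 1 z v* \<sigma> g)"
    have cont: "continuous_on (- {0, 1}) (riemann_p r r' s s')" "continuous_on (- {0, 1}) (riemann_q r r' s s' t t')"
      unfolding riemann_p_def[abs_def] riemann_q_def[abs_def] by (intro continuous_intros; auto)+
    show thesis
    proof (rule that[OF sum])
      fix b1 b2
      assume b: "pulled_back (riemann_p r r' s s') (riemann_q r r' s s' t t') b1 b2"
      show "realizes_monodromy D p b1 b2 \<rho>"
        unfolding realizes_monodromy_def
      proof (rule exI[of _ "\<lambda>x. X (\<mu> x)"], intro conjI ballI)
        show "solution_basis b1 b2 p (\<lambda>x. X (\<mu> x))"
          by (rule pullback_solution_basis[OF p U X cont b])
        fix g assume g: "g \<in> loops_at (- D) p"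
        obtain F :: "real \<Rightarrow> complex \<Rightarrow> complex ^ 2" where F: "continued_row (\<mu> \<circ> g) F"
           "\<And>z. F 0 z = X z" "\<And>z. X z = F 1 z v* \<sigma> (\<mu> \<circ> g)"
          using mono[OF mu_loop[OF g]] by blast
        show "\<exists>Y'. (\<forall>i. continues_along g (\<lambda>x. X (\<mu> x) $ i) (\<lambda>x. Y' x $ i)) \<and>
            (\<forall>\<^sub>F x in nhds p. X (\<mu> x) = Y' x v* \<rho> (homotopy_class (- D) g))"
        proof (intro exI[of _ "\<lambda>x. F 1 (\<mu> x)"] conjI allI)
          show "continues_along g (\<lambda>x. X (\<mu> x) $ k) (\<lambda>x. F 1 (\<mu> x) $ k)" for k
            using pullback_continues_along[OF g F(1), of k] unfolding F(2) .
          show "\<forall>\<^sub>F x in nhds p. X (\<mu> x) = F 1 (\<mu> x) v* \<rho> (homotopy_class (- D) g)"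
            using F(3) \<sigma>_mu[OF g] by simp
        qed
      qed
    qed
  qed
qed

end

section \<open>Affine and Moebius coordinates\<close>

lemma riemann_sphere_cases2: "x \<notin> {Fin a, Fin b, Inf} \<Longrightarrow> (\<And>z. x = Fin z \<Longrightarrow> z \<noteq> a \<Longrightarrow> z \<noteq> b \<Longrightarrow> thesis) \<Longrightarrow> thesis"
  by (cases x) auto

lemma sphere_coordinate_affine:
  assumes ne: "a1 \<noteq> a2"
  shows "sphere_coordinate {Fin a1, Fin a2, Inf} (\<lambda>x. case x of Fin z \<Rightarrow> (z - a1) / (a2 - a1) | Inf \<Rightarrow> 0)
     (\<lambda>y. Fin (a1 + (a2 - a1) * y)) (\<lambda>_. 1 / (a2 - a1)) (\<lambda>_. 0)"
    (is "sphere_coordinate ?D ?\<mu> ?\<nu> _ _")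
proof
  have k: "a2 - a1 \<noteq> 0" using ne by simp
  show "open (- ?D)" by (rule open_Compl_three)
  show "?\<mu> x \<in> - {0, 1}" "?\<nu> (?\<mu> x) = x" if x: "x \<notin> ?D" for x
  proof -
    obtain z where "x = Fin z" "z \<noteq> a1" "z \<noteq> a2" using riemann_sphere_cases2[OF x] by blast
    then show "?\<mu> x \<in> - {0, 1}" "?\<nu> (?\<mu> x) = x" using k by auto
  qed
  show "?\<nu> y \<notin> ?D" "?\<mu> (?\<nu> y) = y" if "y \<in> - {0, 1}" for y
  proof -
    have "a1 + (a2 - a1) * y = a2 \<longleftrightarrow> (a2 - a1) * (y - 1) = 0" by (auto simp: algebra_simps)
    then show "?\<nu> y \<notin> ?D" "?\<mu> (?\<nu> y) = y" using that k by auto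
  qed
  show "holomorphic_on_sphere ?\<mu> (- ?D)"
    unfolding holomorphic_on_sphere_def
  proof
    show "(\<lambda>z. ?\<mu> (Fin z)) holomorphic_on Fin -` (- ?D)"
      using k by (auto intro!: holomorphic_intros)
    have "(\<lambda>w. (1 / w - a1) / (a2 - a1)) holomorphic_on recip -` (- ?D)"
      using k by (intro holomorphic_intros) (auto simp: recip_def)
    then show "(\<lambda>w. ?\<mu> (recip w)) holomorphic_on recip -` (- ?D)"
      by (rule holomorphic_transform) (auto simp: recip_def)
  qed
  show "continuous_on (- {0, 1}) ?\<nu>"
    by (rule continuous_on_compose2[OF continuous_on_Fin[of UNIV]]) (auto intro!: continuous_intros)
  show "(\<lambda>y. f (?\<nu> y)) holomorphic_on {y \<in> - {0, 1}. ?\<nu> y \<in> U}" if "holomorphic_on_sphere f U" for f U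
  proof -
    have "(\<lambda>z. f (Fin z)) holomorphic_on Fin -` U" using that by (simp add: holomorphic_on_sphere_def)
    then have "((\<lambda>z. f (Fin z)) \<circ> (\<lambda>y. a1 + (a2 - a1) * y)) holomorphic_on {y \<in> - {0, 1}. ?\<nu> y \<in> U}"
      by (rule holomorphic_on_compose_gen[rotated]) (auto intro!: holomorphic_intros)
    then show ?thesis by (simp add: o_def)
  qed
  show "((\<lambda>z. ?\<mu> (Fin z)) has_field_derivative 1 / (a2 - a1)) (at z)" for z
    using k by (auto intro!: derivative_eq_intros)
qed (use ne in auto)

text \<open>The map sends \<open>a1\<close> to 0, \<open>a3\<close> to infinity and, by the choice
  of \<open>k\<close>, \<open>a2\<close> to 1. The constant \<open>k\<close> is its value at
  \<open>Inf\<close>; as it differs from 0 and 1, the point \<open>Inf\<close> is an ordinary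
  one.\<close>

lemma sphere_coordinate_moebius:
  assumes ne: "a1 \<noteq> a2" "a1 \<noteq> a3" "a2 \<noteq> a3"
  defines "k \<equiv> (a2 - a3) / (a2 - a1)"
  shows "sphere_coordinate {Fin a1, Fin a2, Fin a3} (\<lambda>x. case x of Fin z \<Rightarrow> k * (z - a1) / (z - a3) | Inf \<Rightarrow> k)
     (\<lambda>y. if y = k then Inf else Fin ((a3 * y - k * a1) / (y - k)))
     (\<lambda>z. k * (a1 - a3) / (z - a3) ^ 2) (\<lambda>z. - 2 * k * (a1 - a3) / (z - a3) ^ 3)"
    (is "sphere_coordinate ?D ?\<mu> ?\<nu> ?m1 ?m2")
proof
  have d: "a2 - a1 \<noteq> 0" "a2 - a3 \<noteq> 0" "a1 - a3 \<noteq> 0" using ne by auto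
  have k0: "k \<noteq> 0" using d by (simp add: k_def)
  have keq: "k * (a2 - a1) = a2 - a3" using d by (simp add: k_def)
  have k1: "k \<noteq> 1"
  proof
    assume "k = 1" then show False using keq ne by simp
  qed
  show "open (- ?D)" by (rule open_Compl_three)
  show "?\<mu> x \<in> - {0, 1}" "?\<nu> (?\<mu> x) = x" if x: "x \<notin> ?D" for x
  proof -
    show "?\<mu> x \<in> - {0, 1}"
    proof (cases x)
      case (Fin z)
      then have z: "z - a1 \<noteq> 0" "z - a2 \<noteq> 0" "z - a3 \<noteq> 0" using x by auto
      have "(a2 - a1) * (k * (z - a1) - (z - a3)) = (a1 - a3) * (z - a2)" using keq by algebra
      then have "k * (z - a1) \<noteq> z - a3" using z d by auto
      then show ?thesis using Fin z k0 by auto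
    qed (use k0 k1 in auto)
    show "?\<nu> (?\<mu> x) = x"
    proof (cases x)
      case (Fin z)
      then have z: "z - a3 \<noteq> 0" using x by auto
      have y: "k * (z - a1) / (z - a3) - k = k * (a3 - a1) / (z - a3)"
        using z by (simp add: field_simps)
      then have ny: "k * (z - a1) / (z - a3) \<noteq> k" using k0 d z by (metis divide_eq_0_iff mult_eq_0_iff right_minus_eq ne(2))
      have "a3 * (k * (z - a1) / (z - a3)) - k * a1 = z * (k * (a3 - a1) / (z - a3))"
        using z by (simp add: field_simps)
      then show ?thesis using Fin ny k0 z ne(2) unfolding y[symmetric] by simp
    qed auto
  qed
  show "?\<nu> y \<notin> ?D" "?\<mu> (?\<nu> y) = y" if y: "y \<in> - {0, 1}" for y
  proof -
    show mn: "?\<mu> (?\<nu> y) = y"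
    proof (cases "y = k")
      case False
      then have yk: "y - k \<noteq> 0" by simp
      let ?z = "(a3 * y - k * a1) / (y - k)"
      have e: "?z - a1 = y * (a3 - a1) / (y - k)" "?z - a3 = k * (a3 - a1) / (y - k)"
        using yk by (simp_all add: field_simps)
      have "k * (?z - a1) / (?z - a3) = y" unfolding e using k0 yk ne(2) by simp
      then show ?thesis using False by simp
    qed auto
    \<comment> \<open>At \<open>a3\<close> the value is 0 by division by zero. So all three singular
      points have values in \<open>{0, 1}\<close>, and the preceding inversion formula keeps \<nu>
      away from them.\<close>
    have "?\<mu> (Fin a1) = 0" "?\<mu> (Fin a2) = 1" "?\<mu> (Fin a3) = 0" using d keq by auto
    then show "?\<nu> y \<notin> ?D" using mn y by auto
  qed
  show "holomorphic_on_sphere ?\<mu> (- ?D)"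
    unfolding holomorphic_on_sphere_def
  proof
    show "(\<lambda>z. ?\<mu> (Fin z)) holomorphic_on Fin -` (- ?D)"
      by (auto intro!: holomorphic_intros)
    have nz: "1 - a3 * w \<noteq> 0" if "w \<in> recip -` (- ?D)" for w
      using that by (auto simp: recip_def field_simps split: if_splits)
    have "(\<lambda>w. k * (1 - a1 * w) / (1 - a3 * w)) holomorphic_on recip -` (- ?D)"
      using nz by (intro holomorphic_intros) auto
    then show "(\<lambda>w. ?\<mu> (recip w)) holomorphic_on recip -` (- ?D)"
    proof (rule holomorphic_transform)
      fix w assume w: "w \<in> recip -` (- ?D)"
      show "k * (1 - a1 * w) / (1 - a3 * w) = ?\<mu> (recip w)"
      proof (cases "w = 0")
        case False
        then have "1 / w - a1 = (1 - a1 * w) / w" "1 / w - a3 = (1 - a3 * w) / w" by (auto simp: field_simps)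
        then show ?thesis using False by (simp add: recip_def)
      qed (simp add: recip_def)
    qed
  qed
  \<comment> \<open>On \<open>R\<close> the map \<nu> avoids \<open>Fin 0\<close> and can be written
    in the chart \<open>recip\<close>, which covers \<open>y = k\<close>; away from \<open>k\<close>
    the chart \<open>Fin\<close> applies. The two open pieces exhaust the domain.\<close>
  define R where "R = {y \<in> - {0, 1}. a3 * y \<noteq> k * a1}"
  have rc: "?\<nu> y = recip ((y - k) / (a3 * y - k * a1))" if "y \<in> R" for y
    using that by (auto simp: R_def recip_def)
  have kR: "k \<in> R" using k0 k1 ne(2) by (auto simp: R_def)
  have oR: "open R"
  proof -
    have "R = - {0, 1} \<inter> {y. a3 * y \<noteq> k * a1}" by (auto simp: R_def)
    moreover have "open {y. a3 * y \<noteq> k * a1}" by (intro open_Collect_neq continuous_intros)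
    ultimately show ?thesis by (simp add: open_Int open_Compl finite_imp_closed)
  qed
  have oF: "open (- {0, 1, k})" by (intro open_Compl finite_imp_closed) auto
  have un: "R \<union> - {0, 1, k} = - {0, 1}" using kR by (auto simp: R_def)
  have "continuous_on R ?\<nu>"
  proof (rule continuous_on_eq)
    show "continuous_on R (\<lambda>y. recip ((y - k) / (a3 * y - k * a1)))"
      by (rule continuous_on_compose2[OF continuous_on_recip[of UNIV]]) (auto intro!: continuous_intros simp: R_def)
  qed (simp only: rc)
  moreover have "continuous_on (- {0, 1, k}) ?\<nu>"
  proof (rule continuous_on_eq)
    show "continuous_on (- {0, 1, k}) (\<lambda>y. Fin ((a3 * y - k * a1) / (y - k)))"
      by (rule continuous_on_compose2[OF continuous_on_Fin[of UNIV]]) (auto intro!: continuous_intros)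
  qed auto
  ultimately show "continuous_on (- {0, 1}) ?\<nu>" using continuous_on_open_Un[OF oR oF] un by metis
  show "(\<lambda>y. f (?\<nu> y)) holomorphic_on {y \<in> - {0, 1}. ?\<nu> y \<in> U}" if f: "holomorphic_on_sphere f U" and U: "open U" for f U
  proof -
    let ?A = "{y \<in> R. recip ((y - k) / (a3 * y - k * a1)) \<in> U}" and ?B = "{y \<in> - {0, 1, k}. Fin ((a3 * y - k * a1) / (y - k)) \<in> U}"
    have fF: "(\<lambda>z. f (Fin z)) holomorphic_on Fin -` U" and fR: "(\<lambda>z. f (recip z)) holomorphic_on recip -` U"
      using f by (auto simp: holomorphic_on_sphere_def)
    have holR: "(\<lambda>y. (y - k) / (a3 * y - k * a1)) holomorphic_on R"
      by (auto intro!: holomorphic_intros simp: R_def)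
    have holF: "(\<lambda>y. (a3 * y - k * a1) / (y - k)) holomorphic_on - {0, 1, k}"
      by (auto intro!: holomorphic_intros)
    have "(\<lambda>y. f (recip ((y - k) / (a3 * y - k * a1)))) holomorphic_on ?A"
      using holomorphic_on_compose_gen[OF holomorphic_on_subset[OF holR] fR, of ?A] by (auto simp: o_def)
    then have A: "(\<lambda>y. f (?\<nu> y)) holomorphic_on ?A"
      by (rule holomorphic_transform) (simp only: rc mem_Collect_eq)
    have "(\<lambda>y. f (Fin ((a3 * y - k * a1) / (y - k)))) holomorphic_on ?B"
      using holomorphic_on_compose_gen[OF holomorphic_on_subset[OF holF] fF, of ?B] by (auto simp: o_def)
    then have B: "(\<lambda>y. f (?\<nu> y)) holomorphic_on ?B"
      by (rule holomorphic_transform) auto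
    have "open ((\<lambda>y. (y - k) / (a3 * y - k * a1)) -` (recip -` U) \<inter> R)"
      using holomorphic_on_imp_continuous_on[OF holR] open_recip_vimage[OF U] oR continuous_on_open_vimage by blast
    moreover have "?A = (\<lambda>y. (y - k) / (a3 * y - k * a1)) -` (recip -` U) \<inter> R" by auto
    ultimately have oA: "open ?A" by simp
    have "open ((\<lambda>y. (a3 * y - k * a1) / (y - k)) -` (Fin -` U) \<inter> - {0, 1, k})"
      using holomorphic_on_imp_continuous_on[OF holF] open_Fin_vimage[OF U] oF continuous_on_open_vimage by blast
    moreover have "?B = (\<lambda>y. (a3 * y - k * a1) / (y - k)) -` (Fin -` U) \<inter> - {0, 1, k}" by auto
    ultimately have oB: "open ?B" by simp
    have "?A \<union> ?B = {y \<in> - {0, 1}. ?\<nu> y \<in> U}"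
    proof (intro equalityI subsetI)
      fix y assume "y \<in> {y \<in> - {0, 1}. ?\<nu> y \<in> U}"
      then show "y \<in> ?A \<union> ?B" using kR rc[OF kR] by (cases "y = k") auto
    next
      fix y assume "y \<in> ?A \<union> ?B"
      then show "y \<in> {y \<in> - {0, 1}. ?\<nu> y \<in> U}"
      proof
        assume "y \<in> ?A" then show ?thesis using rc[of y] by (simp add: R_def)
      qed auto
    qed
    then show ?thesis using holomorphic_on_Un[OF A B oA oB] by simp
  qed
  fix z assume "Fin z \<notin> ?D"
  then have z: "z - a3 \<noteq> 0" by auto
  have "((\<lambda>z. k * (z - a1) / (z - a3)) has_field_derivative (k * (z - a3) - k * (z - a1)) / ((z - a3) * (z - a3))) (at z)"
    using z by (auto intro!: derivative_eq_intros)
  then show "((\<lambda>z. ?\<mu> (Fin z)) has_field_derivative ?m1 z) (at z)"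
    by (simp add: power2_eq_square algebra_simps)
  show "(?m1 has_field_derivative ?m2 z) (at z)"
  proof -
    define c where "c = k * (a1 - a3)"
    have "((\<lambda>z. c / (z - a3) ^ 2) has_field_derivative (0 * (z - a3) ^ 2 - c * (2 * (z - a3))) / ((z - a3) ^ 2 * (z - a3) ^ 2)) (at z)"
      by (rule DERIV_divide) (use z in \<open>auto intro!: derivative_eq_intros\<close>)
    moreover have "(0 * w ^ 2 - c * (2 * w)) / (w ^ 2 * w ^ 2) = - 2 * c / w ^ 3" if "w \<noteq> 0" for w
      using that by (simp add: power2_eq_square power3_eq_cube mult_ac)
    ultimately have "((\<lambda>z. c / (z - a3) ^ 2) has_field_derivative - 2 * c / (z - a3) ^ 3) (at z)" using z by metis
    then show ?thesis unfolding c_def by (simp only: mult.assoc)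
  qed
  show "?m1 z \<noteq> 0" using z k0 ne(2) by simp
qed

section \<open>Pole orders of the explicit coefficients\<close>

lemma pole_order_leI:
  assumes "g analytic_on {a}" "\<And>z. z \<noteq> a \<Longrightarrow> f z = g z / (z - a) ^ n"
  shows "pole_order_le f a n"
  unfolding pole_order_le_def using assms by (auto simp: eventually_at_filter)

lemma eventually_affine_nonzero: "\<forall>\<^sub>F w in at 0. 1 - a * w \<noteq> (0::complex)"
proof -
  have "isCont (\<lambda>w. 1 - a * w) 0" by (intro continuous_intros)
  then have "\<forall>\<^sub>F w in nhds 0. 1 - a * w \<noteq> 0"
    using continuous_at_avoid[of 0 "\<lambda>w. 1 - a * w" 0] by (auto simp: eventually_nhds_metric dist_commute)
  then show ?thesis using eventually_nhds_conv_at by blast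
qed

text \<open>In the coordinate \<open>w\<close> the nonzero finite singular points lie at their
  reciprocals and so stay away from \<open>w = 0\<close>. The formula for \<open>f\<close> is only
  required where no denominator vanishes.\<close>

lemma pole_order_le_infI:
  fixes f :: "complex \<Rightarrow> complex"
  assumes "g analytic_on {0}" "\<And>w. w \<noteq> 0 \<Longrightarrow> 1 - a1 * w \<noteq> 0 \<Longrightarrow> 1 - a2 * w \<noteq> 0 \<Longrightarrow> 1 - a3 * w \<noteq> 0 \<Longrightarrow> f w = g w / w ^ n"
  shows "pole_order_le f 0 n"
  unfolding pole_order_le_def
proof (intro exI conjI)
  have "\<forall>\<^sub>F w in at (0::complex). w \<noteq> 0" by (simp add: eventually_at_filter)
  then show "\<forall>\<^sub>F w in at 0. f w = g w / (w - 0) ^ n"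
    using eventually_affine_nonzero[of a1] eventually_affine_nonzero[of a2] eventually_affine_nonzero[of a3]
    by eventually_elim (use assms(2) in simp)
qed (rule assms(1))

lemma recip_diff: "w \<noteq> 0 \<Longrightarrow> 1 / w - a = (1 - a * w) / (w :: complex)"
  by (simp add: field_simps)

text \<open>At infinity \<open>b1\<close> decays at least like \<open>1 / z\<close> and
  \<open>b2\<close> at least like \<open>1 / z\<^sup>2\<close>, which is the Fuchsian condition
  there.\<close>

lemma riemann_equation_affine:
  fixes a1 a2 c1 c2 A B C :: complex
  assumes ne: "a1 \<noteq> a2"
  defines "b1 \<equiv> \<lambda>z. c1 / (z - a1) + c2 / (z - a2)"
    and "b2 \<equiv> \<lambda>z. (A / (z - a2) + B / (z - a1) + C) / ((z - a1) * (z - a2))"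
  shows "riemann_equation {Fin a1, Fin a2, Inf} b1 b2"
  unfolding riemann_equation_def
proof (intro conjI allI ballI impI)
  show "card {Fin a1, Fin a2, Inf} = 3" using ne by simp
  fix p assume "p \<notin> {Fin a1, Fin a2, Inf}"
  then show "ordinary_at b1 b2 p"
    by (rule riemann_sphere_cases2) (auto simp: b1_def b2_def intro!: analytic_intros)
next
  fix p assume "p \<in> {Fin a1, Fin a2, Inf}"
  then consider "p = Fin a1" | "p = Fin a2" | "p = Inf" by blast
  then show "fuchsian_at b1 b2 p"
  proof cases
    case 1
    have "pole_order_le b1 a1 1"
      by (rule pole_order_leI[of "\<lambda>z. c1 + c2 * (z - a1) / (z - a2)"])
         (use ne in \<open>auto simp: b1_def add_divide_distrib intro!: analytic_intros\<close>)
    moreover have "pole_order_le b2 a1 2"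
    proof (rule pole_order_leI[of "\<lambda>z. (A / (z - a2) * (z - a1) + B + C * (z - a1)) / (z - a2)"])
      fix z assume z: "z \<noteq> a1"
      have "A / (z - a2) * (z - a1) + B + C * (z - a1) = (A / (z - a2) + B / (z - a1) + C) * (z - a1)"
        using z by (simp add: distrib_right)
      then show "b2 z = (A / (z - a2) * (z - a1) + B + C * (z - a1)) / (z - a2) / (z - a1)\<^sup>2"
        unfolding b2_def using z by (simp add: power2_eq_square)
    qed (use ne in \<open>auto intro!: analytic_intros\<close>)
    ultimately show ?thesis using 1 by simp
  next
    case 2
    have "pole_order_le b1 a2 1"
      by (rule pole_order_leI[of "\<lambda>z. c2 + c1 * (z - a2) / (z - a1)"])
         (use ne in \<open>auto simp: b1_def add_divide_distrib intro!: analytic_intros\<close>)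
    moreover have "pole_order_le b2 a2 2"
    proof (rule pole_order_leI[of "\<lambda>z. (A + B / (z - a1) * (z - a2) + C * (z - a2)) / (z - a1)"])
      fix z assume z: "z \<noteq> a2"
      have "A + B / (z - a1) * (z - a2) + C * (z - a2) = (A / (z - a2) + B / (z - a1) + C) * (z - a2)"
        using z by (simp add: distrib_right)
      then show "b2 z = (A + B / (z - a1) * (z - a2) + C * (z - a2)) / (z - a1) / (z - a2)\<^sup>2"
        unfolding b2_def using z by (simp add: power2_eq_square)
    qed (use ne in \<open>auto intro!: analytic_intros\<close>)
    ultimately show ?thesis using 2 by simp
  next
    case 3
    have "pole_order_le (coeff1_inf b1) 0 1"
    proof (rule pole_order_le_infI[of "\<lambda>w. 2 - c1 / (1 - a1 * w) - c2 / (1 - a2 * w)" a1 a2 0])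
      fix w :: complex assume w: "w \<noteq> 0"
      show "coeff1_inf b1 w = (2 - c1 / (1 - a1 * w) - c2 / (1 - a2 * w)) / w ^ 1"
      proof -
        have e: "c / ((1 - a * w) / w) / w\<^sup>2 = c / (1 - a * w) / w" for c a
          using w by (simp add: power2_eq_square)
        have "coeff1_inf b1 w = 2 / w - (c1 / ((1 - a1 * w) / w) / w\<^sup>2 + c2 / ((1 - a2 * w) / w) / w\<^sup>2)"
          unfolding coeff1_inf_def b1_def recip_diff[OF w] by (simp only: add_divide_distrib)
        then show ?thesis unfolding e by (simp add: diff_divide_distrib)
      qed
    qed (auto intro!: analytic_intros)
    moreover have "pole_order_le (coeff2_inf b2) 0 2"
    proof (rule pole_order_le_infI[of "\<lambda>w. (A * w / (1 - a2 * w) + B * w / (1 - a1 * w) + C) / ((1 - a1 * w) * (1 - a2 * w))" a1 a2 0])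
      fix w :: complex assume w: "w \<noteq> 0"
      show "coeff2_inf b2 w = (A * w / (1 - a2 * w) + B * w / (1 - a1 * w) + C) / ((1 - a1 * w) * (1 - a2 * w)) / w ^ 2"
        unfolding coeff2_inf_def b2_def recip_diff[OF w] using w by (simp add: eval_nat_numeral)
    qed (auto intro!: analytic_intros)
    ultimately show ?thesis using 3 by simp
  qed
qed

text \<open>Infinity must now be ordinary. The sum of residues 2 cancels the term
  \<open>2 / w\<close> of the transformed first coefficient, and \<open>b2\<close> decays at least
  like \<open>1 / z ^ 4\<close>.\<close>

lemma riemann_equation_finite:
  fixes a1 a2 a3 c1 c2 c3 A B C :: complex
  assumes ne: "a1 \<noteq> a2" "a1 \<noteq> a3" "a2 \<noteq> a3" and c: "c1 + c2 + c3 = 2"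
  defines "b1 \<equiv> \<lambda>z. c1 / (z - a1) + c2 / (z - a2) + c3 / (z - a3)"
    and "b2 \<equiv> \<lambda>z. (A * (z - a3) / (z - a2) + B * (z - a3) / (z - a1) + C) / ((z - a1) * (z - a2) * (z - a3) ^ 2)"
  shows "riemann_equation {Fin a1, Fin a2, Fin a3} b1 b2"
  unfolding riemann_equation_def
proof (intro conjI allI ballI impI)
  show "card {Fin a1, Fin a2, Fin a3} = 3" using ne by simp
  fix p assume p: "p \<notin> {Fin a1, Fin a2, Fin a3}"
  show "ordinary_at b1 b2 p"
  proof (cases p)
    case (Fin z)
    then show ?thesis using p by (auto simp: b1_def b2_def intro!: analytic_intros)
  next
    case Inf
    have "pole_order_le (coeff1_inf b1) 0 0"
    proof (rule pole_order_le_infI[of "\<lambda>w. - (c1 * a1 / (1 - a1 * w) + c2 * a2 / (1 - a2 * w) + c3 * a3 / (1 - a3 * w))" a1 a2 a3])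
      fix w :: complex assume w: "w \<noteq> 0" "1 - a1 * w \<noteq> 0" "1 - a2 * w \<noteq> 0" "1 - a3 * w \<noteq> 0"
      \<comment> \<open>Separates the pole at \<open>w = 0\<close> from a part that is analytic
        there, so that the residues can be added up.\<close>
      have e: "c / ((1 - a * w) / w) / w\<^sup>2 = c / w + c * a / (1 - a * w)" if "1 - a * w \<noteq> 0" for c a
        using that w(1) by (simp add: divide_simps power2_eq_square) (simp add: algebra_simps)
      have "coeff1_inf b1 w = 2 / w - (c1 / ((1 - a1 * w) / w) / w\<^sup>2 + c2 / ((1 - a2 * w) / w) / w\<^sup>2 + c3 / ((1 - a3 * w) / w) / w\<^sup>2)"
        unfolding coeff1_inf_def b1_def recip_diff[OF w(1)] by (simp only: add_divide_distrib)
      also have "\<dots> = (2 - (c1 + c2 + c3)) / w - (c1 * a1 / (1 - a1 * w) + c2 * a2 / (1 - a2 * w) + c3 * a3 / (1 - a3 * w))"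
        unfolding e[OF w(2)] e[OF w(3)] e[OF w(4)] by (simp add: diff_divide_distrib add_divide_distrib)
      finally show "coeff1_inf b1 w = - (c1 * a1 / (1 - a1 * w) + c2 * a2 / (1 - a2 * w) + c3 * a3 / (1 - a3 * w)) / w ^ 0"
        by (simp add: c)
    qed (auto intro!: analytic_intros)
    moreover have "pole_order_le (coeff2_inf b2) 0 0"
    proof (rule pole_order_le_infI[of "\<lambda>w. (A * (1 - a3 * w) / (1 - a2 * w) + B * (1 - a3 * w) / (1 - a1 * w) + C) / ((1 - a1 * w) * (1 - a2 * w) * (1 - a3 * w) ^ 2)" a1 a2 a3])
      fix w :: complex assume w: "w \<noteq> 0"
      show "coeff2_inf b2 w = (A * (1 - a3 * w) / (1 - a2 * w) + B * (1 - a3 * w) / (1 - a1 * w) + C) / ((1 - a1 * w) * (1 - a2 * w) * (1 - a3 * w) ^ 2) / w ^ 0"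
        unfolding coeff2_inf_def b2_def recip_diff[OF w] using w by (simp add: eval_nat_numeral)
    qed (auto intro!: analytic_intros)
    ultimately show ?thesis using Inf by simp
  qed
next
  fix p assume "p \<in> {Fin a1, Fin a2, Fin a3}"
  then consider "p = Fin a1" | "p = Fin a2" | "p = Fin a3" by blast
  then show "fuchsian_at b1 b2 p"
  proof cases
    case 1
    have "pole_order_le b1 a1 1"
      by (rule pole_order_leI[of "\<lambda>z. c1 + (c2 / (z - a2) + c3 / (z - a3)) * (z - a1)"])
         (use ne in \<open>auto simp: b1_def add_divide_distrib intro!: analytic_intros\<close>)
    moreover have "pole_order_le b2 a1 2"
    proof (rule pole_order_leI[of "\<lambda>z. (A * (z - a3) / (z - a2) * (z - a1) + B * (z - a3) + C * (z - a1)) / ((z - a2) * (z - a3) ^ 2)"])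
      fix z assume z: "z \<noteq> a1"
      have "A * (z - a3) / (z - a2) * (z - a1) + B * (z - a3) + C * (z - a1) = (A * (z - a3) / (z - a2) + B * (z - a3) / (z - a1) + C) * (z - a1)"
        using z by (simp add: distrib_right)
      then show "b2 z = (A * (z - a3) / (z - a2) * (z - a1) + B * (z - a3) + C * (z - a1)) / ((z - a2) * (z - a3) ^ 2) / (z - a1)\<^sup>2"
        unfolding b2_def using z by (simp add: power2_eq_square)
    qed (use ne in \<open>auto intro!: analytic_intros\<close>)
    ultimately show ?thesis using 1 by simp
  next
    case 2
    have "pole_order_le b1 a2 1"
      by (rule pole_order_leI[of "\<lambda>z. c2 + (c1 / (z - a1) + c3 / (z - a3)) * (z - a2)"])
         (use ne in \<open>auto simp: b1_def add_divide_distrib intro!: analytic_intros\<close>)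
    moreover have "pole_order_le b2 a2 2"
    proof (rule pole_order_leI[of "\<lambda>z. (A * (z - a3) + B * (z - a3) / (z - a1) * (z - a2) + C * (z - a2)) / ((z - a1) * (z - a3) ^ 2)"])
      fix z assume z: "z \<noteq> a2"
      have "A * (z - a3) + B * (z - a3) / (z - a1) * (z - a2) + C * (z - a2) = (A * (z - a3) / (z - a2) + B * (z - a3) / (z - a1) + C) * (z - a2)"
        using z by (simp add: distrib_right)
      then show "b2 z = (A * (z - a3) + B * (z - a3) / (z - a1) * (z - a2) + C * (z - a2)) / ((z - a1) * (z - a3) ^ 2) / (z - a2)\<^sup>2"
        unfolding b2_def using z by (simp add: power2_eq_square)
    qed (use ne in \<open>auto intro!: analytic_intros\<close>)
    ultimately show ?thesis using 2 by simp
  next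
    case 3
    have "pole_order_le b1 a3 1"
      by (rule pole_order_leI[of "\<lambda>z. c3 + (c1 / (z - a1) + c2 / (z - a2)) * (z - a3)"])
         (use ne in \<open>auto simp: b1_def add_divide_distrib intro!: analytic_intros\<close>)
    moreover have "pole_order_le b2 a3 2"
      by (rule pole_order_leI[of "\<lambda>z. (A * (z - a3) / (z - a2) + B * (z - a3) / (z - a1) + C) / ((z - a1) * (z - a2))"])
         (use ne in \<open>auto simp: b2_def intro!: analytic_intros\<close>)
    ultimately show ?thesis using 3 by simp
  qed
qed

section \<open>The pulled back equations for the two positions of infinity\<close>

lemma realization_with_infinity:
  assumes ne: "a1 \<noteq> a2" and D: "D = {Fin a1, Fin a2, Inf}" and p: "p \<notin> D"
    and \<rho>: "\<rho> \<in> hom (fundamental_group (- D) p) GL2" and irr: "irreducible_rep (fundamental_group (- D) p) \<rho>"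
  shows "\<exists>b1 b2. riemann_equation D b1 b2 \<and> realizes_monodromy D p b1 b2 \<rho>"
proof -
  interpret sphere_coordinate D "\<lambda>x. case x of Fin z \<Rightarrow> (z - a1) / (a2 - a1) | Inf \<Rightarrow> 0"
     "\<lambda>y. Fin (a1 + (a2 - a1) * y)" "\<lambda>_. 1 / (a2 - a1)" "\<lambda>_. 0"
    unfolding D by (rule sphere_coordinate_affine[OF ne])
  show ?thesis
  proof (rule realized_after_pullback[OF p \<rho> irr])
    fix r r' s s' t t' :: complex
    assume real: "\<And>b1 b2. pulled_back (riemann_p r r' s s') (riemann_q r r' s s' t t') b1 b2 \<Longrightarrow> realizes_monodromy D p b1 b2 \<rho>"
    let ?d = "a2 - a1"
    let ?b1 = "\<lambda>z. (1 - r - r') / (z - a1) + (1 - s - s') / (z - a2)"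
    let ?b2 = "\<lambda>z. (s * s' * ?d / (z - a2) + - (r * r' * ?d) / (z - a1) + t * t') / ((z - a1) * (z - a2))"
    have "riemann_equation D ?b1 ?b2" unfolding D by (rule riemann_equation_affine[OF ne])
    moreover have "realizes_monodromy D p ?b1 ?b2 \<rho>"
    proof (rule real, unfold pulled_back_def, intro allI impI conjI)
      fix z assume "Fin z \<notin> D"
      then have z: "z - a1 \<noteq> 0" "z - a2 \<noteq> 0" using D by auto
      have d: "?d \<noteq> 0" using ne by simp
      have m: "(z - a1) / ?d - 1 = (z - a2) / ?d" using d by (simp add: field_simps)
      show "?b1 z = riemann_p r r' s s' (case Fin z of Fin z \<Rightarrow> (z - a1) / (a2 - a1) | Inf \<Rightarrow> 0) * (1 / (a2 - a1)) - 0 / (1 / (a2 - a1))"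
        using z d by (simp add: riemann_p_def m add_divide_distrib)
      show "?b2 z = riemann_q r r' s s' t t' (case Fin z of Fin z \<Rightarrow> (z - a1) / (a2 - a1) | Inf \<Rightarrow> 0) * (1 / (a2 - a1)) ^ 2"
        using z d by (simp add: riemann_q_def m power2_eq_square)
    qed
    ultimately show ?thesis by blast
  qed
qed

lemma realization_finite:
  assumes ne: "a1 \<noteq> a2" "a1 \<noteq> a3" "a2 \<noteq> a3" and D: "D = {Fin a1, Fin a2, Fin a3}" and p: "p \<notin> D"
    and \<rho>: "\<rho> \<in> hom (fundamental_group (- D) p) GL2" and irr: "irreducible_rep (fundamental_group (- D) p) \<rho>"
  shows "\<exists>b1 b2. riemann_equation D b1 b2 \<and> realizes_monodromy D p b1 b2 \<rho>"
proof -
  define k where "k = (a2 - a3) / (a2 - a1)"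
  let ?\<mu> = "\<lambda>x. case x of Fin z \<Rightarrow> k * (z - a1) / (z - a3) | Inf \<Rightarrow> k"
  let ?m1 = "\<lambda>z. k * (a1 - a3) / (z - a3) ^ 2" and ?m2 = "\<lambda>z. - 2 * k * (a1 - a3) / (z - a3) ^ 3"
  interpret sphere_coordinate D ?\<mu> "\<lambda>y. if y = k then Inf else Fin ((a3 * y - k * a1) / (y - k))" ?m1 ?m2
    unfolding D k_def by (rule sphere_coordinate_moebius[OF ne])
  have d: "a2 - a1 \<noteq> 0" "a2 - a3 \<noteq> 0" "a1 - a3 \<noteq> 0" using ne by auto
  have k0: "k \<noteq> 0" using d by (simp add: k_def)
  have k1: "k - 1 = (a1 - a3) / (a2 - a1)" using d by (simp add: k_def field_simps)
  show ?thesis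
  proof (rule realized_after_pullback[OF p \<rho> irr])
    fix r r' s s' t t' :: complex
    assume sum: "r + r' + s + s' + t + t' = 1"
      and real: "\<And>b1 b2. pulled_back (riemann_p r r' s s') (riemann_q r r' s s' t t') b1 b2 \<Longrightarrow> realizes_monodromy D p b1 b2 \<rho>"
    let ?E = "(a1 - a3) * (a2 - a3)"
    let ?b1 = "\<lambda>z. (1 - r - r') / (z - a1) + (1 - s - s') / (z - a2) + (1 - t - t') / (z - a3)"
    let ?b2 = "\<lambda>z. (s * s' / (k - 1) * ?E * (z - a3) / (z - a2) + - (r * r' / k * ?E) * (z - a3) / (z - a1) + t * t' * ?E) / ((z - a1) * (z - a2) * (z - a3) ^ 2)"
    have "(1 - r - r') + (1 - s - s') + (1 - t - t') = 2" using sum by algebra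
    then have "riemann_equation D ?b1 ?b2" unfolding D by (rule riemann_equation_finite[OF ne])
    moreover have "realizes_monodromy D p ?b1 ?b2 \<rho>"
    proof (rule real, unfold pulled_back_def, intro allI impI conjI)
      fix z assume "Fin z \<notin> D"
      then have z: "z - a1 \<noteq> 0" "z - a2 \<noteq> 0" "z - a3 \<noteq> 0" using D by auto
      let ?m = "k * (z - a1) / (z - a3)"
      have pm: "riemann_p r r' s s' m * d = (1 - r - r') * (d / m) + (1 - s - s') * (d / (m - 1))" for m d
        by (simp add: riemann_p_def distrib_right)
      have qm: "riemann_q r r' s s' t t' m * d ^ 2 = (s * s' / (m - 1) - r * r' / m + t * t') * (d / m * (d / (m - 1)))" for m d
        by (simp add: riemann_q_def power2_eq_square)
      have distr: "(A * x / y - B * x / w + C) * (E / F) = (A * E * x / y + - (B * E) * x / w + C * E) / F" for A B C E F x y w :: complex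
        by (simp add: divide_inverse algebra_simps)
      \<comment> \<open>The logarithmic derivatives of \<open>?m\<close> and \<open>?m - 1\<close>:
        both have residue 1 at a zero and -1 at the common pole \<open>a3\<close>. Through them the
        coefficients of the pulled back equation become partial fractions, and Fuchs' relation gives
        the residue \<open>1 - t - t'\<close> at \<open>a3\<close>.\<close>
      have m0: "?m1 z / ?m = 1 / (z - a1) - 1 / (z - a3)"
        using z k0 by (simp add: divide_simps power2_eq_square)
      have mm: "?m - 1 = (k - 1) * (z - a2) / (z - a3)"
        using z d unfolding k_def by (simp add: divide_simps) (simp add: algebra_simps)
      have k1': "k - 1 \<noteq> 0" using k1 d by simp
      have m1': "?m1 z / (?m - 1) = 1 / (z - a2) - 1 / (z - a3)"
        unfolding mm using z d unfolding k1 k_def by (simp add: divide_simps power2_eq_square)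
      have m2': "?m2 z / ?m1 z = - 2 / (z - a3)"
        using z d k0 by (simp add: divide_simps power2_eq_square power3_eq_cube)
      have "riemann_p r r' s s' ?m * ?m1 z = (1 - r - r') * (?m1 z / ?m) + (1 - s - s') * (?m1 z / (?m - 1))"
        by (rule pm)
      also have "\<dots> - ?m2 z / ?m1 z = (1 - r - r') / (z - a1) + (1 - s - s') / (z - a2) + (2 - (1 - r - r') - (1 - s - s')) / (z - a3)"
        unfolding m0 m1' m2' by (simp add: algebra_simps add_divide_distrib diff_divide_distrib)
      also have "2 - (1 - r - r') - (1 - s - s') = 1 - t - t'" using sum by algebra
      finally show "?b1 z = riemann_p r r' s s' (?\<mu> (Fin z)) * ?m1 z - ?m2 z / ?m1 z" by simp
      have "(1 / (z - a1) - 1 / (z - a3)) * (1 / (z - a2) - 1 / (z - a3)) = ?E / ((z - a1) * (z - a2) * (z - a3) ^ 2)"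
        using z by (simp add: divide_simps power2_eq_square)
      then have mmm: "?m1 z / ?m * (?m1 z / (?m - 1)) = ?E / ((z - a1) * (z - a2) * (z - a3) ^ 2)"
        unfolding m0 m1' .
      have "riemann_q r r' s s' t t' ?m * ?m1 z ^ 2 = (s * s' / (?m - 1) - r * r' / ?m + t * t') * (?m1 z / ?m * (?m1 z / (?m - 1)))"
        by (rule qm)
      also have "\<dots> = (s * s' / (k - 1) * (z - a3) / (z - a2) - r * r' / k * (z - a3) / (z - a1) + t * t') * (?E / ((z - a1) * (z - a2) * (z - a3) ^ 2))"
        unfolding mmm unfolding mm by simp
      also have "\<dots> = ?b2 z"
        by (rule distr)
      finally show "?b2 z = riemann_q r r' s s' t t' (?\<mu> (Fin z)) * ?m1 z ^ 2" by simp
    qed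
    ultimately show ?thesis by blast
  qed
qed

theorem theorem1p1:
  fixes a1 a2 a3 p :: riemann_sphere
    and \<rho> :: "(real \<Rightarrow> riemann_sphere) set \<Rightarrow> complex ^ 2 ^ 2"
  assumes "distinct [a1, a2, a3]"
    and "p \<notin> {a1, a2, a3}"
    and "\<rho> \<in> hom (fundamental_group (- {a1, a2, a3}) p) GL2"
    and "irreducible_rep (fundamental_group (- {a1, a2, a3}) p) \<rho>"
  shows "\<exists>b1 b2. riemann_equation {a1, a2, a3} b1 b2 \<and>
                 realizes_monodromy {a1, a2, a3} p b1 b2 \<rho>"
proof -
  let ?D = "{a1, a2, a3}"
  \<comment> \<open>The statement depends on the set of singular points only, so they may be
    reordered to put \<open>Inf\<close>, if it occurs, in the last place.\<close>
  have "(\<exists>x y z. x \<noteq> y \<and> x \<noteq> z \<and> y \<noteq> z \<and> ?D = {Fin x, Fin y, Fin z}) \<or> (\<exists>x y. x \<noteq> y \<and> ?D = {Fin x, Fin y, Inf})"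
    using assms(1) by (cases a1; cases a2; cases a3) (auto simp: insert_commute)
  then show ?thesis
  proof (elim disjE exE conjE)
    fix x y z assume "x \<noteq> y" "x \<noteq> z" "y \<noteq> z" "?D = {Fin x, Fin y, Fin z}"
    then show ?thesis using realization_finite[OF _ _ _ _ assms(2-4)] by blast
  next
    fix x y assume "x \<noteq> y" "?D = {Fin x, Fin y, Inf}"
    then show ?thesis using realization_with_infinity[OF _ _ assms(2-4)] by blast
  qed
qed

end
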